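(* Let $1<p,q<\infty$ with $1/p+1/q=1$, let $M=(m_i)_{i\ge1}$ and $N=(n_i)_{i\ge1}$ satisfy conditions (i) and (ii) below, and let $\mathcal N$ be an $(M,N,q)$-Schreier norming set with associated Banach space $X_{\mathcal N}$. Then: (1) there is a bounded linear operator $T$ on $X_{\mathcal N}$ which is not of the form $\lambda I+K$ with $\lambda$ a scalar and $K$ a compact operator on $X_{\mathcal N}$; (2) if $X_{\mathcal N}$ is hereditarily indecomposable, this operator $T$ is strictly singular (and non-compact); (3) $\ell_\infty$ embeds isomorphically into $\mathcal L(X_{\mathcal N})$, the space of bounded linear operators on $X_{\mathcal N}$.
   Context: Notation. $c_{00}$ is the space of finitely supported real sequences, $(e_i)_{i\ge1}$ its unit vector basis and $(e_i^* )_{i\ge1}$ the biorthogonal functionals. For $x=\sum_i a_ie_i$ (or a functional $x^*=\sum_i a_ie_i^*$), ${\rm supp}\,x=\{i:a_i\neq0\}$. For finite $E,F\subset\mathbb N$, $E<F$ means $\max E<\min F$; for $n\in\mathbb N$, "$F\ge n$" (resp. "${\rm supp}\,x\ge n$") means $\min F\ge n$ (resp. $\min{\rm supp}\,x\ge n$). $Ba(\ell_q)$ is the closed unit ball of $\ell_q$ (applied to finite scalar sequences). For an interval $E\subset\mathbb N$ and a functional $x^*$, $Ex^*$ is the restriction of $x^*$ to the coordinates in $E$. Schreier families: $S_0=\{\{n\}:n\in\mathbb N\}\cup\{\emptyset\}$ and $S_{n+1}=\{\bigcup_{i=1}^mF_i: m\in\mathbb N,\ F_i\in S_n,\ m\le\min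 F_1,\ F_1<\dots<F_m\}\cup\{\emptyset\}$. Successive finite sets $E_1<\dots<E_k$ are $S_n$-admissible if $\{\min E_1,\dots,\min E_k\}\in S_n$; a finite block sequence $x_1,\dots,x_k$ of vectors or functionals (${\rm supp}\,x_1<\dots<{\rm supp}\,x_k$) is $S_n$-admissible if $({\rm supp}\,x_i)_{i=1}^k$ is. Sequences. $M=(m_i)$, $N=(n_i)$ are increasing sequences of positive integers such that (i) $m_1>3$, $m_2=m_1^5$, $m_{2j+1}=m_{2j}^5$ for $j\ge1$, and there is an increasing sequence $(s_i)$ of positive integers with $m_{2j}=\prod_{i=1}^{j-1}m_{2i}^{s_i}$ for $j\ge2$; (ii) defining for $j\ge2$ $f_j=\max\{\rho n_1+\sum_{1\le i<j}\rho_in_{2i}:\ \rho,\rho_i\in\mathbb N\cup\{0\},\ m_1^{\rho}\prod_{1\le i<j}m_{2i}^{\rho_i}<m_{2j}\}$, one has $4f_j<n_{2j}$ for all $j\ge2$, and $5n_1<n_2$. Norming sets. A set $\mathcal N\subset{\rm span}\{e_i^*\}$ is norming if it contains every $e_n^*$, satisfies $|x^*(e_n)|\le1$ for all $x^*\in\mathcal N$, $n\in\mathbb N$, is symmetric ($x^*\in\mathcal N\Rightarrow -x^*\in\mathcal N$), and $Ex^*\in\mathcal N$ for all $x^*\in\mathcal N$ and intervals $E\subset\mathbb N$. Then $\|x\|_{\mathcal N}=\sup\{x^*(x):x^*\in\mathcal N\}$ is a norm on $c_{00}$ and $X_{\mathcal N}$ is its completion; $(e_i)$ is a normalized bimonotone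 basis of $X_{\mathcal N}$, and elements of ${\rm span}\{e_i^*\}$ are regarded as elements of $X_{\mathcal N}^*$. $(M,N,q)$-Schreier. Let $1<p,q<\infty$, $1/p+1/q=1$. For $k\ge1$ let $\mathcal N_k$ be the set of all $\frac1{m_{2k}}\sum_{i=1}^d\gamma_ix_i^*$ where $d\in\mathbb N$, $(\gamma_i)_{i=1}^d\in Ba(\ell_q)$, and $x_1^*,\dots,x_d^*\in\mathcal N$ is an $S_{n_{2k}}$-admissible block sequence. Let $\mathcal N^q_\infty$ be the union over $k\ge0$ of the sets of all $\frac1{m_{2k+1}}\sum_{i=1}^d\gamma_iEx_i^*$ where $(\gamma_i)\in 2^{1/p}Ba(\ell_q)$, $E$ is an interval of $\mathbb N$, $x_1^*,\dots,x_d^*$ is an $S_{n_{2k+1}}$-admissible block sequence with $x_i^*\in\mathcal N_{j_i}$ and $j_1,\dots,j_d$ pairwise distinct. A norming set $\mathcal N$ is $(M,N,q)$-Schreier if $\mathcal N_j\subset\mathcal N$ for all $j\ge1$ and $\mathcal N\subset\bigcup_{j\ge1}\mathcal N_j\cup\mathcal N^q_\infty\cup\{\pm e_n^*:n\in\mathbb N\}$. A Banach space is hereditarily indecomposable (HI) if no closed infinite-dimensional subspace is a direct sum of two closed infinite-dimensional subspaces. An operator is strictly singular if its restriction to no infinite-dimensional subspace is an isomorphism. *)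

theory Defs
  imports Complex_Main
begin

section \<open>Vectors and functionals on c00 (coordinates indexed by positive integers)\<close>

definition supp :: "(nat \<Rightarrow> real) \<Rightarrow> nat set" where
  "supp f = {i. f i \<noteq> 0}"

definition unitf :: "nat \<Rightarrow> nat \<Rightarrow> real" where
  "unitf n = (\<lambda>i. if i = n then 1 else 0)"

definition restr :: "nat set \<Rightarrow> (nat \<Rightarrow> real) \<Rightarrow> nat \<Rightarrow> real" where
  "restr E f = (\<lambda>i. if i \<in> E then f i else 0)"

definition is_interval :: "nat set \<Rightarrow> bool" where
  "is_interval E \<longleftrightarrow> (\<exists>a b. E = {a..b})"

definition act :: "(nat \<Rightarrow> real) \<Rightarrow> (nat \<Rightarrow> real) \<Rightarrow> real" where
  "act f x = (\<Sum>i\<in>supp f. f i * x i)"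

definition set_less :: "nat set \<Rightarrow> nat set \<Rightarrow> bool" where
  "set_less E F \<longleftrightarrow> (\<forall>a\<in>E. \<forall>b\<in>F. a < b)"

fun schreier :: "nat \<Rightarrow> nat set set" where
  "schreier 0 = insert {} ((\<lambda>k. {k}) ` {k. 1 \<le> k})"
| "schreier (Suc n) = insert {}
     {\<Union>(set Fs) | Fs. Fs \<noteq> [] \<and> (\<forall>F\<in>set Fs. F \<in> schreier n \<and> F \<noteq> {})
        \<and> sorted_wrt set_less Fs \<and> length Fs \<le> Min (hd Fs)}"

definition admissible_sets :: "nat \<Rightarrow> nat set list \<Rightarrow> bool" where
  "admissible_sets n Es \<longleftrightarrow> (\<forall>E\<in>set Es. finite E \<and> E \<noteq> {}) \<and> sorted_wrt set_less Es
     \<and> Min ` set Es \<in> schreier n"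

definition admissible :: "nat \<Rightarrow> (nat \<Rightarrow> real) list \<Rightarrow> bool" where
  "admissible n fs \<longleftrightarrow> admissible_sets n (map supp fs)"

definition lin_comb :: "(nat \<Rightarrow> real) \<Rightarrow> (nat \<Rightarrow> real) list \<Rightarrow> nat \<Rightarrow> real" where
  "lin_comb \<gamma> fs = (\<lambda>i. \<Sum>k<length fs. \<gamma> k * (fs ! k) i)"

definition in_ball_lq :: "real \<Rightarrow> real \<Rightarrow> nat \<Rightarrow> (nat \<Rightarrow> real) \<Rightarrow> bool" where
  "in_ball_lq q r d \<gamma> \<longleftrightarrow> (\<Sum>k<d. \<bar>\<gamma> k\<bar> powr q) \<le> r powr q"

definition incr_pos :: "(nat \<Rightarrow> nat) \<Rightarrow> bool" where
  "incr_pos m \<longleftrightarrow> 0 < m 1 \<and> (\<forall>i\<ge>1. m i < m (Suc i))"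

definition fval :: "(nat \<Rightarrow> nat) \<Rightarrow> (nat \<Rightarrow> nat) \<Rightarrow> nat \<Rightarrow> nat" where
  "fval m n j = Max {\<rho> * n 1 + (\<Sum>i\<in>{1..<j}. \<rho>s i * n (2*i)) | \<rho> \<rho>s.
      m 1 ^ \<rho> * (\<Prod>i\<in>{1..<j}. m (2*i) ^ \<rho>s i) < m (2*j)}"

definition cond_MN :: "(nat \<Rightarrow> nat) \<Rightarrow> (nat \<Rightarrow> nat) \<Rightarrow> bool" where
  "cond_MN m n \<longleftrightarrow> incr_pos m \<and> incr_pos n
     \<and> m 1 > 3 \<and> m 2 = m 1 ^ 5 \<and> (\<forall>j\<ge>1. m (2*j+1) = m (2*j) ^ 5)
     \<and> (\<exists>s. incr_pos s \<and> (\<forall>j\<ge>2. m (2*j) = (\<Prod>i\<in>{1..<j}. m (2*i) ^ s i)))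
     \<and> (\<forall>j\<ge>2. 4 * fval m n j < n (2*j)) \<and> 5 * n 1 < n 2"

definition norming :: "(nat \<Rightarrow> real) set \<Rightarrow> bool" where
  "norming NN \<longleftrightarrow>
     (\<forall>f\<in>NN. finite (supp f) \<and> f 0 = 0) \<and>
     (\<forall>n\<ge>1. unitf n \<in> NN) \<and>
     (\<forall>f\<in>NN. \<forall>n. \<bar>f n\<bar> \<le> 1) \<and>
     (\<forall>f\<in>NN. (\<lambda>i. - f i) \<in> NN) \<and>
     (\<forall>f\<in>NN. \<forall>E. is_interval E \<longrightarrow> restr E f \<in> NN)"

definition Nk :: "(nat \<Rightarrow> nat) \<Rightarrow> (nat \<Rightarrow> nat) \<Rightarrow> real \<Rightarrow> (nat \<Rightarrow> real) set \<Rightarrow> nat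
    \<Rightarrow> (nat \<Rightarrow> real) set" where
  "Nk m n q NN k = {(\<lambda>i. lin_comb \<gamma> fs i / real (m (2*k))) | \<gamma> fs.
      fs \<noteq> [] \<and> in_ball_lq q 1 (length fs) \<gamma> \<and> set fs \<subseteq> NN \<and> admissible (n (2*k)) fs}"

definition Ninf :: "(nat \<Rightarrow> nat) \<Rightarrow> (nat \<Rightarrow> nat) \<Rightarrow> real \<Rightarrow> real \<Rightarrow> (nat \<Rightarrow> real) set
    \<Rightarrow> (nat \<Rightarrow> real) set" where
  "Ninf m n p q NN = {(\<lambda>i. restr E (lin_comb \<gamma> fs) i / real (m (2*k+1))) | k \<gamma> E fs.
      fs \<noteq> [] \<and> in_ball_lq q (2 powr (1/p)) (length fs) \<gamma> \<and> is_interval E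
      \<and> admissible (n (2*k+1)) fs
      \<and> (\<exists>js. length js = length fs \<and> distinct js \<and> (\<forall>l<length fs. 1 \<le> js ! l \<and> fs ! l \<in> Nk m n q NN (js ! l)))}"

definition MNq_schreier :: "(nat \<Rightarrow> nat) \<Rightarrow> (nat \<Rightarrow> nat) \<Rightarrow> real \<Rightarrow> real
    \<Rightarrow> (nat \<Rightarrow> real) set \<Rightarrow> bool" where
  "MNq_schreier m n p q NN \<longleftrightarrow> norming NN \<and> (\<forall>j\<ge>1. Nk m n q NN j \<subseteq> NN) \<and>
     NN \<subseteq> (\<Union>j\<in>{1..}. Nk m n q NN j) \<union> Ninf m n p q NN
           \<union> {unitf k | k. 1 \<le> k} \<union> {(\<lambda>i. - unitf k i) | k. 1 \<le> k}"

section \<open>The space X_N (completion of c00, realised as a space of coordinate sequences)\<close>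

definition nnorm :: "(nat \<Rightarrow> real) set \<Rightarrow> (nat \<Rightarrow> real) \<Rightarrow> real" where
  "nnorm NN x = Sup ((\<lambda>f. act f x) ` NN)"

definition XN :: "(nat \<Rightarrow> real) set \<Rightarrow> (nat \<Rightarrow> real) set" where
  "XN NN = {x. x 0 = 0 \<and> bdd_above ((\<lambda>f. act f x) ` NN) \<and>
      (\<lambda>k. nnorm NN (\<lambda>i. if i \<le> k then 0 else x i)) \<longlonglongrightarrow> 0}"

definition bounded_op :: "(nat \<Rightarrow> real) set \<Rightarrow> ((nat \<Rightarrow> real) \<Rightarrow> nat \<Rightarrow> real) \<Rightarrow> bool" where
  "bounded_op NN T \<longleftrightarrow> (\<forall>x\<in>XN NN. T x \<in> XN NN)
     \<and> (\<forall>x\<in>XN NN. \<forall>y\<in>XN NN. T (\<lambda>i. x i + y i) = (\<lambda>i. T x i + T y i))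
     \<and> (\<forall>x\<in>XN NN. \<forall>c. T (\<lambda>i. c * x i) = (\<lambda>i. c * T x i))
     \<and> (\<exists>C. \<forall>x\<in>XN NN. nnorm NN (T x) \<le> C * nnorm NN x)"

definition op_norm :: "(nat \<Rightarrow> real) set \<Rightarrow> ((nat \<Rightarrow> real) \<Rightarrow> nat \<Rightarrow> real) \<Rightarrow> real" where
  "op_norm NN T = Sup {nnorm NN (T x) | x. x \<in> XN NN \<and> nnorm NN x \<le> 1}"

text \<open>compact: image of the unit ball is relatively compact, i.e. totally bounded
  (X_N being complete)\<close>
definition compact_op :: "(nat \<Rightarrow> real) set \<Rightarrow> ((nat \<Rightarrow> real) \<Rightarrow> nat \<Rightarrow> real) \<Rightarrow> bool" where
  "compact_op NN K \<longleftrightarrow> bounded_op NN K \<and>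
     (\<forall>\<epsilon>>0. \<exists>F. finite F \<and> F \<subseteq> XN NN \<and>
        (\<forall>x\<in>XN NN. nnorm NN x \<le> 1 \<longrightarrow> (\<exists>y\<in>F. nnorm NN (\<lambda>i. K x i - y i) < \<epsilon>)))"

definition subspace_X :: "(nat \<Rightarrow> real) set \<Rightarrow> (nat \<Rightarrow> real) set \<Rightarrow> bool" where
  "subspace_X NN Y \<longleftrightarrow> Y \<subseteq> XN NN \<and> (\<lambda>i. 0) \<in> Y
     \<and> (\<forall>x\<in>Y. \<forall>y\<in>Y. (\<lambda>i. x i + y i) \<in> Y) \<and> (\<forall>x\<in>Y. \<forall>c. (\<lambda>i. c * x i) \<in> Y)"

definition closed_X :: "(nat \<Rightarrow> real) set \<Rightarrow> (nat \<Rightarrow> real) set \<Rightarrow> bool" where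
  "closed_X NN Y \<longleftrightarrow> (\<forall>s x. (\<forall>k. s k \<in> Y) \<and> x \<in> XN NN
      \<and> (\<lambda>k. nnorm NN (\<lambda>i. s k i - x i)) \<longlonglongrightarrow> 0 \<longrightarrow> x \<in> Y)"

definition lin_indep :: "(nat \<Rightarrow> real) list \<Rightarrow> bool" where
  "lin_indep vs \<longleftrightarrow> (\<forall>c. lin_comb c vs = (\<lambda>i. 0) \<longrightarrow> (\<forall>k<length vs. c k = 0))"

definition inf_dim :: "(nat \<Rightarrow> real) set \<Rightarrow> bool" where
  "inf_dim Y \<longleftrightarrow> (\<forall>d. \<exists>vs. length vs = d \<and> set vs \<subseteq> Y \<and> lin_indep vs)"

definition hered_indec :: "(nat \<Rightarrow> real) set \<Rightarrow> bool" where
  "hered_indec NN \<longleftrightarrow> \<not> (\<exists>Y Z W.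
      subspace_X NN Y \<and> closed_X NN Y \<and> inf_dim Y \<and>
      subspace_X NN Z \<and> closed_X NN Z \<and> inf_dim Z \<and>
      subspace_X NN W \<and> closed_X NN W \<and> inf_dim W \<and>
      Z \<inter> W = {(\<lambda>i. 0)} \<and> Y = {(\<lambda>i. z i + w i) | z w. z \<in> Z \<and> w \<in> W})"

definition strictly_singular :: "(nat \<Rightarrow> real) set \<Rightarrow> ((nat \<Rightarrow> real) \<Rightarrow> nat \<Rightarrow> real) \<Rightarrow> bool" where
  "strictly_singular NN T \<longleftrightarrow> bounded_op NN T \<and>
     (\<forall>Y. subspace_X NN Y \<and> inf_dim Y \<longrightarrow>
        \<not> (\<exists>c>0. \<forall>y\<in>Y. c * nnorm NN y \<le> nnorm NN (T y)))"

definition bounded_seq :: "(nat \<Rightarrow> real) \<Rightarrow> bool" where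
  "bounded_seq a \<longleftrightarrow> bdd_above (range (\<lambda>i. \<bar>a i\<bar>))"

definition sup_norm :: "(nat \<Rightarrow> real) \<Rightarrow> real" where
  "sup_norm a = Sup (range (\<lambda>i. \<bar>a i\<bar>))"

definition linf_embeds :: "(nat \<Rightarrow> real) set \<Rightarrow> bool" where
  "linf_embeds NN \<longleftrightarrow> (\<exists>J :: (nat \<Rightarrow> real) \<Rightarrow> (nat \<Rightarrow> real) \<Rightarrow> nat \<Rightarrow> real.
     (\<forall>a. bounded_seq a \<longrightarrow> bounded_op NN (J a)) \<and>
     (\<forall>a b. bounded_seq a \<and> bounded_seq b \<longrightarrow>
        (\<forall>x\<in>XN NN. J (\<lambda>i. a i + b i) x = (\<lambda>i. J a x i + J b x i))) \<and>
     (\<forall>a c. bounded_seq a \<longrightarrow> (\<forall>x\<in>XN NN. J (\<lambda>i. c * a i) x = (\<lambda>i. c * J a x i))) \<and>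
     (\<exists>c C. 0 < c \<and> (\<forall>a. bounded_seq a \<longrightarrow>
        c * sup_norm a \<le> op_norm NN (J a) \<and> op_norm NN (J a) \<le> C * sup_norm a)))"

end

theory Submission
  imports Defs "HOL-Analysis.Convex"
begin

text \<open>
  Unwinding the norming set, the coordinates of \<open>f \<in> \<N>\<close> that come from branches of total weight
  below \<open>m (2*j)\<close> form a Schreier set of order \<open>\<kappa> j\<close>, and the remaining ones have \<open>\<ell>\<^sub>q\<close>-norm at most
  \<open>1 / m (2*j)\<close>. Since \<open>m (2*l)\<close> is a product of powers of the earlier even weights, the functional
  \<open>x\<^sub>k\<^sup>* = (1 / m (2*l)) \<Sum>\<gamma>\<^sub>t e\<^sub>t\<^sup>*\<close> with \<open>l = k + 2\<close>, spread over a Schreier set of order \<open>\<kappa> l + 1\<close>, can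
  be rebuilt with outermost weight \<open>m (2*j)\<close> and outermost order \<open>\<kappa> j + 1\<close> for every \<open>2 \<le> j \<le> l\<close>.
  As \<open>2 * \<kappa> j + 1 \<le> n (2*j)\<close>, combinations of the \<open>x\<^sub>k\<^sup>*\<close> over Schreier sets of order \<open>\<kappa> j\<close> with
  coefficients in the ball of \<open>\<ell>\<^sub>q\<close> again belong to \<open>\<N>\<close>. Splitting \<open>f\<close> into its levels shows that all
  operators \<open>x \<mapsto> \<Sum>b\<^sub>k x\<^sub>k\<^sup>*(x) e\<^sub>k\<close> with bounded \<open>b\<close> are bounded. The order \<open>\<kappa> l + 1\<close> exceeds the order of
  the heavy part of any \<open>f\<close>, so repeated averages provide bounded vectors biorthogonal to the
  \<open>x\<^sub>k\<^sup>*\<close>; hence the operators are not compact and depend on \<open>b\<close> isomorphically. Gaps between the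
  supports give infinitely many unit vectors in the kernel, which excludes a nonzero scalar part and,
  in a hereditarily indecomposable space, forces strict singularity.
\<close>

section \<open>Schreier families\<close>

text \<open>An odd node may have a huge admissibility order \<open>n (2*k+1)\<close>, so adding up
  orders along a branch would not bound the heavy part. The distinct weights of its children help:
  fewer than \<open>j\<close> of them have weight below \<open>m (2*j)\<close>, and only these can
  carry heavy coordinates. Beyond coordinate \<open>j\<close> so few pieces have minima forming a
  Schreier set of order 1, so an odd node costs a single order. The price is that the heavy part is
  controlled only from \<open>j\<close> on; earlier coordinates are estimated one by one, and the
  resulting factor \<open>j + 1\<close> is beaten by the decay of \<open>1 / m (2*j)\<close>.

  Two demands fix the order \<open>\<kappa> l + 1\<close> of the blocks. One order above the heavy
  part is enough for averages that are almost invisible to it. Conversely, when the weight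
  \<open>m (2*j)\<close> is moved outermost, the index set contributes \<open>\<kappa> j\<close> and
  the blocks \<open>\<kappa> j + 1\<close>; the factor 4 in the growth condition on \<open>N\<close>
  leaves room for the sum.\<close>

lemma schreier_empty [simp]: "{} \<in> schreier n"
  by (cases n) auto

lemma schreier_finite: "F \<in> schreier n \<Longrightarrow> finite F"
  by (induction n arbitrary: F) auto

lemma schreier_pos: "F \<in> schreier n \<Longrightarrow> t \<in> F \<Longrightarrow> 1 \<le> t"
  by (induction n arbitrary: F) auto

text \<open>Empty pieces are allowed and the length is compared with every point, so families
  obtained by restriction or reindexing need no preparation. Filtering out empty pieces only
  shortens the list.\<close>

lemma schreier_SucI:
  assumes "\<And>F. F \<in> set Fs \<Longrightarrow> F \<in> schreier n" and "sorted_wrt set_less Fs"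
    and len: "\<And>t. t \<in> \<Union>(set Fs) \<Longrightarrow> length Fs \<le> t"
  shows "\<Union>(set Fs) \<in> schreier (Suc n)"
proof -
  define Gs where "Gs = filter (\<lambda>F. F \<noteq> {}) Fs"
  have U: "\<Union>(set Fs) = \<Union>(set Gs)" unfolding Gs_def by auto
  show ?thesis
  proof (cases "Gs = []")
    case True
    then show ?thesis by (simp add: U)
  next
    case False
    then have h: "hd Gs \<in> set Gs" by simp
    then have h': "hd Gs \<in> schreier n" "hd Gs \<noteq> {}" "hd Gs \<in> set Fs"
      using assms(1) by (auto simp: Gs_def)
    have "Min (hd Gs) \<in> hd Gs" using h' schreier_finite by (simp add: Min_in)
    then have "length Fs \<le> Min (hd Gs)" using len h'(3) by blast
    moreover have "length Gs \<le> length Fs" by (simp add: Gs_def)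
    ultimately have "length Gs \<le> Min (hd Gs)" by linarith
    moreover have "sorted_wrt set_less Gs" using assms(2) by (simp add: Gs_def sorted_wrt_filter)
    moreover have "\<forall>F\<in>set Gs. F \<in> schreier n \<and> F \<noteq> {}" using assms(1) by (auto simp: Gs_def)
    ultimately show ?thesis unfolding U using False by auto
  qed
qed

lemma schreier_SucE:
  assumes "F \<in> schreier (Suc n)" "F \<noteq> {}"
  obtains Fs where "F = \<Union>(set Fs)" "\<And>G. G \<in> set Fs \<Longrightarrow> G \<in> schreier n"
    "\<And>G. G \<in> set Fs \<Longrightarrow> G \<noteq> {}" "sorted_wrt set_less Fs" "\<And>t. t \<in> F \<Longrightarrow> length Fs \<le> t"
proof -
  from assms obtain Fs where Fs: "F = \<Union>(set Fs)" "Fs \<noteq> []"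
    "\<forall>G\<in>set Fs. G \<in> schreier n \<and> G \<noteq> {}" "sorted_wrt set_less Fs" "length Fs \<le> Min (hd Fs)"
    by auto
  have "length Fs \<le> t" if "t \<in> F" for t
  proof -
    obtain A As where A: "Fs = A # As" using Fs(2) by (cases Fs) auto
    have fin: "finite A" "A \<noteq> {}" using Fs(3) A schreier_finite by auto
    then have mA: "Min A \<in> A" by simp
    have "Min A \<le> t"
    proof (cases "t \<in> A")
      case True
      then show ?thesis using fin by simp
    next
      case False
      then obtain B where "B \<in> set As" "t \<in> B" using \<open>t \<in> F\<close> Fs(1) A by auto
      then have "Min A < t" using Fs(4) A mA by (auto simp: set_less_def)
      then show ?thesis by simp
    qed
    then show ?thesis using Fs(5) A by simp
  qed
  then show ?thesis using that[of Fs] Fs by blast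
qed

declare schreier.simps(2) [simp del]

lemma sorted_set_less_cases:
  assumes "sorted_wrt set_less Fs" "A \<in> set Fs" "B \<in> set Fs" "A \<noteq> B"
  shows "set_less A B \<or> set_less B A"
proof -
  obtain i j where "i < length Fs" "j < length Fs" "A = Fs ! i" "B = Fs ! j"
    using assms by (auto simp: in_set_conv_nth)
  then show ?thesis using assms by (metis linorder_neqE_nat sorted_wrt_nth_less)
qed

lemma schreier_singleton: "1 \<le> k \<Longrightarrow> {k} \<in> schreier n"
proof (induction n)
  case (Suc n)
  then show ?case using schreier_SucI[of "[{k}]" n] by auto
qed auto

text \<open>Heredity, spreading and inclusion between the families are the special cases of this lemma
  in which each \<open>G i\<close> has at most one point.\<close>

lemma schreier_compose:
  assumes "I \<in> schreier a" and "\<And>i. i \<in> I \<Longrightarrow> G i \<in> schreier b"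
    and "\<And>i t. i \<in> I \<Longrightarrow> t \<in> G i \<Longrightarrow> i \<le> t"
    and "\<And>i j. i \<in> I \<Longrightarrow> j \<in> I \<Longrightarrow> i < j \<Longrightarrow> set_less (G i) (G j)"
  shows "(\<Union>i\<in>I. G i) \<in> schreier (a + b)"
  using assms
proof (induction a arbitrary: I)
  case 0
  then show ?case by auto
next
  case (Suc a)
  show ?case
  proof (cases "I = {}")
    case False
    then obtain Is where Is: "I = \<Union>(set Is)" "\<And>G. G \<in> set Is \<Longrightarrow> G \<in> schreier a"
      "sorted_wrt set_less Is" "\<And>t. t \<in> I \<Longrightarrow> length Is \<le> t"
      using schreier_SucE[OF Suc.prems(1)] by metis
    define Us where "Us = map (\<lambda>J. \<Union>i\<in>J. G i) Is"
    have U: "(\<Union>i\<in>I. G i) = \<Union>(set Us)" unfolding Us_def Is(1) by auto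
    have "\<Union>(set Us) \<in> schreier (Suc (a + b))"
    proof (rule schreier_SucI)
      fix F assume "F \<in> set Us"
      then obtain J where J: "J \<in> set Is" "F = (\<Union>i\<in>J. G i)" by (auto simp: Us_def)
      then have "J \<subseteq> I" using Is(1) by auto
      then show "F \<in> schreier (a + b)" unfolding J(2)
        by (intro Suc.IH Is(2) J(1) Suc.prems(2-4)) blast+
    next
      have "set_less (\<Union>i\<in>J. G i) (\<Union>i\<in>K. G i)"
        if "J \<in> set Is" "K \<in> set Is" "set_less J K" for J K
      proof -
        have "J \<subseteq> I" "K \<subseteq> I" using Is(1) that by auto
        then have "set_less (G i) (G j)" if "i \<in> J" "j \<in> K" for i j
          using Suc.prems(4)[of i j] that \<open>set_less J K\<close> by (auto simp: set_less_def)
        then show ?thesis unfolding set_less_def by blast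
      qed
      then show "sorted_wrt set_less Us" unfolding Us_def sorted_wrt_map
        by (rule sorted_wrt_mono_rel[OF _ Is(3)])
    next
      fix t assume "t \<in> \<Union>(set Us)"
      then obtain i where "i \<in> I" "t \<in> G i" using U by auto
      then show "length Us \<le> t" using Is(4)[of i] Suc.prems(3)[of i t] by (simp add: Us_def)
    qed
    then show ?thesis using U by simp
  qed simp
qed

text \<open>Pieces are often labelled by positions in a list of children, whereas composition wants
  points as labels. An injective \<open>\<mu>\<close> transfers the labels.\<close>

lemma schreier_compose_indexed:
  assumes "\<mu> ` R \<in> schreier a" "inj_on \<mu> R" and "\<And>r. r \<in> R \<Longrightarrow> G r \<in> schreier b"
    and "\<And>r t. r \<in> R \<Longrightarrow> t \<in> G r \<Longrightarrow> \<mu> r \<le> t"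
    and "\<And>r r'. r \<in> R \<Longrightarrow> r' \<in> R \<Longrightarrow> \<mu> r < \<mu> r' \<Longrightarrow> set_less (G r) (G r')"
  shows "(\<Union>r\<in>R. G r) \<in> schreier (a + b)"
proof -
  have "(\<Union>i\<in>\<mu> ` R. G (inv_into R \<mu> i)) \<in> schreier (a + b)"
  proof (rule schreier_compose[OF assms(1)])
    show "G (inv_into R \<mu> i) \<in> schreier b" if "i \<in> \<mu> ` R" for i
      using that assms(3) by (simp add: inv_into_into)
    show "i \<le> t" if "i \<in> \<mu> ` R" "t \<in> G (inv_into R \<mu> i)" for i t
      using that assms(4) by (metis f_inv_into_f inv_into_into)
    show "set_less (G (inv_into R \<mu> i)) (G (inv_into R \<mu> j))"
      if "i \<in> \<mu> ` R" "j \<in> \<mu> ` R" "i < j" for i j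
      using that assms(5) by (metis f_inv_into_f inv_into_into)
  qed
  moreover have "(\<Union>i\<in>\<mu> ` R. G (inv_into R \<mu> i)) = (\<Union>r\<in>R. G r)"
    using assms(2) by (simp add: inv_into_f_f)
  ultimately show ?thesis by simp
qed

lemma schreier_subset:
  assumes "F \<in> schreier n" "H \<subseteq> F"
  shows "H \<in> schreier n"
proof -
  have "(\<Union>i\<in>F. if i \<in> H then {i} else {}) \<in> schreier (n + 0)"
    by (rule schreier_compose[OF assms(1)])
      (use schreier_pos[OF assms(1)] schreier_singleton[of _ 0] in
        \<open>auto simp: set_less_def split: if_splits\<close>)
  moreover have "(\<Union>i\<in>F. if i \<in> H then {i} else {}) = H" using assms(2) by auto
  ultimately show ?thesis by simp
qed

lemma schreier_mono:
  assumes "F \<in> schreier a" "a \<le> b"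
  shows "F \<in> schreier b"
proof -
  have "(\<Union>i\<in>F. {i}) \<in> schreier (a + (b - a))"
    by (rule schreier_compose[OF assms(1)])
      (use schreier_pos[OF assms(1)] schreier_singleton in \<open>auto simp: set_less_def\<close>)
  then show ?thesis using assms(2) by simp
qed

lemma schreier_1I:
  assumes "finite I" "\<And>t. t \<in> I \<Longrightarrow> 1 \<le> t \<and> card I \<le> t"
  shows "I \<in> schreier 1"
proof -
  have "\<Union>(set (map (\<lambda>x. {x}) (sorted_list_of_set I))) \<in> schreier (Suc 0)"
  proof (rule schreier_SucI)
    show "sorted_wrt set_less (map (\<lambda>x. {x}) (sorted_list_of_set I))"
      using assms(1) strict_sorted_list_of_set[of I] by (simp add: sorted_wrt_map set_less_def)
  qed (use assms in auto)
  then show ?thesis using assms(1) by simp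
qed

text \<open>Converse of composition: unfolding the definition \<open>a\<close> times stops at pieces
  of order \<open>b\<close>, and each piece is labelled by its least point.\<close>

lemma schreier_split:
  assumes "F \<in> schreier (a + b)" "F \<noteq> {}"
  shows "\<exists>I P. I \<subseteq> F \<and> I \<in> schreier a \<and> I \<noteq> {} \<and> F = (\<Union>i\<in>I. P i) \<and>
    (\<forall>i\<in>I. P i \<in> schreier b \<and> i \<in> P i \<and> (\<forall>t\<in>P i. i \<le> t)) \<and>
    (\<forall>i\<in>I. \<forall>j\<in>I. i < j \<longrightarrow> set_less (P i) (P j))"
  using assms
proof (induction a arbitrary: F)
  case 0
  have fin: "finite F" using 0 schreier_finite by blast
  then have "Min F \<in> F" using 0 by simp
  moreover then have "{Min F} \<in> schreier 0" using 0 schreier_pos by (intro schreier_singleton) auto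
  ultimately show ?case using 0 fin
    by (intro exI[of _ "{Min F}"] exI[of _ "\<lambda>_. F"]) auto
next
  case (Suc a)
  obtain Fs where Fs: "F = \<Union>(set Fs)" "\<And>G. G \<in> set Fs \<Longrightarrow> G \<in> schreier (a + b)"
      "\<And>G. G \<in> set Fs \<Longrightarrow> G \<noteq> {}"
      "sorted_wrt set_less Fs" "\<And>t. t \<in> F \<Longrightarrow> length Fs \<le> t"
    using schreier_SucE[of F "a + b"] Suc.prems by auto
  define R where "R G I P \<longleftrightarrow> I \<subseteq> G \<and> I \<in> schreier a \<and> I \<noteq> {} \<and> G = (\<Union>i\<in>I. P i) \<and>
    (\<forall>i\<in>I. P i \<in> schreier b \<and> i \<in> P i \<and> (\<forall>t\<in>P i. i \<le> t)) \<and>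
    (\<forall>i\<in>I. \<forall>j\<in>I. i < j \<longrightarrow> set_less (P i) (P j))" for G I P
  have "\<forall>G\<in>set Fs. \<exists>I P. R G I P" unfolding R_def by (intro ballI Suc.IH Fs(2,3))
  then obtain J Q where "\<And>G. G \<in> set Fs \<Longrightarrow> R G (J G) (Q G)" by metis
  then have JQ: "J G \<subseteq> G" "J G \<in> schreier a" "J G \<noteq> {}" "(\<Union>i\<in>J G. Q G i) = G"
      "\<And>i. i \<in> J G \<Longrightarrow> Q G i \<in> schreier b \<and> i \<in> Q G i \<and> (\<forall>t\<in>Q G i. i \<le> t)"
      "\<And>i j. i \<in> J G \<Longrightarrow> j \<in> J G \<Longrightarrow> i < j \<Longrightarrow> set_less (Q G i) (Q G j)"
    if "G \<in> set Fs" for G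
    using that unfolding R_def by blast+
  have uniq: "A = B" if "A \<in> set Fs" "B \<in> set Fs" "t \<in> A" "t \<in> B" for A B t
    using sorted_set_less_cases[OF Fs(4) that(1,2)] that(3,4) by (auto simp: set_less_def)
  \<comment> \<open>\<open>P\<close> must depend on the point alone, so a point has to remember
    which piece of \<open>Fs\<close> it came from; disjointness makes that piece unique.\<close>
  define own where "own i = (THE G. G \<in> set Fs \<and> i \<in> G)" for i
  have own: "own i = G" if "G \<in> set Fs" "i \<in> G" for i G
    unfolding own_def by (rule the_equality) (use that uniq in auto)
  define I where "I = \<Union>(set (map J Fs))"
  define P where "P i = Q (own i) i" for i
  have P: "P i = Q G i" if "G \<in> set Fs" "i \<in> J G" for i G
    using that own[of G i] JQ(1)[of G] by (auto simp: P_def)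
  have "I \<in> schreier (Suc a)" unfolding I_def
  proof (rule schreier_SucI)
    show "sorted_wrt set_less (map J Fs)" unfolding sorted_wrt_map
    proof (rule sorted_wrt_mono_rel[OF _ Fs(4)])
      show "set_less (J A) (J B)" if "A \<in> set Fs" "B \<in> set Fs" "set_less A B" for A B
        using that JQ(1)[of A] JQ(1)[of B] unfolding set_less_def by blast
    qed
    show "length (map J Fs) \<le> t" if "t \<in> \<Union>(set (map J Fs))" for t
      using that Fs(1,5) JQ(1) by fastforce
  qed (use JQ(2) in auto)
  moreover have "I \<subseteq> F" unfolding I_def Fs(1) using JQ(1) by fastforce
  moreover have "I \<noteq> {}" using Suc.prems(2) JQ(3) unfolding I_def Fs(1) by fastforce
  moreover have "F = (\<Union>i\<in>I. P i)"
  proof -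
    have "(\<Union>i\<in>I. P i) = (\<Union>G\<in>set Fs. \<Union>i\<in>J G. P i)" unfolding I_def by auto
    also have "\<dots> = (\<Union>G\<in>set Fs. \<Union>i\<in>J G. Q G i)" using P by simp
    also have "\<dots> = (\<Union>G\<in>set Fs. G)" using JQ(4) by simp
    finally show ?thesis using Fs(1) by simp
  qed
  moreover have "P i \<in> schreier b \<and> i \<in> P i \<and> (\<forall>t\<in>P i. i \<le> t)" if "i \<in> I" for i
  proof -
    obtain G where "G \<in> set Fs" "i \<in> J G" using \<open>i \<in> I\<close> by (auto simp: I_def)
    then show ?thesis using JQ(5)[of G i] P[of G i] by simp
  qed
  moreover have "set_less (P i) (P j)" if ij: "i \<in> I" "j \<in> I" "i < j" for i j
  proof -
    obtain A B where AB: "A \<in> set Fs" "i \<in> J A" "B \<in> set Fs" "j \<in> J B"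
      using ij by (auto simp: I_def)
    show ?thesis
    proof (cases "A = B")
      case True
      then show ?thesis using AB JQ(6)[of A i j] P[of A i] P[of A j] ij(3) by simp
    next
      case False
      have sub: "P i \<subseteq> A" "P j \<subseteq> B" "i \<in> A" "j \<in> B" 
        using AB JQ(1,4)[of A] JQ(1,4)[of B] P[of A i] P[of B j] by blast+
      have "\<not> set_less B A" using sub(3,4) ij(3) unfolding set_less_def by (meson less_asym)
      then have "set_less A B" using sorted_set_less_cases[OF Fs(4) AB(1,3) False] by blast
      then show ?thesis using sub(1,2) unfolding set_less_def by blast
    qed
  qed
  ultimately show ?case by blast
qed

section \<open>Repeated averages over Schreier sets\<close>

lemma sum_UN_le:
  fixes b :: "'a \<Rightarrow> real"
  assumes "finite I" "\<And>i. i \<in> I \<Longrightarrow> finite (A i)" "\<And>t. 0 \<le> b t"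
  shows "sum b (\<Union>i\<in>I. A i) \<le> (\<Sum>i\<in>I. sum b (A i))"
  using assms(1,2)
proof (induction I)
  case (insert i I)
  have "sum b (A i \<union> (\<Union>j\<in>I. A j)) \<le> sum b (A i) + sum b (\<Union>j\<in>I. A j)"
    using insert.hyps insert.prems assms(3) by (simp add: sum_Un sum_nonneg)
  moreover have "sum b (\<Union>j\<in>I. A j) \<le> (\<Sum>j\<in>I. sum b (A j))"
    using insert by simp
  ultimately show ?case using insert.hyps by simp
qed simp

text \<open>A set \<open>G\<close> of the next order splits into at most as many sets of the lower
  order as its first point in \<open>F\<close> allows, a number bounded by the maximum of the first
  block that \<open>G\<close> meets. Each block is chosen with a tolerance divided by the maximum of
  its predecessor, so every later block contributes at most \<open>\<epsilon> / 2\<close>. The first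
  block met may contribute its full mass 1, which averaging over \<open>M\<close> blocks reduces to
  \<open>1 / M < \<epsilon> / 2\<close>.\<close>

lemma schreier_repeated_averages:
  fixes \<epsilon> :: real
  assumes "\<epsilon> > 0"
  shows "\<exists>F (a :: nat \<Rightarrow> real). F \<in> schreier (Suc d) \<and> F \<noteq> {} \<and> (\<forall>t\<in>F. N \<le> t \<and> 0 < a t) \<and>
    (\<forall>t. t \<notin> F \<longrightarrow> a t = 0) \<and> sum a F = 1 \<and> (\<forall>G\<in>schreier d. sum a (G \<inter> F) < \<epsilon>)"
  using assms
proof (induction d arbitrary: N \<epsilon>)
  case 0
  obtain M0 :: nat where M0: "1 / \<epsilon> < real M0" using reals_Archimedean2 by blast
  define M where "M = max (max N 1) M0"
  have M: "N \<le> M" "1 \<le> M" "1 / \<epsilon> < real M" using M0 by (auto simp: M_def)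
  then have small: "1 / real M < \<epsilon>" using 0 by (simp add: field_simps)
  define F where "F = {M..<2 * M}"
  define a where "a t = (if t \<in> F then 1 / real M else 0)" for t
  have "F \<in> schreier 1" by (rule schreier_1I) (use M in \<open>auto simp: F_def\<close>)
  moreover have "sum a F = 1" using M by (simp add: a_def F_def)
  moreover have "sum a (G \<inter> F) < \<epsilon>" if "G \<in> schreier 0" for G
  proof -
    have "card (G \<inter> F) \<le> 1"
      using that by (auto simp: card_insert_if Int_insert_left)
    moreover have "sum a (G \<inter> F) = real (card (G \<inter> F)) * (1 / real M)" by (simp add: a_def)
    ultimately have "sum a (G \<inter> F) \<le> 1 / real M" using M(2)
      by (simp add: field_simps)
    then show ?thesis using small by linarith
  qed
  ultimately show ?case using M
    by (intro exI[of _ F] exI[of _ a]) (auto simp: a_def F_def)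
next
  case (Suc d)
  obtain M0 :: nat where M0: "2 / \<epsilon> < real M0" using reals_Archimedean2 by blast
  define M where "M = max (max N 1) M0"
  have M: "N \<le> M" "1 \<le> M" "2 / \<epsilon> < real M" using M0 by (auto simp: M_def)
  then have small: "1 / real M < \<epsilon> / 2" using Suc.prems by (simp add: field_simps)
  define P where "P = (\<lambda>(F, a :: nat \<Rightarrow> real). F \<in> schreier (Suc d) \<and> F \<noteq> {} \<and>
    (\<forall>t\<in>F. M \<le> t \<and> 0 < a t) \<and> (\<forall>t. t \<notin> F \<longrightarrow> a t = 0) \<and> sum a F = 1)"
  define Q where "Q = (\<lambda>(F, a :: nat \<Rightarrow> real) (F', a' :: nat \<Rightarrow> real). (\<forall>t\<in>F'. Max F < t) \<and>
    (\<forall>G\<in>schreier d. sum a' (G \<inter> F') < \<epsilon> / (2 * real (Max F))))"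
  have "\<exists>X. \<forall>r. P (X r) \<and> Q (X r) (X (Suc r))"
  proof (rule dependent_nat_choice)
    show "\<exists>x. P x" using Suc.IH[of \<epsilon> M] Suc.prems unfolding P_def by blast
    show "\<exists>y. P y \<and> Q x y" if "P x" for x r
    proof -
      obtain F a where x: "x = (F, a)" by force
      have "finite F" "F \<noteq> {}" using that x schreier_finite[of F "Suc d"] by (auto simp: P_def)
      then have "Max F \<in> F" by simp
      then have F: "M \<le> Max F" using that x by (auto simp: P_def)
      then have "0 < \<epsilon> / (2 * real (Max F))" using M(2) Suc.prems by simp
      from Suc.IH[OF this, of "Suc (Max F)"] obtain F' a' where "F' \<in> schreier (Suc d)" "F' \<noteq> {}"
        "\<forall>t\<in>F'. Suc (Max F) \<le> t \<and> 0 < a' t" "\<forall>t. t \<notin> F' \<longrightarrow> a' t = 0" "sum a' F' = 1"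
        "\<forall>G\<in>schreier d. sum a' (G \<inter> F') < \<epsilon> / (2 * real (Max F))"
        by blast
      then show ?thesis using x F by (intro exI[of _ "(F', a')"]) (auto simp: P_def Q_def Suc_le_eq)
    qed
  qed
  then obtain X where X: "\<And>r. P (X r)" "\<And>r. Q (X r) (X (Suc r))" by blast
  define f where "f r = fst (X r)" for r
  define b where "b r = snd (X r)" for r
  have f: "f r \<in> schreier (Suc d)" "f r \<noteq> {}" "\<And>t. t \<in> f r \<Longrightarrow> M \<le> t \<and> 0 < b r t"
    "\<And>t. t \<notin> f r \<Longrightarrow> b r t = 0" "sum (b r) (f r) = 1" for r
    using X(1)[of r] by (auto simp: P_def f_def b_def case_prod_beta)
  have g: "\<And>t. t \<in> f (Suc r) \<Longrightarrow> Max (f r) < t"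
    "\<And>G. G \<in> schreier d \<Longrightarrow> sum (b (Suc r)) (G \<inter> f (Suc r)) < \<epsilon> / (2 * real (Max (f r)))" for r
    using X(2)[of r] by (auto simp: Q_def f_def b_def case_prod_beta)
  have fin: "finite (f r)" for r using f schreier_finite by blast
  have mono: "Max (f r) \<le> Max (f r')" if "r \<le> r'" for r r'
    by (rule lift_Suc_mono_le[OF _ that]) (use fin f(2) g(1)[OF Max_in] in \<open>auto intro: less_imp_le\<close>)
  have less: "set_less (f r) (f r')" if "r < r'" for r r'
  proof -
    obtain k where k: "r' = Suc k" "r \<le> k" using \<open>r < r'\<close> by (cases r') auto
    have "s < t" if "s \<in> f r" "t \<in> f r'" for s t
      using Max_ge[OF fin that(1)] mono[OF k(2)] g(1)[of t k] that(2) k(1) by simp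
    then show ?thesis by (simp add: set_less_def)
  qed
  define F where "F = (\<Union>r<M. f r)"
  define a where "a t = (\<Sum>r<M. b r t) / real M" for t
  have b0: "0 \<le> b r t" for r t using f(3,4)[of t r] by (cases "t \<in> f r") (auto intro: less_imp_le)
  have finF: "finite F" using fin by (simp add: F_def)
  have sum_a: "sum a (G \<inter> F) = (\<Sum>r<M. sum (b r) (G \<inter> f r)) / real M" for G
  proof -
    have "sum a (G \<inter> F) = (\<Sum>r<M. sum (b r) (G \<inter> F)) / real M"
      unfolding a_def sum_divide_distrib[symmetric] by (subst sum.swap) simp
    moreover have "sum (b r) (G \<inter> F) = sum (b r) (G \<inter> f r)" if "r < M" for r
      by (rule sum.mono_neutral_right) (use finF that f(4) in \<open>auto simp: F_def\<close>)
    ultimately show ?thesis by simp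
  qed
  have "F = \<Union>(set (map f [0..<M]))" by (auto simp: F_def)
  also have "\<dots> \<in> schreier (Suc (Suc d))"
  proof (rule schreier_SucI)
    show "sorted_wrt set_less (map f [0..<M])"
      unfolding sorted_wrt_map by (rule sorted_wrt_mono_rel[of _ "(<)"]) (auto intro: less)
  qed (use f in auto)
  finally have FS: "F \<in> schreier (Suc (Suc d))" .
  have "F \<noteq> {}" using f(2)[of 0] M(2) by (force simp: F_def)
  moreover have "N \<le> t \<and> 0 < a t" if "t \<in> F" for t
  proof -
    obtain r where r: "r < M" "t \<in> f r" using \<open>t \<in> F\<close> by (auto simp: F_def)
    have "0 < b r t" "M \<le> t" using f(3) r by auto
    moreover have "b r t \<le> (\<Sum>r<M. b r t)"
      by (rule member_le_sum) (use r b0 in auto)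
    ultimately show ?thesis using M by (auto simp: a_def)
  qed
  moreover have "a t = 0" if "t \<notin> F" for t
    using that f(4) by (auto simp: F_def a_def)
  moreover have "sum a F = 1"
    using sum_a[of UNIV] f(5) M(2) by simp
  moreover have "sum a (G \<inter> F) < \<epsilon>" if G: "G \<in> schreier (Suc d)" for G
  proof (cases "G \<inter> F = {}")
    case True
    then show ?thesis using Suc.prems by simp
  next
    case False
    have "G \<inter> F \<in> schreier (Suc d)" using G schreier_subset by blast
    then obtain Gs where Gs: "G \<inter> F = \<Union>(set Gs)" "\<And>H. H \<in> set Gs \<Longrightarrow> H \<in> schreier d"
      "\<And>t. t \<in> G \<inter> F \<Longrightarrow> length Gs \<le> t"
      using schreier_SucE False by metis
    define r0 where "r0 = (LEAST r. G \<inter> f r \<noteq> {} \<and> r < M)"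
    have ex: "\<exists>r. G \<inter> f r \<noteq> {} \<and> r < M" using False by (auto simp: F_def)
    have r0: "G \<inter> f r0 \<noteq> {}" "r0 < M" using LeastI_ex[OF ex] unfolding r0_def by auto
    have below: "G \<inter> f r = {}" if "r < r0" for r
      using not_less_Least[of r "\<lambda>r. G \<inter> f r \<noteq> {} \<and> r < M"] that r0(2) unfolding r0_def by auto
    obtain t0 where t0: "t0 \<in> G" "t0 \<in> f r0" using r0(1) by blast
    have "length Gs \<le> t0" using Gs(3) t0 r0(2) by (auto simp: F_def)
    also have "t0 \<le> Max (f r0)" using fin t0 by simp
    finally have len: "length Gs \<le> Max (f r0)" .
    have bd: "sum (b r) (G \<inter> f r) \<le> \<epsilon> / 2 + (if r = r0 then 1 else 0)" if r: "r < M" for r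
    proof -
      consider "r < r0" | "r = r0" | "r > r0" by linarith
      then show ?thesis
      proof cases
        case 1
        then show ?thesis using below Suc.prems by simp
      next
        case 2
        have "sum (b r) (G \<inter> f r) \<le> sum (b r) (f r)"
          by (rule sum_mono2) (use fin b0 in auto)
        then show ?thesis using 2 f(5)[of r] Suc.prems by simp
      next
        case 3
        then obtain k where k: "r = Suc k" "r0 \<le> k" by (cases r) auto
        let ?e = "\<epsilon> / (2 * real (Max (f k)))"
        have len': "length Gs \<le> Max (f k)" using len mono[OF k(2)] by linarith
        have pos: "0 < Max (f k)" using len' t0 Gs(1) r0(2) by (cases Gs) (auto simp: F_def)
        have "G \<inter> f r = (\<Union>H\<in>set Gs. H \<inter> f r)"
          using Gs(1) r by (auto simp: F_def)
        then have "sum (b r) (G \<inter> f r) \<le> (\<Sum>H\<in>set Gs. sum (b r) (H \<inter> f r))"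
          using fin b0 by (simp only:) (rule sum_UN_le, auto)
        also have "\<dots> \<le> (\<Sum>H\<in>set Gs. ?e)"
          using Gs(2) g(2) k(1) by (intro sum_mono less_imp_le) auto
        also have "\<dots> = real (card (set Gs)) * ?e" by simp
        also have "\<dots> \<le> real (Max (f k)) * ?e"
          using len' card_length[of Gs] Suc.prems by (intro mult_right_mono) auto
        also have "\<dots> = \<epsilon> / 2" using pos by simp
        finally show ?thesis using 3 by simp
      qed
    qed
    have "(\<Sum>r<M. sum (b r) (G \<inter> f r)) \<le> (\<Sum>r<M. \<epsilon> / 2 + (if r = r0 then 1 else 0))"
      using bd by (intro sum_mono) auto
    also have "\<dots> = real M * (\<epsilon> / 2) + 1" using r0(2) by (simp add: sum.distrib)
    finally have "sum a (G \<inter> F) \<le> (real M * (\<epsilon> / 2) + 1) / real M"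
      unfolding sum_a by (simp add: divide_right_mono)
    also have "\<dots> = \<epsilon> / 2 + 1 / real M" using M(2) by (simp add: field_simps)
    also have "\<dots> < \<epsilon>" using small by linarith
    finally show ?thesis .
  qed
  ultimately show ?case using FS by blast
qed

section \<open>The space of a norming set\<close>

lemma act_superset:
  assumes "finite A" "supp f \<subseteq> A"
  shows "act f x = (\<Sum>i\<in>A. f i * x i)"
  unfolding act_def by (rule sum.mono_neutral_left) (use assms in \<open>auto simp: supp_def\<close>)

lemma act_add: "act f (\<lambda>i. x i + y i) = act f x + act f y"
  by (simp add: act_def algebra_simps sum.distrib)

lemma act_scale: "act f (\<lambda>i. c * x i) = c * act f x"
  by (simp add: act_def sum_distrib_left mult_ac)

lemma act_uminus: "act (\<lambda>i. - f i) x = - act f x"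
  by (simp add: act_def supp_def sum_negf)

lemma act_unitf: "act (unitf k) x = x k"
proof -
  have "supp (unitf k) = {k}" by (auto simp: supp_def unitf_def)
  then show ?thesis by (simp add: act_def unitf_def)
qed

lemma act_lin_comb:
  assumes "finite B" "\<And>k. k \<in> B \<Longrightarrow> finite (supp (h k))"
  shows "act (\<lambda>t. \<Sum>k\<in>B. b k * h k t) x = (\<Sum>k\<in>B. b k * act (h k) x)"
proof -
  define A where "A = (\<Union>k\<in>B. supp (h k))"
  have A: "finite A" using assms by (simp add: A_def)
  have "(\<Sum>k\<in>B. b k * h k t) = 0" if "t \<notin> A" for t
    using that by (intro sum.neutral) (auto simp: A_def supp_def)
  then have "supp (\<lambda>t. \<Sum>k\<in>B. b k * h k t) \<subseteq> A" by (auto simp: supp_def)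
  then have "act (\<lambda>t. \<Sum>k\<in>B. b k * h k t) x = (\<Sum>t\<in>A. \<Sum>k\<in>B. b k * (h k t * x t))"
    using act_superset[OF A] by (simp add: sum_distrib_right mult.assoc)
  also have "\<dots> = (\<Sum>k\<in>B. b k * (\<Sum>t\<in>A. h k t * x t))"
    by (subst sum.swap) (simp add: sum_distrib_left)
  also have "\<dots> = (\<Sum>k\<in>B. b k * act (h k) x)"
    by (intro sum.cong refl arg_cong2[where f="(*)"] act_superset[symmetric] A) (auto simp: A_def)
  finally show ?thesis .
qed

abbreviation tail :: "nat \<Rightarrow> (nat \<Rightarrow> real) \<Rightarrow> nat \<Rightarrow> real" where
  "tail K x \<equiv> (\<lambda>i. if i \<le> K then 0 else x i)"

locale norming_set =
  fixes NN :: "(nat \<Rightarrow> real) set"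
  assumes norming_NN: "norming NN"
begin

lemma NN_finite: "f \<in> NN \<Longrightarrow> finite (supp f)" and NN_0: "f \<in> NN \<Longrightarrow> f 0 = 0"
  and NN_unit: "1 \<le> k \<Longrightarrow> unitf k \<in> NN" and NN_le1: "f \<in> NN \<Longrightarrow> \<bar>f t\<bar> \<le> 1"
  and NN_uminus: "f \<in> NN \<Longrightarrow> (\<lambda>i. - f i) \<in> NN"
  and NN_restr: "f \<in> NN \<Longrightarrow> restr {a..b} f \<in> NN"
  using norming_NN unfolding norming_def is_interval_def by blast+

text \<open>For unbounded actions the \<open>Sup\<close> in \<open>nnorm\<close> carries no
  information, so norm estimates come paired with boundedness.\<close>

definition bdd :: "(nat \<Rightarrow> real) \<Rightarrow> bool" where
  "bdd x \<longleftrightarrow> bdd_above ((\<lambda>f. act f x) ` NN)"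

lemma NN_nonempty: "NN \<noteq> {}"
  using NN_unit[of 1] by auto

lemma nnorm_le:
  assumes "\<And>f. f \<in> NN \<Longrightarrow> act f x \<le> C"
  shows "nnorm NN x \<le> C" and "bdd x"
proof -
  show "nnorm NN x \<le> C" unfolding nnorm_def
    by (rule cSUP_least[OF NN_nonempty]) (use assms in auto)
  show "bdd x" unfolding bdd_def by (rule bdd_aboveI2) (use assms in auto)
qed

lemma act_le:
  assumes "bdd x" "f \<in> NN"
  shows "\<bar>act f x\<bar> \<le> nnorm NN x"
proof -
  have le: "act g x \<le> nnorm NN x" if "g \<in> NN" for g
    unfolding nnorm_def by (rule cSUP_upper[OF that assms(1)[unfolded bdd_def]])
  show ?thesis using le[OF assms(2)] le[OF NN_uminus[OF assms(2)]] by (simp add: act_uminus)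
qed

lemma nnorm_nonneg: "bdd x \<Longrightarrow> 0 \<le> nnorm NN x"
  using act_le[of x "unitf 1"] NN_unit[of 1] by fastforce

lemma coord_le: "bdd x \<Longrightarrow> 1 \<le> k \<Longrightarrow> \<bar>x k\<bar> \<le> nnorm NN x"
  using act_le[of x "unitf k"] NN_unit[of k] by (simp add: act_unitf)

lemma nnorm_add:
  assumes "bdd x" "bdd y"
  shows "nnorm NN (\<lambda>i. x i + y i) \<le> nnorm NN x + nnorm NN y" "bdd (\<lambda>i. x i + y i)"
proof -
  have *: "act f (\<lambda>i. x i + y i) \<le> nnorm NN x + nnorm NN y" if "f \<in> NN" for f
    using act_le[OF assms(1) that] act_le[OF assms(2) that] by (simp add: act_add)
  show "nnorm NN (\<lambda>i. x i + y i) \<le> nnorm NN x + nnorm NN y" by (rule nnorm_le(1)[OF *])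
  show "bdd (\<lambda>i. x i + y i)" by (rule nnorm_le(2)[OF *])
qed

lemma nnorm_scale_le:
  assumes "bdd x"
  shows "nnorm NN (\<lambda>i. c * x i) \<le> \<bar>c\<bar> * nnorm NN x" "bdd (\<lambda>i. c * x i)"
proof -
  have *: "act f (\<lambda>i. c * x i) \<le> \<bar>c\<bar> * nnorm NN x" if "f \<in> NN" for f
  proof -
    have "c * act f x \<le> \<bar>c\<bar> * \<bar>act f x\<bar>" by (metis abs_ge_self abs_mult)
    also have "\<dots> \<le> \<bar>c\<bar> * nnorm NN x" using act_le[OF assms that] by (simp add: mult_left_mono)
    finally show ?thesis by (simp add: act_scale)
  qed
  show "nnorm NN (\<lambda>i. c * x i) \<le> \<bar>c\<bar> * nnorm NN x" by (rule nnorm_le(1)[OF *])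
  show "bdd (\<lambda>i. c * x i)" by (rule nnorm_le(2)[OF *])
qed

lemma nnorm_uminus: "bdd x \<Longrightarrow> bdd (\<lambda>i. - x i)" "bdd x \<Longrightarrow> nnorm NN (\<lambda>i. - x i) = nnorm NN x"
proof -
  have le: "bdd (\<lambda>i. - y i) \<and> nnorm NN (\<lambda>i. - y i) \<le> nnorm NN y" if "bdd y" for y
    using nnorm_scale_le[OF that, of "-1"] by simp
  show "bdd (\<lambda>i. - x i)" "nnorm NN (\<lambda>i. - x i) = nnorm NN x" if "bdd x"
    using le[OF that] le[of "\<lambda>i. - x i"] by simp_all
qed

lemma nnorm_diff:
  assumes "bdd x" "bdd y"
  shows "nnorm NN (\<lambda>i. x i - y i) \<le> nnorm NN x + nnorm NN y" "bdd (\<lambda>i. x i - y i)"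
  using nnorm_add[OF assms(1) nnorm_uminus(1)[OF assms(2)]] nnorm_uminus(2)[OF assms(2)] by simp_all

lemma nnorm_diff_commute:
  assumes "bdd x" "bdd y"
  shows "nnorm NN (\<lambda>i. x i - y i) = nnorm NN (\<lambda>i. y i - x i)"
  using nnorm_uminus(2)[OF nnorm_diff(2)[OF assms]] by simp

lemma nnorm_triangle:
  assumes "bdd x" "bdd y" "bdd z"
  shows "nnorm NN (\<lambda>i. x i - z i) \<le> nnorm NN (\<lambda>i. x i - y i) + nnorm NN (\<lambda>i. y i - z i)"
  using nnorm_add(1)[OF nnorm_diff(2)[OF assms(1,2)] nnorm_diff(2)[OF assms(2,3)]] by simp

lemma nnorm_zero: "bdd (\<lambda>i. 0)" "nnorm NN (\<lambda>i. 0) = 0"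
proof -
  have z: "act f (\<lambda>i. 0) = 0" for f by (simp add: act_def)
  show bz: "bdd (\<lambda>i. 0)" by (rule nnorm_le(2)[of _ 0]) (simp add: z)
  have "nnorm NN (\<lambda>i. 0) \<le> 0" by (rule nnorm_le(1)) (simp add: z)
  then show "nnorm NN (\<lambda>i. 0) = 0" using nnorm_nonneg[OF bz] by simp
qed

text \<open>A functional acts on a tail of \<open>x\<close> as its restriction to an interval acts
  on \<open>x\<close>, and \<open>NN\<close> is closed under such restrictions.\<close>

lemma nnorm_tail:
  assumes "bdd x"
  shows "nnorm NN (tail K x) \<le> nnorm NN x" "bdd (tail K x)"
proof -
  have *: "act f (tail K x) \<le> nnorm NN x" if f: "f \<in> NN" for f
  proof -
    obtain b where b: "supp f \<subseteq> {..b}" 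
      using NN_finite[OF f] finite_nat_set_iff_bounded_le[of "supp f"] by auto
    have "act f (tail K x) = (\<Sum>i\<le>b. f i * tail K x i)" using b by (intro act_superset) auto
    also have "\<dots> = (\<Sum>i\<le>b. restr {K+1..b} f i * x i)"
      by (intro sum.cong) (auto simp: restr_def)
    also have "\<dots> = act (restr {K+1..b} f) x"
      using b by (intro act_superset[symmetric]) (auto simp: supp_def restr_def split: if_splits)
    also have "\<dots> \<le> nnorm NN x" using act_le[OF assms NN_restr[OF f, of "K+1" b]] by simp
    finally show ?thesis .
  qed
  show "nnorm NN (tail K x) \<le> nnorm NN x" by (rule nnorm_le(1)[OF *])
  show "bdd (tail K x)" by (rule nnorm_le(2)[OF *])
qed

section \<open>The space of sequences: linear structure, finite vectors, completeness\<close>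

lemma XN_bdd: "x \<in> XN NN \<Longrightarrow> bdd x" and XN_0: "x \<in> XN NN \<Longrightarrow> x 0 = 0"
  and XN_tail: "x \<in> XN NN \<Longrightarrow> (\<lambda>k. nnorm NN (tail k x)) \<longlonglongrightarrow> 0"
  by (auto simp: XN_def bdd_def)

lemma XN_I:
  assumes "x 0 = 0" "bdd x" and le: "\<And>k. nnorm NN (tail k x) \<le> u k" and u: "u \<longlonglongrightarrow> 0"
  shows "x \<in> XN NN"
proof -
  have "(\<lambda>k. nnorm NN (tail k x)) \<longlonglongrightarrow> 0"
    by (rule tendsto_sandwich[OF _ _ tendsto_const u])
      (auto intro!: always_eventually le nnorm_nonneg nnorm_tail(2) assms(2))
  then show ?thesis using assms by (simp add: XN_def bdd_def)
qed

lemma XN_zero: "(\<lambda>i. 0) \<in> XN NN"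
  by (rule XN_I[of _ "\<lambda>_. 0"]) (simp_all add: nnorm_zero)

lemma XN_add:
  assumes "x \<in> XN NN" "y \<in> XN NN"
  shows "(\<lambda>i. x i + y i) \<in> XN NN"
proof (rule XN_I)
  note b = XN_bdd[OF assms(1)] XN_bdd[OF assms(2)]
  show "nnorm NN (tail k (\<lambda>i. x i + y i)) \<le> nnorm NN (tail k x) + nnorm NN (tail k y)" for k
  proof -
    have "tail k (\<lambda>i. x i + y i) = (\<lambda>i. tail k x i + tail k y i)" by auto
    then show ?thesis using nnorm_add(1)[OF nnorm_tail(2)[OF b(1)] nnorm_tail(2)[OF b(2)]] by simp
  qed
  show "(\<lambda>k. nnorm NN (tail k x) + nnorm NN (tail k y)) \<longlonglongrightarrow> 0"
    using tendsto_add[OF XN_tail[OF assms(1)] XN_tail[OF assms(2)]] by simp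
  show "bdd (\<lambda>i. x i + y i)" using nnorm_add(2)[OF b] .
qed (use XN_0[OF assms(1)] XN_0[OF assms(2)] in simp)

lemma XN_scale:
  assumes "x \<in> XN NN"
  shows "(\<lambda>i. c * x i) \<in> XN NN"
proof (rule XN_I)
  note b = XN_bdd[OF assms]
  show "nnorm NN (tail k (\<lambda>i. c * x i)) \<le> \<bar>c\<bar> * nnorm NN (tail k x)" for k
  proof -
    have "tail k (\<lambda>i. c * x i) = (\<lambda>i. c * tail k x i)" by auto
    then show ?thesis using nnorm_scale_le(1)[OF nnorm_tail(2)[OF b]] by simp
  qed
  show "(\<lambda>k. \<bar>c\<bar> * nnorm NN (tail k x)) \<longlonglongrightarrow> 0"
    using tendsto_mult_right_zero[OF XN_tail[OF assms]] by simp
  show "bdd (\<lambda>i. c * x i)" using nnorm_scale_le(2)[OF b] .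
qed (use XN_0[OF assms] in simp)

lemma XN_diff:
  assumes "x \<in> XN NN" "y \<in> XN NN"
  shows "(\<lambda>i. x i - y i) \<in> XN NN"
  using XN_add[OF assms(1) XN_scale[OF assms(2), of "-1"]] by simp

lemma XN_finite:
  assumes "x 0 = 0" "finite (supp x)"
  shows "x \<in> XN NN"
proof (rule XN_I)
  show "bdd x"
  proof (rule nnorm_le(2))
    fix f assume f: "f \<in> NN"
    have "act f x = (\<Sum>i\<in>supp f \<inter> supp x. f i * x i)"
      unfolding act_def by (rule sum.mono_neutral_right) (use NN_finite[OF f] in \<open>auto simp: supp_def\<close>)
    also have "\<dots> \<le> (\<Sum>i\<in>supp f \<inter> supp x. \<bar>x i\<bar>)"
    proof (rule sum_mono)
      fix i
      have "f i * x i \<le> \<bar>f i\<bar> * \<bar>x i\<bar>" by (metis abs_ge_self abs_mult)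
      also have "\<dots> \<le> 1 * \<bar>x i\<bar>" using NN_le1[OF f] by (intro mult_right_mono) auto
      finally show "f i * x i \<le> \<bar>x i\<bar>" by simp
    qed
    also have "\<dots> \<le> (\<Sum>i\<in>supp x. \<bar>x i\<bar>)" using assms by (intro sum_mono2) auto
    finally show "act f x \<le> (\<Sum>i\<in>supp x. \<bar>x i\<bar>)" .
  qed
  obtain b where b: "supp x \<subseteq> {..b}" using assms(2) finite_nat_set_iff_bounded_le[of "supp x"] by auto
  have "nnorm NN (tail k x) = 0" if "b \<le> k" for k
  proof -
    have "tail k x = (\<lambda>i. 0)" using b that by (fastforce simp: supp_def)
    then show ?thesis by (simp only: nnorm_zero)
  qed
  then show "(\<lambda>k. nnorm NN (tail k x)) \<longlonglongrightarrow> 0"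
    by (intro tendsto_eventually eventually_sequentiallyI) auto
qed (use assms in auto)

lemma unitf_XN: "1 \<le> k \<Longrightarrow> unitf k \<in> XN NN"
  by (rule XN_finite) (auto simp: unitf_def supp_def)

lemma nnorm_unitf: "nnorm NN (unitf k) \<le> 1"
proof (rule nnorm_le(1))
  fix f assume f: "f \<in> NN"
  have "act f (unitf k) = (\<Sum>i\<in>supp f. if i = k then f i else 0)"
    unfolding act_def by (intro sum.cong) (auto simp: unitf_def)
  also have "\<dots> \<le> 1" using NN_finite[OF f] NN_le1[OF f, of k] by (auto simp: abs_le_iff)
  finally show "act f (unitf k) \<le> 1" .
qed

lemma XN_eq_zero:
  assumes "x \<in> XN NN" "nnorm NN x \<le> 0"
  shows "x = (\<lambda>i. 0)"
proof
  fix i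
  show "x i = 0"
    using coord_le[OF XN_bdd[OF assms(1)], of i] XN_0[OF assms(1)] assms(2) by (cases i) auto
qed

lemma coord_tendsto:
  assumes "\<And>k. s k \<in> XN NN" "x \<in> XN NN" "(\<lambda>k. nnorm NN (\<lambda>i. s k i - x i)) \<longlonglongrightarrow> 0"
  shows "(\<lambda>k. s k i) \<longlonglongrightarrow> x i"
proof -
  have "\<bar>s k i - x i\<bar> \<le> nnorm NN (\<lambda>i. s k i - x i)" for k
    using coord_le[OF nnorm_diff(2)[OF XN_bdd XN_bdd, OF assms(1,2)], of i k]
      nnorm_nonneg[OF nnorm_diff(2)[OF XN_bdd XN_bdd, OF assms(1,2)], of k]
      XN_0[OF assms(1), of k] XN_0[OF assms(2)] by (cases i) auto
  then have "(\<lambda>k. \<bar>s k i - x i\<bar>) \<longlonglongrightarrow> 0"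
    by (intro tendsto_sandwich[OF _ _ tendsto_const assms(3)]) simp_all
  then have "(\<lambda>k. s k i - x i) \<longlonglongrightarrow> 0" by (rule tendsto_rabs_zero_cancel)
  then show ?thesis by (simp add: LIM_zero_iff)
qed

text \<open>The limit is taken coordinatewise. Functionals have finite support, so their actions
  pass to the limit and the Cauchy estimate becomes a norm estimate; tails of the limit are compared
  with tails of one approximating term.\<close>

lemma XN_complete:
  assumes s: "\<And>k. s k \<in> XN NN"
    and Cauchy: "\<And>\<epsilon>. 0 < \<epsilon> \<Longrightarrow> \<exists>N. \<forall>k\<ge>N. \<forall>l\<ge>N. nnorm NN (\<lambda>i. s k i - s l i) < \<epsilon>"
  obtains x where "x \<in> XN NN" "(\<lambda>k. nnorm NN (\<lambda>i. s k i - x i)) \<longlonglongrightarrow> 0"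
proof -
  have b: "bdd (s k)" for k using XN_bdd s by blast
  have bd: "bdd (\<lambda>i. s k i - s l i)" for k l using nnorm_diff(2) b by blast
  have "convergent (\<lambda>k. s k i)" for i
  proof (rule real_Cauchy_convergent, rule metric_CauchyI)
    fix \<epsilon> :: real assume "0 < \<epsilon>"
    then obtain N where N: "\<forall>k\<ge>N. \<forall>l\<ge>N. nnorm NN (\<lambda>i. s k i - s l i) < \<epsilon>" using Cauchy by blast
    have "\<bar>s k i - s l i\<bar> \<le> nnorm NN (\<lambda>i. s k i - s l i)" for k l
      using coord_le[OF bd, of i k l] XN_0[OF s] nnorm_nonneg[OF bd, of k l] by (cases i) auto
    then show "\<exists>N. \<forall>k\<ge>N. \<forall>l\<ge>N. dist (s k i) (s l i) < \<epsilon>"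
      using N unfolding dist_real_def by (meson le_less_trans)
  qed
  then obtain x where x: "\<And>i. (\<lambda>k. s k i) \<longlonglongrightarrow> x i" unfolding convergent_def by metis
  have close: "\<exists>N. \<forall>k\<ge>N. bdd (\<lambda>i. s k i - x i) \<and> nnorm NN (\<lambda>i. s k i - x i) \<le> \<epsilon>" if "0 < \<epsilon>" for \<epsilon>
  proof -
    obtain N where N: "\<forall>k\<ge>N. \<forall>l\<ge>N. nnorm NN (\<lambda>i. s k i - s l i) < \<epsilon>" using Cauchy[OF \<open>0 < \<epsilon>\<close>] by blast
    have "act f (\<lambda>i. s k i - x i) \<le> \<epsilon>" if k: "k \<ge> N" and f: "f \<in> NN" for k f
    proof (rule LIMSEQ_le_const2)
      show "(\<lambda>l. act f (\<lambda>i. s k i - s l i)) \<longlonglongrightarrow> act f (\<lambda>i. s k i - x i)"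
        unfolding act_def by (intro tendsto_intros x)
      show "\<exists>N. \<forall>l\<ge>N. act f (\<lambda>i. s k i - s l i) \<le> \<epsilon>"
      proof (intro exI[of _ N] allI impI)
        fix l assume "N \<le> l"
        then have "nnorm NN (\<lambda>i. s k i - s l i) < \<epsilon>" using N k by blast
        then show "act f (\<lambda>i. s k i - s l i) \<le> \<epsilon>" using act_le[OF bd f, of k l] by linarith
      qed
    qed
    then show ?thesis using nnorm_le by blast
  qed
  obtain N0 where N0: "bdd (\<lambda>i. s N0 i - x i)" using close[of 1] by fastforce
  have bx: "bdd x" using nnorm_diff(2)[OF b[of N0] N0] by simp
  have lim: "(\<lambda>k. nnorm NN (\<lambda>i. s k i - x i)) \<longlonglongrightarrow> 0"
  proof (rule LIMSEQ_I)
    fix r :: real assume "0 < r"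
    then obtain N where N: "\<forall>k\<ge>N. bdd (\<lambda>i. s k i - x i) \<and> nnorm NN (\<lambda>i. s k i - x i) \<le> r/2"
      using close[of "r/2"] by auto
    then show "\<exists>N. \<forall>k\<ge>N. norm (nnorm NN (\<lambda>i. s k i - x i) - 0) < r"
      using nnorm_nonneg \<open>0 < r\<close> by (intro exI[of _ N]) fastforce
  qed
  have "(\<lambda>k. nnorm NN (tail k x)) \<longlonglongrightarrow> 0"
  proof (rule LIMSEQ_I)
    fix r :: real assume r: "0 < r"
    then obtain j where j: "nnorm NN (\<lambda>i. s j i - x i) \<le> r/3" using close[of "r/3"] by auto
    obtain K where K: "\<forall>k\<ge>K. norm (nnorm NN (tail k (s j)) - 0) < r/3"
      using LIMSEQ_D[OF XN_tail[OF s[of j]], of "r/3"] r by auto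
    have "nnorm NN (tail k x) < r" if "k \<ge> K" for k
    proof -
      have bsx: "bdd (\<lambda>i. s j i - x i)" using nnorm_diff(2)[OF b bx] .
      have "tail k x = (\<lambda>i. tail k (s j) i - tail k (\<lambda>i. s j i - x i) i)" by auto
      then have "nnorm NN (tail k x) \<le> nnorm NN (tail k (s j)) + nnorm NN (tail k (\<lambda>i. s j i - x i))"
        using nnorm_diff(1)[OF nnorm_tail(2)[OF b[of j]] nnorm_tail(2)[OF bsx], of k k] by simp
      also have "\<dots> \<le> r/3 + r/3"
        using K that nnorm_tail(1)[OF bsx, of k] j by (intro add_mono) (fastforce, linarith)
      finally show ?thesis using r by simp
    qed
    then show "\<exists>K. \<forall>k\<ge>K. norm (nnorm NN (tail k x) - 0) < r"
      using nnorm_nonneg[OF nnorm_tail(2)[OF bx]] by auto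
  qed
  moreover have "x 0 = 0" using x[of 0] by (simp add: XN_0[OF s] LIMSEQ_const_iff)
  ultimately have "x \<in> XN NN" using bx by (simp add: XN_def bdd_def)
  then show ?thesis using that lim by blast
qed

text \<open>Pigeonhole on a finite net: two different images would lie within
  \<open>\<bar>c\<bar> / 2\<close> of the same net point, while one coordinate already shows that
  their distance is at least \<open>\<bar>c\<bar>\<close>. This serves both to exclude a scalar part
  on kernel vectors and to refute compactness on the test vectors.\<close>

lemma compact_op_unit_images:
  fixes u :: "nat \<Rightarrow> nat \<Rightarrow> real"
  assumes K: "compact_op NN K" and u: "\<And>k. u k \<in> XN NN" "\<And>k. nnorm NN (u k) \<le> 1"
    and Ku: "\<And>k. K (u k) = (\<lambda>i. c * unitf (\<phi> k) i)" and \<phi>: "inj \<phi>" "\<And>k. 1 \<le> \<phi> k"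
  shows "c = 0"
proof (rule ccontr)
  assume c: "c \<noteq> 0"
  then have "0 < \<bar>c\<bar> / 2" by simp
  then obtain S where S: "finite S" "S \<subseteq> XN NN"
    "\<forall>x\<in>XN NN. nnorm NN x \<le> 1 \<longrightarrow> (\<exists>y\<in>S. nnorm NN (\<lambda>i. K x i - y i) < \<bar>c\<bar> / 2)"
    using K unfolding compact_op_def by blast
  then have "\<forall>k. \<exists>y\<in>S. nnorm NN (\<lambda>i. K (u k) i - y i) < \<bar>c\<bar> / 2" using u by blast
  then obtain y where y: "\<And>k. y k \<in> S" "\<And>k. nnorm NN (\<lambda>i. K (u k) i - y k i) < \<bar>c\<bar> / 2" by metis
  have "range y \<subseteq> S" using y(1) by auto
  then have "\<not> inj y" using finite_subset[of "range y" S] S(1) finite_imageD[of y UNIV] by auto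
  then obtain k l where kl: "k \<noteq> l" "y k = y l" by (auto simp: inj_def)
  define v where "v k = (\<lambda>i. c * unitf (\<phi> k) i)" for k
  have b: "bdd (v k)" "bdd (y k)" for k
    using XN_bdd[OF XN_scale[OF unitf_XN[OF \<phi>(2)]]] y(1)[of k] S(2) XN_bdd by (auto simp: v_def)
  have less: "nnorm NN (\<lambda>i. v k i - y k i) < \<bar>c\<bar> / 2" for k using y(2)[of k] unfolding Ku v_def .
  have "nnorm NN (\<lambda>i. v k i - v l i) \<le> nnorm NN (\<lambda>i. v k i - y k i) + nnorm NN (\<lambda>i. y k i - v l i)"
    using nnorm_triangle b by blast
  also have "nnorm NN (\<lambda>i. y k i - v l i) = nnorm NN (\<lambda>i. v l i - y l i)"
    using nnorm_diff_commute[OF b(2) b(1)] kl by metis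
  finally have "nnorm NN (\<lambda>i. v k i - v l i) < \<bar>c\<bar>" using less[of k] less[of l] by simp
  moreover have "\<bar>v k (\<phi> k) - v l (\<phi> k)\<bar> \<le> nnorm NN (\<lambda>i. v k i - v l i)"
    by (rule coord_le[OF nnorm_diff(2)[OF b(1) b(1)] \<phi>(2)])
  moreover have "\<phi> k \<noteq> \<phi> l" using \<phi>(1) kl(1) by (auto dest: injD)
  ultimately show False by (simp add: v_def unitf_def)
qed

lemma inf_dim_unitf:
  assumes D: "infinite D" and Z: "\<And>k. k \<in> D \<Longrightarrow> unitf k \<in> Z"
  shows "inf_dim Z"
  unfolding inf_dim_def
proof
  fix d
  obtain A where A: "finite A" "card A = d" "A \<subseteq> D" using infinite_arbitrarily_large[OF D] by blast
  obtain xs where xs: "set xs = A" "distinct xs" using finite_distinct_list A by blast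
  have "c k = 0" if c: "lin_comb c (map unitf xs) = (\<lambda>i. 0)" and k: "k < length xs" for c k
  proof -
    have "0 = lin_comb c (map unitf xs) (xs ! k)" using c by simp
    also have "\<dots> = (\<Sum>j<length xs. if j = k then c j else 0)"
      unfolding lin_comb_def using xs k
      by (intro sum.cong) (auto simp: unitf_def nth_eq_iff_index_eq)
    also have "\<dots> = c k" using k by simp
    finally show ?thesis by simp
  qed
  then have "lin_indep (map unitf xs)" by (simp add: lin_indep_def)
  then show "\<exists>vs. length vs = d \<and> set vs \<subseteq> Z \<and> lin_indep vs"
    using xs A Z by (intro exI[of _ "map unitf xs"]) (auto simp: distinct_card)
qed

lemma inf_dim_mono: "inf_dim Y \<Longrightarrow> Y \<subseteq> Z \<Longrightarrow> inf_dim Z"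
  unfolding inf_dim_def by blast

text \<open>If \<open>T\<close> were bounded below on \<open>Y\<close>, the sum of the closure of \<open>Y\<close> and the kernel of \<open>T\<close> would be
  direct and closed.\<close>

lemma strictly_singular_if_large_kernel:
  assumes HI: "hered_indec NN" and T: "bounded_op NN T" and D: "infinite D" "0 \<notin> D"
    and ker: "\<And>x. x \<in> XN NN \<Longrightarrow> \<forall>i. i \<notin> D \<longrightarrow> x i = 0 \<Longrightarrow> T x = (\<lambda>i. 0)"
  shows "strictly_singular NN T"
  unfolding strictly_singular_def
proof (intro conjI T allI impI notI, elim conjE exE)
  fix Y c assume Y: "subspace_X NN Y" "inf_dim Y" and c: "0 < (c::real)"
    and low: "\<forall>y\<in>Y. c * nnorm NN y \<le> nnorm NN (T y)"
  obtain C0 where "\<forall>x\<in>XN NN. nnorm NN (T x) \<le> C0 * nnorm NN x" using T by (auto simp: bounded_op_def)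
  \<comment> \<open>The summand 1 makes the constant positive, since it is divided by later.\<close>
  define C where "C = \<bar>C0\<bar> + 1"
  have TX: "T x \<in> XN NN" if "x \<in> XN NN" for x using T that by (simp add: bounded_op_def)
  have T_le: "nnorm NN (T x) \<le> C * nnorm NN x" if "x \<in> XN NN" for x
  proof -
    have "nnorm NN (T x) \<le> C0 * nnorm NN x"
      using \<open>\<forall>x\<in>XN NN. nnorm NN (T x) \<le> C0 * nnorm NN x\<close> that by blast
    also have "\<dots> \<le> C * nnorm NN x"
      using nnorm_nonneg[OF XN_bdd[OF that]] by (intro mult_right_mono) (auto simp: C_def)
    finally show ?thesis .
  qed
  have C: "0 < C" by (simp add: C_def)
  have T_add: "T (\<lambda>i. x i + y i) = (\<lambda>i. T x i + T y i)" if "x \<in> XN NN" "y \<in> XN NN" for x y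
    using T that by (simp add: bounded_op_def)
  have T_diff: "T (\<lambda>i. x i - y i) = (\<lambda>i. T x i - T y i)" if "x \<in> XN NN" "y \<in> XN NN" for x y
  proof -
    have "T (\<lambda>i. -1 * y i) = (\<lambda>i. -1 * T y i)" using T that(2) unfolding bounded_op_def by blast
    then show ?thesis using T_add[OF that(1) XN_scale[OF that(2), of "-1"]] by simp
  qed
  have YX: "Y \<subseteq> XN NN" and Y0: "(\<lambda>i. 0) \<in> Y"
    and Yadd: "\<And>x y. x \<in> Y \<Longrightarrow> y \<in> Y \<Longrightarrow> (\<lambda>i. x i + y i) \<in> Y"
    and Yscale: "\<And>x d. x \<in> Y \<Longrightarrow> (\<lambda>i. d * x i) \<in> Y"
    using Y(1) by (auto simp: subspace_X_def)
  note bX = XN_bdd and bd = nnorm_diff(2)[OF XN_bdd XN_bdd]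
  \<comment> \<open>Not necessarily the whole kernel: vectors supported on \<open>D\<close> suffice,
    and their closedness can be read off coordinatewise.\<close>
  define Z where "Z = {x \<in> XN NN. \<forall>i. i \<notin> D \<longrightarrow> x i = 0}"
  have Zs: "subspace_X NN Z" unfolding subspace_X_def Z_def
    using XN_add XN_scale XN_zero by auto
  have Zc: "closed_X NN Z" unfolding closed_X_def
  proof (intro allI impI, elim conjE)
    fix s x assume s: "\<forall>k. s k \<in> Z" and x: "x \<in> XN NN"
      and lim: "(\<lambda>k. nnorm NN (\<lambda>i. s k i - x i)) \<longlonglongrightarrow> 0"
    have "x i = 0" if "i \<notin> D" for i
    proof -
      have "(\<lambda>k. s k i) \<longlonglongrightarrow> x i" using s by (intro coord_tendsto[OF _ x lim]) (auto simp: Z_def)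
      moreover have "(\<lambda>k. s k i) = (\<lambda>k. 0)" using s that by (auto simp: Z_def)
      ultimately show ?thesis by (simp add: LIMSEQ_const_iff)
    qed
    then show "x \<in> Z" using x by (simp add: Z_def)
  qed
  have Zi: "inf_dim Z"
  proof (rule inf_dim_unitf[OF D(1)])
    fix k assume k: "k \<in> D"
    then have "1 \<le> k" using D(2) by (cases k) auto
    then show "unitf k \<in> Z" using unitf_XN k by (auto simp: Z_def unitf_def)
  qed
  \<comment> \<open>The closure of \<open>Y\<close>: indecomposability speaks of closed subspaces
    only, while \<open>Y\<close> is arbitrary. The lower bound passes to \<open>W\<close> by
    continuity of \<open>T\<close>.\<close>
  define W where "W = {x \<in> XN NN. \<forall>\<epsilon>>0. \<exists>y\<in>Y. nnorm NN (\<lambda>i. x i - y i) < \<epsilon>}"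
  have WX: "W \<subseteq> XN NN" by (auto simp: W_def)
  have W_approx: "\<exists>y\<in>Y. nnorm NN (\<lambda>i. x i - y i) < \<epsilon>" if "x \<in> W" "0 < \<epsilon>" for x \<epsilon>
    using that by (simp add: W_def)
  have YW: "Y \<subseteq> W"
  proof
    fix y assume y: "y \<in> Y"
    have "nnorm NN (\<lambda>i. y i - y i) = 0" using nnorm_zero by simp
    then have "\<forall>\<epsilon>>0. \<exists>y'\<in>Y. nnorm NN (\<lambda>i. y i - y' i) < \<epsilon>" 
      by (intro allI impI bexI[of _ y] y) simp
    then show "y \<in> W" using y YX by (auto simp: W_def)
  qed
  have Wi: "inf_dim W" using inf_dim_mono[OF Y(2) YW] .
  have Ws: "subspace_X NN W" unfolding subspace_X_def
  proof (intro conjI WX ballI allI)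
    show "(\<lambda>i. 0) \<in> W" using Y0 YW by blast
  next
    fix x y assume xy: "x \<in> W" "y \<in> W"
    have "\<exists>z\<in>Y. nnorm NN (\<lambda>i. (x i + y i) - z i) < \<epsilon>" if "0 < \<epsilon>" for \<epsilon>
    proof -
      obtain u v where uv: "u \<in> Y" "v \<in> Y" "nnorm NN (\<lambda>i. x i - u i) < \<epsilon>/2" "nnorm NN (\<lambda>i. y i - v i) < \<epsilon>/2"
        using W_approx[OF xy(1), of "\<epsilon>/2"] W_approx[OF xy(2), of "\<epsilon>/2"] \<open>0 < \<epsilon>\<close> by auto
      have "bdd (\<lambda>i. x i - u i)" "bdd (\<lambda>i. y i - v i)" using bd xy uv(1,2) WX YX by blast+
      from nnorm_add(1)[OF this]
      have "nnorm NN (\<lambda>i. (x i - u i) + (y i - v i)) < \<epsilon>" using uv by linarith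
      moreover have "(\<lambda>i. (x i - u i) + (y i - v i)) = (\<lambda>i. (x i + y i) - (u i + v i))" by auto
      ultimately show ?thesis using Yadd[OF uv(1,2)] by (intro bexI[of _ "\<lambda>i. u i + v i"]) auto
    qed
    moreover have "(\<lambda>i. x i + y i) \<in> XN NN" using XN_add xy WX by blast
    ultimately show "(\<lambda>i. x i + y i) \<in> W" by (simp add: W_def)
  next
    fix x d assume x: "x \<in> W"
    have "\<exists>z\<in>Y. nnorm NN (\<lambda>i. d * x i - z i) < \<epsilon>" if "0 < \<epsilon>" for \<epsilon>
    proof -
      define e where "e = \<epsilon> / (\<bar>d\<bar> + 1)"
      have e: "0 < e" "\<bar>d\<bar> * e < \<epsilon>" using that by (auto simp: e_def field_simps)
      obtain u where u: "u \<in> Y" "nnorm NN (\<lambda>i. x i - u i) < e" using W_approx[OF x e(1)] by blast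
      have "bdd (\<lambda>i. x i - u i)" using bd x u(1) WX YX by blast
      then have "nnorm NN (\<lambda>i. d * (x i - u i)) \<le> \<bar>d\<bar> * nnorm NN (\<lambda>i. x i - u i)" by (rule nnorm_scale_le(1))
      also have "\<dots> \<le> \<bar>d\<bar> * e" using u(2) by (intro mult_left_mono) auto
      finally show ?thesis using e(2) Yscale[OF u(1), of d]
        by (intro bexI[of _ "\<lambda>i. d * u i"]) (auto simp: right_diff_distrib)
    qed
    moreover have "(\<lambda>i. d * x i) \<in> XN NN" using XN_scale x WX by blast
    ultimately show "(\<lambda>i. d * x i) \<in> W" by (simp add: W_def)
  qed
  have Wadd: "(\<lambda>i. x i + y i) \<in> W" and Wscale: "(\<lambda>i. d * x i) \<in> W" if "x \<in> W" "y \<in> W" for x y d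
    using Ws that by (auto simp: subspace_X_def)
  have Wc: "closed_X NN W" unfolding closed_X_def
  proof (intro allI impI, elim conjE)
    fix s x assume s: "\<forall>k. s k \<in> W" and x: "x \<in> XN NN"
      and lim: "(\<lambda>k. nnorm NN (\<lambda>i. s k i - x i)) \<longlonglongrightarrow> 0"
    have "\<exists>y\<in>Y. nnorm NN (\<lambda>i. x i - y i) < \<epsilon>" if "0 < \<epsilon>" for \<epsilon>
    proof -
      obtain k where "norm (nnorm NN (\<lambda>i. s k i - x i) - 0) < \<epsilon>/2"
        using LIMSEQ_D[OF lim, of "\<epsilon>/2"] \<open>0 < \<epsilon>\<close> by (meson half_gt_zero order_refl)
      then have k: "nnorm NN (\<lambda>i. s k i - x i) < \<epsilon>/2" by simp
      obtain y where y: "y \<in> Y" "nnorm NN (\<lambda>i. s k i - y i) < \<epsilon>/2"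
        using W_approx[OF s[rule_format], of "\<epsilon>/2" k] \<open>0 < \<epsilon>\<close> by auto
      have b: "bdd x" "bdd (s k)" "bdd y" using bX x s WX y YX by blast+
      have "nnorm NN (\<lambda>i. x i - y i) \<le> nnorm NN (\<lambda>i. x i - s k i) + nnorm NN (\<lambda>i. s k i - y i)"
        using nnorm_triangle[OF b] .
      then show ?thesis using y k nnorm_diff_commute[OF b(1,2)] by (intro bexI[of _ y]) auto
    qed
    then show "x \<in> W" using x by (simp add: W_def)
  qed
  have Wlow: "c * nnorm NN w \<le> nnorm NN (T w)" if w: "w \<in> W" for w
  proof (rule field_le_epsilon)
    fix e :: real assume e: "0 < e"
    define d where "d = e / (c + C)"
    have "(c + C) * d = e" "0 < d" using e c C by (simp_all add: d_def)
    then have d: "0 < d" "c * d + C * d = e" by (simp_all add: distrib_right)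
    obtain y where y: "y \<in> Y" "nnorm NN (\<lambda>i. w i - y i) < d" using W_approx[OF w d(1)] by blast
    have X: "w \<in> XN NN" "y \<in> XN NN" using w WX y YX by auto
    have "nnorm NN w \<le> nnorm NN y + nnorm NN (\<lambda>i. w i - y i)"
      using nnorm_add(1)[OF bX[OF X(2)] bd[OF X]] by simp
    then have "c * nnorm NN w \<le> c * nnorm NN y + c * d"
      using y(2) c by (simp flip: distrib_left)
    also have "c * nnorm NN y \<le> nnorm NN (T y)" using low y by blast
    also have "nnorm NN (T y) \<le> nnorm NN (T w) + nnorm NN (T (\<lambda>i. w i - y i))"
      using nnorm_diff(1)[OF bX[OF TX[OF X(1)]] bX[OF TX[OF XN_diff[OF X]]]] by (simp add: T_diff[OF X])
    also have "nnorm NN (T (\<lambda>i. w i - y i)) \<le> C * d"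
      using T_le[OF XN_diff[OF X]] y(2) C by (meson less_imp_le mult_left_mono order_trans)
    finally show "c * nnorm NN w \<le> nnorm NN (T w) + e" using d(2) by simp
  qed
  have T_Z: "T z = (\<lambda>i. 0)" if "z \<in> Z" for z using ker that by (simp add: Z_def)
  have ZX: "Z \<subseteq> XN NN" by (auto simp: Z_def)
  have inter: "Z \<inter> W = {(\<lambda>i. 0)}"
  proof
    show "Z \<inter> W \<subseteq> {(\<lambda>i. 0)}"
    proof
      fix x assume x: "x \<in> Z \<inter> W"
      then have "c * nnorm NN x \<le> 0" using Wlow[of x] T_Z[of x] nnorm_zero by simp
      then have "nnorm NN x \<le> 0" using c by (simp add: mult_le_0_iff)
      then show "x \<in> {(\<lambda>i. 0)}" using XN_eq_zero x ZX by auto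
    qed
    show "{(\<lambda>i. 0)} \<subseteq> Z \<inter> W" using Zs Ws by (auto simp: subspace_X_def)
  qed
  define V where "V = {(\<lambda>i. z i + w i) | z w. z \<in> Z \<and> w \<in> W}"
  have V_I: "(\<lambda>i. z i + w i) \<in> V" if "z \<in> Z" "w \<in> W" for z w using that unfolding V_def by blast
  have Vs: "subspace_X NN V" unfolding subspace_X_def
  proof (intro conjI ballI allI)
    show "V \<subseteq> XN NN" using XN_add ZX WX by (auto simp: V_def)
    show "(\<lambda>i. 0) \<in> V" using V_I[of "\<lambda>i. 0" "\<lambda>i. 0"] inter by auto
  next
    fix x y assume "x \<in> V" "y \<in> V"
    then obtain z w z' w' where zw: "x = (\<lambda>i. z i + w i)" "z \<in> Z" "w \<in> W" "y = (\<lambda>i. z' i + w' i)" "z' \<in> Z" "w' \<in> W"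
      unfolding V_def by blast
    have "(\<lambda>i. z i + z' i) \<in> Z" "(\<lambda>i. w i + w' i) \<in> W" using zw Zs Ws by (auto simp: subspace_X_def)
    moreover have "(\<lambda>i. x i + y i) = (\<lambda>i. (z i + z' i) + (w i + w' i))" using zw by auto
    ultimately show "(\<lambda>i. x i + y i) \<in> V" using V_I[of "\<lambda>i. z i + z' i" "\<lambda>i. w i + w' i"] by simp
  next
    fix x d assume "x \<in> V"
    then obtain z w where zw: "x = (\<lambda>i. z i + w i)" "z \<in> Z" "w \<in> W" unfolding V_def by blast
    have "(\<lambda>i. d * z i) \<in> Z" "(\<lambda>i. d * w i) \<in> W" using zw Zs Ws by (auto simp: subspace_X_def)
    moreover have "(\<lambda>i. d * x i) = (\<lambda>i. d * z i + d * w i)" using zw by (auto simp: distrib_left)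
    ultimately show "(\<lambda>i. d * x i) \<in> V" using V_I[of "\<lambda>i. d * z i" "\<lambda>i. d * w i"] by simp
  qed
  have Vi: "inf_dim V"
  proof (rule inf_dim_mono[OF Zi])
    have "(\<lambda>i. 0) \<in> W" using inter by auto
    then show "Z \<subseteq> V" using V_I[of _ "\<lambda>i. 0"] by auto
  qed
  have Vc: "closed_X NN V" unfolding closed_X_def
  proof (intro allI impI, elim conjE)
    fix s x assume s: "\<forall>k. s k \<in> V" and x: "x \<in> XN NN"
      and lim: "(\<lambda>k. nnorm NN (\<lambda>i. s k i - x i)) \<longlonglongrightarrow> 0"
    have "\<forall>k. \<exists>z w. s k = (\<lambda>i. z i + w i) \<and> z \<in> Z \<and> w \<in> W" using s unfolding V_def by blast
    then obtain z w where zw: "\<And>k. s k = (\<lambda>i. z k i + w k i)" "\<And>k. z k \<in> Z" "\<And>k. w k \<in> W" by metis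
    have sX: "s k \<in> XN NN" for k using s Vs by (auto simp: subspace_X_def)
    have wX: "w k \<in> XN NN" and zX: "z k \<in> XN NN" for k using zw WX ZX by auto
    have wd: "(\<lambda>i. w k i - w l i) \<in> W" for k l
    proof -
      have "(\<lambda>i. w k i + -1 * w l i) \<in> W" by (rule Wadd[OF zw(3) Wscale[OF zw(3) zw(3)]])
      then show ?thesis by simp
    qed
    have Tw: "T (s k) = T (w k)" for k
      unfolding zw(1)[of k] using T_add[OF zX wX, of k k] T_Z[OF zw(2)] by simp
    \<comment> \<open>\<open>T\<close> annihilates the \<open>Z\<close>-components, so the lower
      bound on \<open>W\<close> turns convergence of the sums \<open>s k\<close> into the Cauchy
      property of the components \<open>w k\<close>.\<close>
    have wle: "c * nnorm NN (\<lambda>i. w k i - w l i) \<le> C * nnorm NN (\<lambda>i. s k i - s l i)" for k l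
    proof -
      have "c * nnorm NN (\<lambda>i. w k i - w l i) \<le> nnorm NN (T (\<lambda>i. w k i - w l i))" by (rule Wlow[OF wd])
      also have "T (\<lambda>i. w k i - w l i) = T (\<lambda>i. s k i - s l i)" by (simp add: T_diff wX sX Tw)
      finally show ?thesis using T_le[OF XN_diff[OF sX sX], of k l] by linarith
    qed
    obtain v where v: "v \<in> XN NN" "(\<lambda>k. nnorm NN (\<lambda>i. w k i - v i)) \<longlonglongrightarrow> 0"
    proof (rule XN_complete[of w])
      fix \<epsilon> :: real assume \<epsilon>: "0 < \<epsilon>"
      define e where "e = c * \<epsilon> / (2 * C)"
      have e: "0 < e" using \<epsilon> c C by (simp add: e_def)
      then obtain N where N: "\<forall>k\<ge>N. norm (nnorm NN (\<lambda>i. s k i - x i) - 0) < e"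
        using LIMSEQ_D[OF lim] by blast
      have "nnorm NN (\<lambda>i. w k i - w l i) < \<epsilon>" if "k \<ge> N" "l \<ge> N" for k l
      proof -
        have "nnorm NN (\<lambda>i. s k i - s l i) \<le> nnorm NN (\<lambda>i. s k i - x i) + nnorm NN (\<lambda>i. x i - s l i)"
          using nnorm_triangle bX sX x by blast
        also have "nnorm NN (\<lambda>i. x i - s l i) = nnorm NN (\<lambda>i. s l i - x i)"
          using nnorm_diff_commute bX sX x by blast
        finally have "nnorm NN (\<lambda>i. s k i - s l i) < 2 * e" 
          using N[rule_format, OF that(1)] N[rule_format, OF that(2)] by simp
        then have "C * nnorm NN (\<lambda>i. s k i - s l i) < C * (2 * e)" using C by simp
        also have "\<dots> = c * \<epsilon>" using C by (simp add: e_def)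
        finally have "c * nnorm NN (\<lambda>i. w k i - w l i) < c * \<epsilon>" using wle[of k l] by linarith
        then show ?thesis using c by simp
      qed
      then show "\<exists>N. \<forall>k\<ge>N. \<forall>l\<ge>N. nnorm NN (\<lambda>i. w k i - w l i) < \<epsilon>" by blast
    qed (use wX in auto)
    have vW: "v \<in> W" using Wc v zw(3) unfolding closed_X_def by blast
    define y where "y = (\<lambda>i. x i - v i)"
    have yX: "y \<in> XN NN" unfolding y_def by (rule XN_diff[OF x v(1)])
    have "(\<lambda>k. nnorm NN (\<lambda>i. z k i - y i)) \<longlonglongrightarrow> 0"
    proof (rule tendsto_sandwich[OF _ _ tendsto_const])
      show "\<forall>\<^sub>F k in sequentially. 0 \<le> nnorm NN (\<lambda>i. z k i - y i)"
        using nnorm_nonneg[OF bd[OF zX yX]] by simp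
      have "nnorm NN (\<lambda>i. z k i - y i) \<le> nnorm NN (\<lambda>i. s k i - x i) + nnorm NN (\<lambda>i. w k i - v i)" for k
      proof -
        have "(\<lambda>i. z k i - y i) = (\<lambda>i. (s k i - x i) - (w k i - v i))" by (auto simp: zw(1) y_def)
        then show ?thesis using nnorm_diff(1)[OF bd[OF sX x] bd[OF wX v(1)], of k k] by simp
      qed
      then show "\<forall>\<^sub>F k in sequentially. nnorm NN (\<lambda>i. z k i - y i) \<le>
          nnorm NN (\<lambda>i. s k i - x i) + nnorm NN (\<lambda>i. w k i - v i)" by simp
      show "(\<lambda>k. nnorm NN (\<lambda>i. s k i - x i) + nnorm NN (\<lambda>i. w k i - v i)) \<longlonglongrightarrow> 0"
        using tendsto_add[OF lim v(2)] by simp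
    qed
    then have "y \<in> Z" using Zc yX zw(2) unfolding closed_X_def by blast
    moreover have "x = (\<lambda>i. y i + v i)" by (auto simp: y_def)
    ultimately show "x \<in> V" using V_I[of y v] vW by simp
  qed
  have "\<not> hered_indec NN" unfolding hered_indec_def not_not
    using Vs Vc Vi Zs Zc Zi Ws Wc Wi inter V_def
    by (intro exI[of _ V] exI[of _ Z] exI[of _ W] conjI)
  then show False using HI by blast
qed

end

section \<open>Weights and complexities\<close>

locale MN_schreier_space =
  fixes p q :: real and m n :: "nat \<Rightarrow> nat" and NN :: "(nat \<Rightarrow> real) set" and s :: "nat \<Rightarrow> nat"
  assumes p: "1 < p" and q: "1 < q" and pq: "1/p + 1/q = 1"
    and MN: "cond_MN m n" and schr: "MNq_schreier m n p q NN"
    and s: "incr_pos s" and m_prod: "\<And>j. 2 \<le> j \<Longrightarrow> m (2*j) = (\<Prod>i\<in>{1..<j}. m (2*i) ^ s i)"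
begin

lemma m1: "4 \<le> m 1" and m2: "m 2 = m 1 ^ 5" and m_odd: "1 \<le> j \<Longrightarrow> m (2*j+1) = m (2*j) ^ 5"
  and m_less: "1 \<le> i \<Longrightarrow> m i < m (Suc i)"
  and n1: "1 \<le> n 1" "5 * n 1 < n 2" and n_fval: "2 \<le> j \<Longrightarrow> 4 * fval m n j < n (2*j)"
  using MN by (auto simp: cond_MN_def incr_pos_def)

lemma m_mono:
  assumes "1 \<le> i" "i \<le> j"
  shows "m i \<le> m j"
  using assms(2)
proof (induction j rule: dec_induct)
  case (step k)
  then show ?case using m_less[of k] assms(1) by simp
qed simp

lemma m_ge4: "1 \<le> i \<Longrightarrow> 4 \<le> m i"
  using m_mono[of 1 i] m1 by simp

text \<open>The shift at \<open>l = 1\<close> makes the relation between \<open>m (2*(l+1))\<close> and \<open>m (2*l)\<close> uniform in \<open>l\<close>.\<close>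

definition sx :: "nat \<Rightarrow> nat" where "sx i = (if i = 1 then s 1 - 1 else s i)"

text \<open>Since \<open>m 3 = m 2 ^ 5\<close> lies strictly below \<open>m 4 = m 2 ^ s 1\<close>,
  the exponent must exceed 5.\<close>

lemma s1: "6 \<le> s 1"
proof -
  have "m 3 = m 2 ^ 5" using m_odd[of 1] by (simp add: numeral_3_eq_3)
  moreover have "m 4 = m 2 ^ s 1" using m_prod[of 2] by (simp add: eval_nat_numeral)
  moreover have "m 3 < m 4" using m_less[of 3] by (simp add: eval_nat_numeral)
  ultimately have "m 2 ^ 5 < m 2 ^ s 1" by simp
  moreover have "1 < m 2" using m_ge4[of 2] by simp
  ultimately show ?thesis by (simp add: power_strict_increasing_iff)
qed

lemma sx_pos: "1 \<le> l \<Longrightarrow> 1 \<le> sx l"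
proof -
  assume l: "1 \<le> l"
  have "1 \<le> s l" using l
  proof (induction l rule: dec_induct)
    case base
    then show ?case using s1 by simp
  next
    case (step k)
    then show ?case using s by (force simp: incr_pos_def)
  qed
  then show ?thesis using s1 by (auto simp: sx_def)
qed

lemma m_Suc:
  assumes "1 \<le> l"
  shows "m (2 * Suc l) = m (2*l) ^ Suc (sx l)"
proof (cases "l = 1")
  case True
  then show ?thesis using m_prod[of 2] s1 by (simp add: sx_def eval_nat_numeral)
next
  case False
  then have l: "2 \<le> l" using assms by simp
  have "m (2 * Suc l) = (\<Prod>i\<in>{1..<Suc l}. m (2*i) ^ s i)" using m_prod[of "Suc l"] l by simp
  also have "\<dots> = (\<Prod>i\<in>{1..<l}. m (2*i) ^ s i) * m (2*l) ^ s l"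
    using l by (subst prod.atLeastLessThan_Suc) auto
  also have "\<dots> = m (2*l) * m (2*l) ^ s l" using m_prod[OF l] by simp
  finally show ?thesis using False by (simp add: sx_def)
qed

text \<open>Exponents of the even weights in the base \<open>\<beta>\<close>, the square root of
  \<open>m 1\<close>; the factor 10 comes from \<open>m 2 = m 1 ^ 5\<close>. In this scale weights
  along a branch add up, and each exponent is a multiple of the preceding one.\<close>

definition ex :: "nat \<Rightarrow> nat" where "ex l = 10 * (\<Prod>i\<in>{1..<l}. Suc (sx i))"

definition \<beta> :: real where "\<beta> = sqrt (real (m 1))"

lemma \<beta>: "2 \<le> \<beta>" "\<beta>\<^sup>2 = real (m 1)"
proof -
  have "sqrt 4 \<le> \<beta>" unfolding \<beta>_def using m1 by (intro real_sqrt_le_mono) simp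
  then show "2 \<le> \<beta>" by simp
qed (simp add: \<beta>_def)

lemma ex_1: "ex 1 = 10" by (simp add: ex_def)

lemma ex_Suc: "1 \<le> l \<Longrightarrow> ex (Suc l) = Suc (sx l) * ex l"
  by (simp add: ex_def prod.atLeastLessThan_Suc)

lemma ex_pos: "0 < ex l"
  by (simp add: ex_def prod_pos)

lemma ex_mono:
  assumes "k \<le> l"
  shows "ex k \<le> ex l"
proof (rule lift_Suc_mono_le[OF _ assms])
  show "ex i \<le> ex (Suc i)" for i
  proof (cases "1 \<le> i")
    case True
    then show ?thesis using ex_Suc[OF True] by simp
  next
    case False
    then show ?thesis by (simp add: ex_def)
  qed
qed

lemma m_eq_\<beta>_power: "1 \<le> l \<Longrightarrow> real (m (2*l)) = \<beta> ^ ex l"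
proof (induction l rule: dec_induct)
  case base
  have "\<beta> ^ 10 = (\<beta>\<^sup>2) ^ 5" by (simp flip: power_mult)
  then show ?case using \<beta>(2) m2 ex_1 by simp
next
  case (step l)
  have "real (m (2 * Suc l)) = real (m (2*l)) ^ Suc (sx l)" using m_Suc step by simp
  also have "\<dots> = \<beta> ^ (ex l * Suc (sx l))" using step by (simp only: power_mult)
  finally show ?case using ex_Suc[of l] step by (simp only: mult.commute)
qed

text \<open>The \<open>Max\<close> in \<open>fval\<close> can be used only over a finite set. All
  bases are at least 2, so \<open>k \<le> m i ^ k\<close> and every exponent is at most
  \<open>m (2*j)\<close>.\<close>

lemma finite_fval:
  assumes "2 \<le> j"
  shows "finite {\<rho> * n 1 + (\<Sum>i\<in>{1..<j}. \<rho>s i * n (2*i)) | \<rho> \<rho>s.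
      m 1 ^ \<rho> * (\<Prod>i\<in>{1..<j}. m (2*i) ^ \<rho>s i) < m (2*j)}" (is "finite ?S")
proof (rule finite_subset)
  let ?M = "m (2*j)"
  let ?B = "?M * n 1 + (\<Sum>i\<in>{1..<j}. ?M * n (2*i))"
  show "?S \<subseteq> {..?B}"
  proof
    fix x assume "x \<in> ?S"
    then obtain \<rho> \<rho>s where x: "x = \<rho> * n 1 + (\<Sum>i\<in>{1..<j}. \<rho>s i * n (2*i))"
      and less: "m 1 ^ \<rho> * (\<Prod>i\<in>{1..<j}. m (2*i) ^ \<rho>s i) < ?M" by blast
    have exp: "k \<le> m i ^ k" if "1 \<le> i" for i k
    proof -
      have "k < 2 ^ k" by simp
      also have "\<dots> \<le> m i ^ k" using m_ge4[OF that] by (intro power_mono) auto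
      finally show ?thesis by simp
    qed
    have pos: "1 \<le> m i ^ k" if "1 \<le> i" for i k using m_ge4[OF that] by simp
    have prod_ge: "1 \<le> (\<Prod>i\<in>A. m (2*i) ^ \<rho>s i)" if "A \<subseteq> {1..<j}" for A
      using that pos by (intro prod_ge_1) auto
    have "\<rho> \<le> m 1 ^ \<rho> * (\<Prod>i\<in>{1..<j}. m (2*i) ^ \<rho>s i)"
      using mult_le_mono[OF exp[of 1 \<rho>] prod_ge[of "{1..<j}"]] by simp
    then have 1: "\<rho> \<le> ?M" using less by linarith
    have 2: "\<rho>s i \<le> ?M" if i: "i \<in> {1..<j}" for i
    proof -
      have "\<rho>s i \<le> m (2*i) ^ \<rho>s i" using exp i by simp
      also have "\<dots> \<le> m (2*i) ^ \<rho>s i * (\<Prod>i\<in>{1..<j} - {i}. m (2*i) ^ \<rho>s i)"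
        using prod_ge[of "{1..<j} - {i}"] by simp
      also have "\<dots> = (\<Prod>i\<in>{1..<j}. m (2*i) ^ \<rho>s i)" using i by (subst prod.remove[of _ i]) auto
      also have "\<dots> \<le> m 1 ^ \<rho> * (\<Prod>i\<in>{1..<j}. m (2*i) ^ \<rho>s i)"
        using pos[of 1 \<rho>] by simp
      finally show ?thesis using less by linarith
    qed
    have "(\<Sum>i\<in>{1..<j}. \<rho>s i * n (2*i)) \<le> (\<Sum>i\<in>{1..<j}. ?M * n (2*i))"
      using 2 by (intro sum_mono) simp
    then show "x \<in> {..?B}" using 1 by (auto simp: x intro!: add_mono)
  qed
qed simp

text \<open>The competitor in the maximum defining \<open>fval\<close> has \<open>sx l\<close>
  factors \<open>m (2*l)\<close> and no others, one factor short of
  \<open>m (2 * Suc l)\<close>.\<close>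

lemma n_growth:
  assumes "1 \<le> l"
  shows "4 * (sx l * n (2*l)) < n (2 * Suc l)"
proof -
  let ?\<rho>s = "\<lambda>i. if i = l then sx l else 0"
  have "(\<Prod>i\<in>{1..<Suc l}. m (2*i) ^ ?\<rho>s i) = (\<Prod>i\<in>{1..<Suc l}. if i = l then m (2*i) ^ sx l else 1)"
    by (intro prod.cong) auto
  also have "\<dots> = m (2*l) ^ sx l" using assms by simp
  also have "\<dots> < m (2 * Suc l)" unfolding m_Suc[OF assms]
    using m_ge4[of "2*l"] assms by simp
  finally have less: "m 1 ^ 0 * (\<Prod>i\<in>{1..<Suc l}. m (2*i) ^ ?\<rho>s i) < m (2 * Suc l)" by simp
  have "(\<Sum>i\<in>{1..<Suc l}. ?\<rho>s i * n (2*i)) = (\<Sum>i\<in>{1..<Suc l}. if i = l then sx l * n (2*i) else 0)"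
    by (intro sum.cong) auto
  also have "\<dots> = sx l * n (2*l)" using assms by simp
  finally have "sx l * n (2*l) = 0 * n 1 + (\<Sum>i\<in>{1..<Suc l}. ?\<rho>s i * n (2*i))" by simp
  with less have mem: "sx l * n (2*l) \<in> {\<rho> * n 1 + (\<Sum>i\<in>{1..<Suc l}. \<rho>s i * n (2*i)) | \<rho> \<rho>s.
      m 1 ^ \<rho> * (\<Prod>i\<in>{1..<Suc l}. m (2*i) ^ \<rho>s i) < m (2 * Suc l)}"
    by (intro CollectI exI[of _ 0] exI[of _ ?\<rho>s] conjI)
  have "sx l * n (2*l) \<le> fval m n (Suc l)" unfolding fval_def
    by (rule Max_ge[OF finite_fval mem]) (use assms in simp)
  then show ?thesis using n_fval[of "Suc l"] assms by simp
qed

text \<open>The increment at \<open>l = 1\<close> pays for replacing ten odd weights by one factor \<open>m 2\<close>.\<close>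

definition nx :: "nat \<Rightarrow> nat" where "nx i = (if i = 1 then n 2 + 4 else n (2*i))"

lemma nx_ge: "n (2*i) \<le> nx i"
  by (simp add: nx_def)

lemma nx_1: "10 \<le> nx 1"
  using n1 by (simp add: nx_def)

lemma sx_1: "5 \<le> sx 1"
  using s1 by (simp add: sx_def)

text \<open>Trading \<open>Suc (sx l)\<close> steps of level \<open>l\<close> for one step of the
  next level must not lose complexity, or the greedy expansion would not be optimal. At
  \<open>l = 1\<close> the increment 4 fits because \<open>sx 1 \<ge> 5\<close> and
  \<open>n 2 \<ge> 6\<close>.\<close>

lemma nx_Suc:
  assumes "1 \<le> l"
  shows "Suc (sx l) * nx l \<le> nx (Suc l)"
proof (cases "l = 1")
  case True
  have "5 * 6 \<le> sx 1 * n 2" "4 * sx 1 \<le> sx 1 * n 2" "n 2 \<le> sx 1 * n 2"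
    using sx_1 n1 mult_le_mono[of 5 "sx 1" 6 "n 2"] by auto
  moreover have "Suc (sx 1) * (n 2 + 4) = sx 1 * n 2 + 4 * sx 1 + n 2 + 4" by (simp add: algebra_simps)
  ultimately have "Suc (sx 1) * (n 2 + 4) \<le> 4 * (sx 1 * n 2)" by linarith
  then show ?thesis using n_growth[of 1] True by (simp add: nx_def)
next
  case False
  have "n (2*l) \<le> sx l * n (2*l)" using sx_pos[OF assms] by simp
  then have "n (2*l) + sx l * n (2*l) \<le> n (2 * Suc l)" using n_growth[OF assms] by linarith
  then show ?thesis using False assms by (simp add: nx_def)
qed

text \<open>\<open>cost j (h - 1)\<close> is the largest total complexity of a branch whose weights, measured in powers of
  \<open>\<beta>\<close>, add up to less than \<open>h\<close>. A step of weight \<open>\<beta> ^ ex i\<close> has complexity \<open>nx i\<close>, a step of weight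
  \<open>\<beta>\<close> has complexity 1; the maximum is attained by the greedy expansion.\<close>

primrec cost :: "nat \<Rightarrow> nat \<Rightarrow> nat" where
  "cost 0 = (\<lambda>d. d)"
| "cost (Suc l) = (\<lambda>d. (d div ex (Suc l)) * nx (Suc l) + cost l (d mod ex (Suc l)))"

lemma cost_add_ex: "1 \<le> l \<Longrightarrow> cost l (d + k * ex l) = cost l d + k * nx l"
proof -
  assume "1 \<le> l"
  then obtain l' where l': "l = Suc l'" by (cases l) auto
  have "(d + k * ex l) div ex l = d div ex l + k" "(d + k * ex l) mod ex l = d mod ex l"
    using ex_pos[of l] by simp_all
  then show ?thesis unfolding l' by (simp add: algebra_simps)
qed

text \<open>This settles carries: a full unit of the next level, paid for in lower digits, costs at
  most one step of that level. At \<open>l = 0\<close> it says that ten odd steps do not exceed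
  \<open>nx 1\<close>.\<close>

lemma cost_add_ex_Suc: "cost l (d + ex (Suc l)) \<le> cost l d + nx (Suc l)"
proof (cases "1 \<le> l")
  case True
  then show ?thesis using cost_add_ex[OF True, of d "Suc (sx l)"] nx_Suc[OF True] ex_Suc[OF True]
    by simp
next
  case False
  then have "l = 0" by simp
  then show ?thesis using nx_1 ex_1 by simp
qed

text \<open>In this mixed-radix expansion, adding \<open>e\<close> either changes only the remainder
  or produces a single carry, since \<open>e\<close> does not exceed the unit;
  \<open>cost_add_ex_Suc\<close> pays for the carry.\<close>

lemma cost_step:
  assumes "\<And>d. cost j d + v \<le> cost j (d + e)" "e \<le> ex (Suc j)" "j \<le> l"
  shows "cost l d + v \<le> cost l (d + e)"
  using assms(3)
proof (induction l arbitrary: d rule: dec_induct)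
  case base
  then show ?case using assms by simp
next
  case (step l)
  define E where "E = ex (Suc l)"
  define a b where "a = d div E" "b = d mod E"
  have E: "0 < E" "e \<le> E" using ex_pos ex_mono[of "Suc j" "Suc l"] assms(2) step by (auto simp: E_def)
  have d: "d = a * E + b" "b < E" using E by (auto simp: a_b_def)
  show ?case
  proof (cases "b + e < E")
    case True
    then have "(d + e) div E = a" "(d + e) mod E = b + e" using d by (simp_all add: add.assoc)
    then show ?thesis using step.IH[of b] d by (simp flip: E_def)
  next
    case False
    define c where "c = b + e - E"
    have c: "b + e = c + E" "c < E" using False d E by (auto simp: c_def)
    then have "d + e = Suc a * E + c" using d by simp
    then have "(d + e) div E = Suc a" "(d + e) mod E = c" using c by (simp_all del: mult_Suc)
    moreover have "cost l b + v \<le> cost l c + nx (Suc l)"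
      using step.IH[of b] cost_add_ex_Suc[of l c] c(1) by (simp flip: E_def)
    ultimately show ?thesis using d by (simp flip: E_def)
  qed
qed

lemma cost_even:
  assumes "1 \<le> i" "i \<le> l"
  shows "cost l d + n (2*i) \<le> cost l (d + ex i)"
proof -
  have "cost l d + nx i \<le> cost l (d + ex i)"
    by (rule cost_step[of i]) (use cost_add_ex[of i _ 1] assms ex_mono[of i "Suc i"] in auto)
  then show ?thesis using nx_ge[of i] by linarith
qed

lemma cost_odd: "cost l d + 1 \<le> cost l (d + 1)"
  by (rule cost_step[of 0]) (use ex_1 in auto)

text \<open>\<open>ex l - 1\<close> is the largest exponent of a total weight still below
  \<open>m (2*l)\<close>. Thus \<open>\<kappa>\<close> takes the role of \<open>fval\<close>, with
  odd nodes entering at weight \<open>\<beta>\<close> and order 1.\<close>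

definition \<kappa> :: "nat \<Rightarrow> nat" where "\<kappa> l = cost l (ex l - 1)"

lemma \<kappa>_Suc:
  assumes "1 \<le> l"
  shows "\<kappa> (Suc l) = sx l * nx l + \<kappa> l"
proof -
  have "\<kappa> (Suc l) = cost l (ex (Suc l) - 1)" using ex_pos[of "Suc l"] by (simp add: \<kappa>_def)
  also have "ex (Suc l) - 1 = (ex l - 1) + sx l * ex l" using ex_Suc[OF assms] ex_pos[of l] by simp
  finally show ?thesis using cost_add_ex[OF assms] by (simp add: \<kappa>_def)
qed

lemma \<kappa>_1: "\<kappa> 1 = 9"
  using ex_1 by (simp add: \<kappa>_def)

text \<open>The factor 4 in \<open>n_growth\<close> is nearly exhausted at \<open>l = 2\<close>:
  \<open>2 * \<kappa> 2 + 1\<close> equals \<open>2 * (sx 1 * n 2) + 8 * sx 1 + 19\<close>, and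
  \<open>sx 1 \<ge> 5\<close>, \<open>n 2 \<ge> 6\<close> bound this by
  \<open>4 * (sx 1 * n 2)\<close>. In the induction step 3 multiples of
  \<open>sx l * n (2*l)\<close> suffice.\<close>

lemma \<kappa>_bound: "2 \<le> l \<Longrightarrow> 2 * \<kappa> l + 1 \<le> n (2*l)"
proof (induction l rule: dec_induct)
  case base
  have "\<kappa> 2 = sx 1 * (n 2 + 4) + 9" using \<kappa>_Suc[of 1] \<kappa>_1 by (simp add: nx_def numeral_2_eq_2)
  moreover have "6 * sx 1 \<le> sx 1 * n 2" using n1 by simp
  ultimately show ?case using n_growth[of 1] sx_1 by (simp add: algebra_simps eval_nat_numeral)
next
  case (step l)
  have "\<kappa> (Suc l) = sx l * n (2*l) + \<kappa> l" using \<kappa>_Suc step by (simp add: nx_def)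
  moreover have "n (2*l) \<le> sx l * n (2*l)" using sx_pos[of l] step by simp
  ultimately show ?case using n_growth[of l] step by linarith
qed

section \<open>The norming set\<close>

lemma Nk_subset: "1 \<le> j \<Longrightarrow> Nk m n q NN j \<subseteq> NN"
  and NN_subset: "NN \<subseteq> (\<Union>j\<in>{1..}. Nk m n q NN j) \<union> Ninf m n p q NN
           \<union> {unitf k | k. 1 \<le> k} \<union> {(\<lambda>i. - unitf k i) | k. 1 \<le> k}"
  using schr by (auto simp: MNq_schreier_def)

sublocale norming_set NN
  using schr by unfold_locales (simp add: MNq_schreier_def)

text \<open>One layer of a functional, common to even and odd weights. Only pointwise domination is
  kept, so that restricting to an interval and weakening the weight stay within the
  definition.\<close>

definition node :: "(nat \<Rightarrow> real) \<Rightarrow> real \<Rightarrow> (nat \<Rightarrow> real) \<Rightarrow> (nat \<Rightarrow> real) list \<Rightarrow> bool" where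
  "node f w \<gamma> fs \<longleftrightarrow> set fs \<subseteq> NN \<and> (\<forall>g\<in>set fs. supp g \<noteq> {}) \<and> sorted_wrt set_less (map supp fs) \<and>
     (\<Sum>r<length fs. \<bar>\<gamma> r\<bar> powr q) \<le> 1 \<and> (\<forall>t. \<bar>f t\<bar> \<le> \<bar>lin_comb \<gamma> fs t\<bar> / w)"

lemma Nk_node:
  assumes "f \<in> Nk m n q NN k"
  obtains \<gamma> fs where "node f (real (m (2*k))) \<gamma> fs"
    "(\<lambda>r. Min (supp (fs ! r))) ` {..<length fs} \<in> schreier (n (2*k))"
proof -
  obtain \<gamma> fs where f: "f = (\<lambda>i. lin_comb \<gamma> fs i / real (m (2*k)))" "in_ball_lq q 1 (length fs) \<gamma>"
    "set fs \<subseteq> NN" "admissible (n (2*k)) fs"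
    using assms by (auto simp: Nk_def)
  have "(\<lambda>r. Min (supp (fs ! r))) ` {..<length fs} = Min ` set (map supp fs)"
    by (force simp: in_set_conv_nth)
  then show ?thesis using that[of \<gamma> fs] f
    by (simp add: node_def in_ball_lq_def admissible_def admissible_sets_def)
qed

text \<open>The factor \<open>2 powr (1/p) \<le> 2 \<le> \<beta>\<close> is absorbed into the weight, of which only \<open>\<beta>\<close> is kept.\<close>

lemma Ninf_node:
  assumes "f \<in> Ninf m n p q NN"
  obtains \<gamma> fs js where "node f \<beta> \<gamma> fs" "length js = length fs" "distinct js"
    "\<And>l. l < length fs \<Longrightarrow> 1 \<le> js ! l \<and> fs ! l \<in> Nk m n q NN (js ! l)"
proof -
  obtain k \<gamma> E fs js where f: "f = (\<lambda>i. restr E (lin_comb \<gamma> fs) i / real (m (2*k+1)))"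
    "in_ball_lq q (2 powr (1/p)) (length fs) \<gamma>" "admissible (n (2*k+1)) fs"
    and js: "length js = length fs" "distinct js"
      "\<forall>l<length fs. 1 \<le> js ! l \<and> fs ! l \<in> Nk m n q NN (js ! l)"
    using assms unfolding Ninf_def by blast
  define c where "c = (2::real) powr (1/p)"
  have c: "0 < c" "c \<le> 2" using p powr_mono[of "1/p" 1 2] by (simp_all add: c_def)
  define \<gamma>' where "\<gamma>' r = \<gamma> r / c" for r
  have "(\<Sum>r<length fs. \<bar>\<gamma>' r\<bar> powr q) = (\<Sum>r<length fs. \<bar>\<gamma> r\<bar> powr q) / c powr q"
    using c by (simp add: \<gamma>'_def powr_divide abs_divide sum_divide_distrib)
  then have ball: "(\<Sum>r<length fs. \<bar>\<gamma>' r\<bar> powr q) \<le> 1"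
    using f(2) c by (simp add: in_ball_lq_def c_def)
  have lc: "lin_comb \<gamma> fs t = c * lin_comb \<gamma>' fs t" for t
    using c by (simp add: lin_comb_def \<gamma>'_def sum_distrib_left)
  have "\<beta> * c \<le> \<beta> * \<beta>" using \<beta>(1) c by (intro mult_left_mono) auto
  also have "\<dots> \<le> real (m (2*k+1))" using \<beta>(2) m_mono[of 1 "2*k+1"] by (simp add: power2_eq_square)
  finally have w: "c / real (m (2*k+1)) \<le> 1 / \<beta>" using \<beta>(1) m_ge4[of "2*k+1"]
    by (simp add: field_simps)
  have "\<bar>f t\<bar> \<le> \<bar>lin_comb \<gamma>' fs t\<bar> / \<beta>" for t
  proof -
    have "\<bar>f t\<bar> \<le> \<bar>lin_comb \<gamma> fs t\<bar> / real (m (2*k+1))" by (simp add: f(1) restr_def)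
    also have "\<dots> = \<bar>lin_comb \<gamma>' fs t\<bar> * (c / real (m (2*k+1)))" using c by (simp add: lc abs_mult)
    also have "\<dots> \<le> \<bar>lin_comb \<gamma>' fs t\<bar> * (1 / \<beta>)" by (intro mult_left_mono w) simp
    finally show ?thesis by simp
  qed
  moreover have "set fs \<subseteq> NN" using js(3) Nk_subset by (force simp: in_set_conv_nth)
  ultimately have "node f \<beta> \<gamma>' fs"
    using ball f(3) by (simp add: node_def admissible_def admissible_sets_def)
  then show ?thesis using that js by blast
qed

section \<open>Estimates for a single layer\<close>

lemma node_disjoint:
  assumes "node f w \<gamma> fs" "r < r'" "r' < length fs"
  shows "set_less (supp (fs ! r)) (supp (fs ! r'))"
  using assms sorted_wrt_nth_less[of set_less "map supp fs" r r'] by (simp add: node_def)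

lemma node_coord:
  assumes "node f w \<gamma> fs" "r < length fs" "t \<in> supp (fs ! r)"
  shows "\<bar>f t\<bar> \<le> \<bar>\<gamma> r\<bar> * \<bar>(fs ! r) t\<bar> / w"
proof -
  have "(fs ! r') t = 0" if "r' < length fs" "r' \<noteq> r" for r'
  proof -
    have "t \<notin> supp (fs ! r')"
      using that assms node_disjoint[OF assms(1), of r r'] node_disjoint[OF assms(1), of r' r]
      by (cases "r < r'") (auto simp: set_less_def)
    then show ?thesis by (simp add: supp_def)
  qed
  then have "lin_comb \<gamma> fs t = (\<Sum>k<length fs. if k = r then \<gamma> k * (fs ! k) t else 0)"
    unfolding lin_comb_def by (intro sum.cong) auto
  also have "\<dots> = \<gamma> r * (fs ! r) t" using assms(2) by simp
  finally have "\<bar>lin_comb \<gamma> fs t\<bar> = \<bar>\<gamma> r\<bar> * \<bar>(fs ! r) t\<bar>" by (simp add: abs_mult)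
  then show ?thesis using assms(1) unfolding node_def by metis
qed

lemma node_supp:
  assumes "node f w \<gamma> fs" "f t \<noteq> 0"
  obtains r where "r < length fs" "t \<in> supp (fs ! r)"
proof -
  have "\<bar>f t\<bar> \<le> \<bar>lin_comb \<gamma> fs t\<bar> / w" using assms(1) by (simp add: node_def)
  then have "lin_comb \<gamma> fs t \<noteq> 0" using assms(2) by auto
  then obtain r where "r < length fs" "\<gamma> r * (fs ! r) t \<noteq> 0"
    unfolding lin_comb_def by (metis (no_types, lifting) lessThan_iff sum.neutral)
  then show ?thesis using that by (simp add: supp_def)
qed

lemma node_\<gamma>:
  assumes "node f w \<gamma> fs" "r < length fs"
  shows "\<bar>\<gamma> r\<bar> \<le> 1"
proof -
  have "\<bar>\<gamma> r\<bar> powr q \<le> (\<Sum>r<length fs. \<bar>\<gamma> r\<bar> powr q)"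
    by (rule member_le_sum) (use assms in auto)
  also have "\<dots> \<le> 1" using assms by (simp add: node_def)
  finally have "\<bar>\<gamma> r\<bar> powr q \<le> 1" .
  then show ?thesis using q gr_one_powr[of "\<bar>\<gamma> r\<bar>" q] by linarith
qed

text \<open>The supports of the children are disjoint, so each coordinate of \<open>f\<close> is
  governed by one child, and coefficients in the unit ball of \<open>\<ell>\<^sub>q\<close> combine
  the bounds \<open>D\<close> without loss.\<close>

lemma node_lq:
  assumes nd: "node f w \<gamma> fs" and w: "0 < w" and A: "finite A"
    and D: "\<And>r. r < length fs \<Longrightarrow> (\<Sum>t\<in>A \<inter> supp (fs ! r). \<bar>(fs ! r) t\<bar> powr q) \<le> D" and "0 \<le> D"
  shows "(\<Sum>t\<in>A. \<bar>f t\<bar> powr q) \<le> D * (1 / w) powr q"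
proof -
  let ?g = "\<lambda>r t. \<bar>\<gamma> r\<bar> powr q * \<bar>(fs ! r) t\<bar> powr q * (1 / w) powr q"
  have pt: "\<bar>f t\<bar> powr q \<le> (\<Sum>r<length fs. ?g r t)" for t
  proof (cases "f t = 0")
    case True
    then show ?thesis by (simp add: sum_nonneg)
  next
    case False
    then obtain r where r: "r < length fs" "t \<in> supp (fs ! r)" using node_supp[OF nd] by blast
    have "\<bar>f t\<bar> powr q \<le> (\<bar>\<gamma> r\<bar> * \<bar>(fs ! r) t\<bar> * (1 / w)) powr q"
      using node_coord[OF nd r] q by (intro powr_mono2) auto
    also have "\<dots> = ?g r t" using w by (simp only: powr_mult)
    also have "\<dots> \<le> (\<Sum>r<length fs. ?g r t)" by (rule member_le_sum) (use r in auto)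
    finally show ?thesis .
  qed
  have "(\<Sum>t\<in>A. \<bar>f t\<bar> powr q) \<le> (\<Sum>t\<in>A. \<Sum>r<length fs. ?g r t)" by (intro sum_mono pt)
  also have "\<dots> = (\<Sum>r<length fs. \<bar>\<gamma> r\<bar> powr q * (1 / w) powr q * (\<Sum>t\<in>A. \<bar>(fs ! r) t\<bar> powr q))"
    by (subst sum.swap) (simp add: sum_distrib_left mult_ac)
  also have "\<dots> \<le> (\<Sum>r<length fs. \<bar>\<gamma> r\<bar> powr q * (1 / w) powr q * D)"
  proof (intro sum_mono mult_left_mono)
    fix r assume r: "r \<in> {..<length fs}"
    have "(\<Sum>t\<in>A. \<bar>(fs ! r) t\<bar> powr q) = (\<Sum>t\<in>A \<inter> supp (fs ! r). \<bar>(fs ! r) t\<bar> powr q)"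
      by (rule sum.mono_neutral_right) (use A in \<open>auto simp: supp_def\<close>)
    then show "(\<Sum>t\<in>A. \<bar>(fs ! r) t\<bar> powr q) \<le> D" using D r by simp
  qed simp
  also have "\<dots> = (\<Sum>r<length fs. \<bar>\<gamma> r\<bar> powr q) * ((1 / w) powr q * D)"
    by (simp add: sum_distrib_right mult.assoc)
  also have "\<dots> \<le> 1 * ((1 / w) powr q * D)"
    using nd \<open>0 \<le> D\<close> by (intro mult_right_mono) (auto simp: node_def)
  finally show ?thesis by (simp add: mult.commute)
qed

lemma node_large:
  assumes "node f w \<gamma> fs" "2 \<le> w" "r < length fs" "t \<in> supp (fs ! r)" "(1/2) ^ Suc k < \<bar>f t\<bar>"
  shows "(1/2) ^ k < \<bar>(fs ! r) t\<bar>"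
proof -
  have "\<bar>f t\<bar> \<le> \<bar>\<gamma> r\<bar> * \<bar>(fs ! r) t\<bar> / w" using node_coord assms by blast
  also have "\<dots> \<le> 1 * \<bar>(fs ! r) t\<bar> / 2"
    using node_\<gamma>[OF assms(1,3)] assms(2) by (intro frac_le mult_right_mono) auto
  finally show ?thesis using assms(5) by simp
qed

lemma NN_cases:
  assumes "f \<in> NN"
  obtains k where "1 \<le> k" "f = unitf k \<or> f = (\<lambda>i. - unitf k i)"
  | k \<gamma> fs where "1 \<le> k" "node f (real (m (2*k))) \<gamma> fs"
    "(\<lambda>r. Min (supp (fs ! r))) ` {..<length fs} \<in> schreier (n (2*k))"
  | \<gamma> fs js where "node f \<beta> \<gamma> fs" "length js = length fs" "distinct js"
    "\<And>l. l < length fs \<Longrightarrow> 1 \<le> js ! l \<and> fs ! l \<in> Nk m n q NN (js ! l)"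
proof -
  consider k where "1 \<le> k" "f \<in> Nk m n q NN k" | "f \<in> Ninf m n p q NN"
    | k where "1 \<le> k" "f = unitf k \<or> f = (\<lambda>i. - unitf k i)"
    using assms NN_subset by fastforce
  then show ?thesis
    by cases (metis Nk_node that(2), metis Ninf_node that(3), metis that(1))
qed

lemma m_ge2: "1 \<le> k \<Longrightarrow> 2 \<le> real (m (2*k))"
  using m_ge4[of "2*k"] by simp

text \<open>Passing to a child at least doubles the coordinates, so induction on \<open>k\<close> unwinds the recursive
  description of the norming set.\<close>

lemma NN_lq_aux:
  assumes "f \<in> NN" "finite A" "\<And>t. t \<in> A \<Longrightarrow> (1/2) ^ k < \<bar>f t\<bar>"
  shows "(\<Sum>t\<in>A. \<bar>f t\<bar> powr q) \<le> 1"
  using assms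
proof (induction k arbitrary: f A)
  case 0
  have "t \<notin> A" for t using 0(3)[of t] NN_le1[OF 0(1), of t] by auto
  then have "A = {}" by blast
  then show ?case by simp
next
  case (Suc k)
  have nodes: ?case if nd: "node f w \<gamma> fs" and w: "2 \<le> w" for w \<gamma> fs
  proof -
    have "(\<Sum>t\<in>A. \<bar>f t\<bar> powr q) \<le> 1 * (1 / w) powr q"
    proof (rule node_lq[OF nd])
      fix r assume r: "r < length fs"
      then show "(\<Sum>t\<in>A \<inter> supp (fs ! r). \<bar>(fs ! r) t\<bar> powr q) \<le> 1"
        using nd Suc.prems node_large[OF nd w r] by (intro Suc.IH) (auto simp: node_def)
    qed (use w Suc.prems in auto)
    also have "\<dots> \<le> 1" using w q by (simp add: powr_le1)
    finally show ?thesis .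
  qed
  from Suc.prems(1) show ?case
  proof (cases rule: NN_cases)
    case (1 i)
    have "(\<Sum>t\<in>A. \<bar>f t\<bar> powr q) = (\<Sum>t\<in>A. if t = i then 1 else 0)"
      using 1 by (intro sum.cong) (auto simp: unitf_def)
    then show ?thesis using Suc.prems(2) by simp
  next
    case (2 i \<gamma> fs)
    then show ?thesis using nodes m_ge2 by blast
  next
    case (3 \<gamma> fs js)
    then show ?thesis using nodes \<beta>(1) by blast
  qed
qed

lemma finite_large:
  assumes "finite (supp f)"
  obtains k where "\<And>t. t \<in> supp f \<Longrightarrow> (1/2::real) ^ k < \<bar>f t\<bar>"
proof (cases "supp f = {}")
  case True
  then show ?thesis using that by blast
next
  case False
  define \<epsilon> where "\<epsilon> = Min ((\<lambda>t. \<bar>f t\<bar>) ` supp f)"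
  have "\<epsilon> \<in> (\<lambda>t. \<bar>f t\<bar>) ` supp f" unfolding \<epsilon>_def using assms False by (intro Min_in) auto
  then have "0 < \<epsilon>" by (auto simp: supp_def)
  then obtain k where "(1/2) ^ k < \<epsilon>" using real_arch_pow_inv[of \<epsilon> "1/2"] by auto
  moreover have "\<epsilon> \<le> \<bar>f t\<bar>" if "t \<in> supp f" for t using that assms by (simp add: \<epsilon>_def)
  ultimately show ?thesis using that[of k] by (meson less_le_trans)
qed

lemma sum_supp: "finite A \<Longrightarrow> (\<Sum>t\<in>A. \<bar>f t\<bar> powr q) = (\<Sum>t\<in>A \<inter> supp f. \<bar>f t\<bar> powr q)"
  by (rule sum.mono_neutral_right) (auto simp: supp_def)

lemma NN_lq:
  assumes "f \<in> NN" "finite A"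
  shows "(\<Sum>t\<in>A. \<bar>f t\<bar> powr q) \<le> 1"
proof -
  obtain k where "\<And>t. t \<in> supp f \<Longrightarrow> (1/2::real) ^ k < \<bar>f t\<bar>"
    using finite_large NN_finite[OF assms(1)] by blast
  then have "(\<Sum>t\<in>A \<inter> supp f. \<bar>f t\<bar> powr q) \<le> 1" using assms by (intro NN_lq_aux) auto
  then show ?thesis using sum_supp[OF assms(2)] by simp
qed

text \<open>Stripping one layer gains the outermost weight over \<open>NN_lq\<close>. This is what
  makes children of large weight light as a whole.\<close>

lemma Nk_lq:
  assumes "f \<in> Nk m n q NN k" "1 \<le> k" "finite A"
  shows "(\<Sum>t\<in>A. \<bar>f t\<bar> powr q) \<le> (1 / real (m (2*k))) powr q"
proof -
  obtain \<gamma> fs where nd: "node f (real (m (2*k))) \<gamma> fs" using Nk_node assms(1) by blast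
  have "(\<Sum>t\<in>A. \<bar>f t\<bar> powr q) \<le> 1 * (1 / real (m (2*k))) powr q"
    by (rule node_lq[OF nd]) (use m_ge2[OF assms(2)] assms nd in \<open>auto simp: node_def intro!: NN_lq\<close>)
  then show ?thesis by simp
qed

text \<open>\<open>h\<close> is the exponent of \<open>\<beta>\<close> that a branch must still
  accumulate for its coordinate to be light; each layer lowers it, and \<open>G\<close> collects the
  coordinates whose branches end too early. An even layer adds order \<open>n (2*i)\<close>, which
  \<open>cost_even\<close> absorbs. At an odd layer children of index at least \<open>j\<close> are
  light; the others have distinct indices below \<open>j\<close>, so beyond coordinate
  \<open>j\<close> the minima of their heavy sets form a Schreier set of order 1. The parameter
  \<open>k\<close> only makes the induction terminate.\<close>

lemma NN_level_aux:
  assumes "f \<in> NN" "finite A" "\<And>t. t \<in> A \<Longrightarrow> (1/2) ^ k < \<bar>f t\<bar>" "h \<le> ex j" "2 \<le> j"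
  shows "\<exists>G\<subseteq>A. G \<inter> {j..} \<in> schreier (cost j (h - 1)) \<and>
    (\<Sum>t\<in>A - G. \<bar>f t\<bar> powr q) \<le> (1 / \<beta> ^ h) powr q"
  using assms(1-4)
proof (induction k arbitrary: f A h)
  case 0
  have "t \<notin> A" for t using 0(3)[of t] NN_le1[OF 0(1), of t] by auto
  then have "A = {}" by blast
  then show ?case by simp
next
  case (Suc k)
  have empty: ?case if "(\<Sum>t\<in>A. \<bar>f t\<bar> powr q) \<le> (1 / \<beta> ^ h) powr q"
    using that by (intro exI[of _ "{}"]) simp
  show ?case
  proof (cases "h = 0")
    case True
    then show ?thesis using empty NN_lq[OF Suc.prems(1,2)] by simp
  next
    case h: False
    from Suc.prems(1) show ?thesis
    proof (cases rule: NN_cases)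
      case (1 i)
      have "A \<inter> {i} \<inter> {j..} \<in> schreier (cost j (h - 1))"
        by (rule schreier_subset[OF schreier_singleton[OF 1(1)]]) auto
      moreover have "(\<Sum>t\<in>A - A \<inter> {i}. \<bar>f t\<bar> powr q) = 0"
        by (intro sum.neutral) (use 1 in \<open>auto simp: unitf_def split: if_splits\<close>)
      ultimately show ?thesis by (intro exI[of _ "A \<inter> {i}"]) auto
    next
      case (2 i \<gamma> fs)
      show ?thesis
      \<comment> \<open>If the outermost weight alone reaches the threshold, everything is light and
        \<open>G\<close> is empty. Otherwise monotonicity of \<open>ex\<close> gives
        \<open>i \<le> j\<close>, as \<open>cost_even\<close> requires.\<close>
      proof (cases "h \<le> ex i")
        case True
        have "(\<Sum>t\<in>A. \<bar>f t\<bar> powr q) \<le> 1 * (1 / real (m (2*i))) powr q"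
          by (rule node_lq[OF 2(2)])
            (use m_ge2[OF 2(1)] Suc.prems 2(2) in \<open>auto simp: node_def intro!: NN_lq\<close>)
        also have "\<dots> \<le> (1 / \<beta> ^ h) powr q"
          unfolding m_eq_\<beta>_power[OF 2(1)] using True \<beta>(1) q
          by (auto intro!: powr_mono2 divide_left_mono power_increasing)
        finally show ?thesis by (rule empty)
      next
        case False
        then have ij: "i \<le> j" using ex_mono[of j i] Suc.prems(4) by (cases "i \<le> j") auto
        define h' where "h' = h - ex i"
        have h': "h = h' + ex i" "1 \<le> h'" using False by (auto simp: h'_def)
        have "\<forall>r\<in>{..<length fs}. \<exists>G. G \<subseteq> A \<inter> supp (fs ! r) \<and> G \<inter> {j..} \<in> schreier (cost j (h' - 1)) \<and>
          (\<Sum>t\<in>A \<inter> supp (fs ! r) - G. \<bar>(fs ! r) t\<bar> powr q) \<le> (1 / \<beta> ^ h') powr q"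
          using 2(2) Suc.prems h' node_large[OF 2(2) m_ge2[OF 2(1)]]
          by (intro ballI Suc.IH) (auto simp: node_def)
        then obtain G where G: "\<And>r. r < length fs \<Longrightarrow> G r \<subseteq> A \<inter> supp (fs ! r)"
          "\<And>r. r < length fs \<Longrightarrow> G r \<inter> {j..} \<in> schreier (cost j (h' - 1))"
          "\<And>r. r < length fs \<Longrightarrow>
            (\<Sum>t\<in>A \<inter> supp (fs ! r) - G r. \<bar>(fs ! r) t\<bar> powr q) \<le> (1 / \<beta> ^ h') powr q"
          unfolding bchoice_iff by auto
        define U where "U = (\<Union>r<length fs. G r)"
        have fin: "finite (supp (fs ! r))" "supp (fs ! r) \<noteq> {}" if "r < length fs" for r
          using that 2(2) by (auto simp: node_def intro!: NN_finite)
        have less: "Min (supp (fs ! r)) < Min (supp (fs ! r'))" if "r < r'" "r' < length fs" for r r'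
          using node_disjoint[OF 2(2) that] fin[of r] fin[of r'] that by (auto simp: set_less_def)
        have inj: "inj_on (\<lambda>r. Min (supp (fs ! r))) {..<length fs}"
          by (rule linorder_inj_onI') (use less in force)
        have "(\<Union>r<length fs. G r \<inter> {j..}) \<in> schreier (n (2*i) + cost j (h' - 1))"
        proof (rule schreier_compose_indexed[OF 2(3) inj])
          fix r t assume "r \<in> {..<length fs}" "t \<in> G r \<inter> {j..}"
          then show "Min (supp (fs ! r)) \<le> t" using G(1) fin by (metis IntE Min_le lessThan_iff subsetD)
        next
          fix r r' assume r: "r \<in> {..<length fs}" "r' \<in> {..<length fs}"
            and "Min (supp (fs ! r)) < Min (supp (fs ! r'))"
          then have "r < r'" using less[of r' r] by (cases r r' rule: linorder_cases) auto
          then show "set_less (G r \<inter> {j..}) (G r' \<inter> {j..})"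
            using node_disjoint[OF 2(2), of r r'] G(1)[of r] G(1)[of r'] r
            unfolding set_less_def by blast
        qed (use G(2) in auto)
        moreover have "U \<inter> {j..} = (\<Union>r<length fs. G r \<inter> {j..})" by (auto simp: U_def)
        moreover have "n (2*i) + cost j (h' - 1) \<le> cost j (h - 1)"
          using cost_even[OF 2(1) ij, of "h' - 1"] h' by simp
        ultimately have "U \<inter> {j..} \<in> schreier (cost j (h - 1))" using schreier_mono by metis
        moreover have "(\<Sum>t\<in>A - U. \<bar>f t\<bar> powr q) \<le> (1 / \<beta> ^ h') powr q * (1 / real (m (2*i))) powr q"
        proof (rule node_lq[OF 2(2)])
          fix r assume r: "r < length fs"
          have "(\<Sum>t\<in>(A - U) \<inter> supp (fs ! r). \<bar>(fs ! r) t\<bar> powr q)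
            \<le> (\<Sum>t\<in>A \<inter> supp (fs ! r) - G r. \<bar>(fs ! r) t\<bar> powr q)"
            by (rule sum_mono2) (use Suc.prems(2) r in \<open>auto simp: U_def\<close>)
          also have "\<dots> \<le> (1 / \<beta> ^ h') powr q" by (rule G(3)[OF r])
          finally show "(\<Sum>t\<in>(A - U) \<inter> supp (fs ! r). \<bar>(fs ! r) t\<bar> powr q) \<le> (1 / \<beta> ^ h') powr q" .
        qed (use m_ge2[OF 2(1)] Suc.prems(2) in auto)
        moreover have "(1 / \<beta> ^ h') powr q * (1 / real (m (2*i))) powr q = (1 / \<beta> ^ h) powr q"
          unfolding m_eq_\<beta>_power[OF 2(1)] h'(1) using \<beta>(1) by (simp add: power_add flip: powr_mult)
        moreover have "U \<subseteq> A" using G(1) by (auto simp: U_def)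
        ultimately show ?thesis by auto
      qed
    next
      case (3 \<gamma> fs js)
      have "\<forall>r\<in>{..<length fs}. \<exists>G. G \<subseteq> A \<inter> supp (fs ! r) \<and> G \<inter> {j..} \<in> schreier (cost j (h - 1 - 1)) \<and>
          (\<Sum>t\<in>A \<inter> supp (fs ! r) - G. \<bar>(fs ! r) t\<bar> powr q) \<le> (1 / \<beta> ^ (h - 1)) powr q"
        using 3(1) Suc.prems node_large[OF 3(1) \<beta>(1)]
        by (intro ballI Suc.IH) (auto simp: node_def)
      then obtain G' where G': "\<And>r. r < length fs \<Longrightarrow> G' r \<subseteq> A \<inter> supp (fs ! r)"
          "\<And>r. r < length fs \<Longrightarrow> G' r \<inter> {j..} \<in> schreier (cost j (h - 1 - 1))"
          "\<And>r. r < length fs \<Longrightarrow>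
            (\<Sum>t\<in>A \<inter> supp (fs ! r) - G' r. \<bar>(fs ! r) t\<bar> powr q) \<le> (1 / \<beta> ^ (h - 1)) powr q"
        unfolding bchoice_iff by auto
      \<comment> \<open>A child whose own weight reaches the remaining threshold is light by
        \<open>Nk_lq\<close>, so its heavy set is discarded; this keeps the number of surviving
        children below the bound needed for order 1.\<close>
      define G where "G r = (if h - 1 \<le> ex (js ! r) then {} else G' r)" for r
      have G: "G r \<subseteq> A \<inter> supp (fs ! r)" "G r \<inter> {j..} \<in> schreier (cost j (h - 1 - 1))"
        "(\<Sum>t\<in>A \<inter> supp (fs ! r) - G r. \<bar>(fs ! r) t\<bar> powr q) \<le> (1 / \<beta> ^ (h - 1)) powr q"
        if r: "r < length fs" for r
      proof -
        show "G r \<subseteq> A \<inter> supp (fs ! r)" "G r \<inter> {j..} \<in> schreier (cost j (h - 1 - 1))"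
          using G'[OF r] by (auto simp: G_def)
        show "(\<Sum>t\<in>A \<inter> supp (fs ! r) - G r. \<bar>(fs ! r) t\<bar> powr q) \<le> (1 / \<beta> ^ (h - 1)) powr q"
        proof (cases "h - 1 \<le> ex (js ! r)")
          case True
          have "(\<Sum>t\<in>A \<inter> supp (fs ! r) - G r. \<bar>(fs ! r) t\<bar> powr q) \<le> (1 / real (m (2 * js ! r))) powr q"
            by (rule Nk_lq) (use 3(4)[OF r] Suc.prems(2) in auto)
          also have "\<dots> \<le> (1 / \<beta> ^ (h - 1)) powr q"
            using m_eq_\<beta>_power[of "js ! r"] 3(4)[OF r] True \<beta>(1) q
            by (auto intro!: powr_mono2 divide_left_mono power_increasing)
          finally show ?thesis .
        qed (use G'(3)[OF r] in \<open>simp add: G_def\<close>)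
      qed
      define U where "U = (\<Union>r<length fs. G r)"
      define R where "R = {r. r < length fs \<and> G r \<inter> {j..} \<noteq> {}}"
      have finR: "finite R" by (simp add: R_def)
      have "card R \<le> card {..<j}"
      proof (rule card_inj_on_le)
        show "inj_on (\<lambda>r. js ! r) R"
          using 3(2,3) by (auto simp: inj_on_def R_def nth_eq_iff_index_eq)
        show "(\<lambda>r. js ! r) ` R \<subseteq> {..<j}"
        proof (rule image_subsetI)
          fix r assume "r \<in> R"
          then have "ex (js ! r) < h - 1" by (auto simp: R_def G_def split: if_splits)
          then show "js ! r \<in> {..<j}" using ex_mono[of j "js ! r"] Suc.prems(4) by (cases "js ! r < j") auto
        qed
      qed simp
      then have card: "card R \<le> j" by simp
      define \<mu> where "\<mu> r = Min (G r \<inter> {j..})" for r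
      have finG: "finite (G r \<inter> {j..})" if "r < length fs" for r
        using G(1)[OF that] Suc.prems(2) by (meson finite_Int finite_subset)
      have \<mu>: "\<mu> r \<in> G r \<inter> {j..}" if "r \<in> R" for r
        unfolding \<mu>_def using that finG by (intro Min_in) (auto simp: R_def)
      have lessG: "set_less (G r \<inter> {j..}) (G r' \<inter> {j..})" if "r < r'" "r' < length fs" for r r'
        using node_disjoint[OF 3(1) that] G(1)[of r] G(1)[of r'] that unfolding set_less_def by force
      have less: "\<mu> r < \<mu> r'" if "r < r'" "r \<in> R" "r' \<in> R" for r r'
        using lessG[of r r'] \<mu>[OF that(2)] \<mu>[OF that(3)] that by (auto simp: set_less_def R_def)
      have inj: "inj_on \<mu> R" by (rule linorder_inj_onI') (use less in force)
      have "(\<Union>r\<in>R. G r \<inter> {j..}) \<in> schreier (1 + cost j (h - 1 - 1))"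
      proof (rule schreier_compose_indexed[OF _ inj])
        have "card (\<mu> ` R) \<le> j" using card card_image_le[OF finR, of \<mu>] by linarith
        then show "\<mu> ` R \<in> schreier 1" using finR \<mu> assms(5) by (intro schreier_1I) fastforce+
      next
        fix r t assume "r \<in> R" "t \<in> G r \<inter> {j..}"
        then show "\<mu> r \<le> t" unfolding \<mu>_def using finG by (intro Min_le) (auto simp: R_def)
      next
        fix r r' assume r: "r \<in> R" "r' \<in> R" "\<mu> r < \<mu> r'"
        then have "r < r'" using less[of r' r] by (cases r r' rule: linorder_cases) auto
        then show "set_less (G r \<inter> {j..}) (G r' \<inter> {j..})" using lessG r by (auto simp: R_def)
      qed (use G(2) in \<open>auto simp: R_def\<close>)
      moreover have UR: "U \<inter> {j..} = (\<Union>r\<in>R. G r \<inter> {j..})" by (auto simp: U_def R_def)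
      \<comment> \<open>A surviving child forces \<open>1 < h\<close>, so the natural subtraction
        \<open>h - 1 - 1\<close> is not truncated.\<close>
      moreover have "1 + cost j (h - 1 - 1) \<le> cost j (h - 1)" if "R \<noteq> {}"
      proof -
        obtain r where "r \<in> R" using \<open>R \<noteq> {}\<close> by blast
        then have "1 < h" by (auto simp: R_def G_def split: if_splits)
        then have "h - 1 = (h - 1 - 1) + 1" by simp
        then show ?thesis using cost_odd[of j "h - 1 - 1"] by simp
      qed
      ultimately have "U \<inter> {j..} \<in> schreier (cost j (h - 1))"
        by (cases "R = {}") (auto intro: schreier_mono)
      moreover have "(\<Sum>t\<in>A - U. \<bar>f t\<bar> powr q) \<le> (1 / \<beta> ^ (h - 1)) powr q * (1 / \<beta>) powr q"
      proof (rule node_lq[OF 3(1)])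
        fix r assume r: "r < length fs"
        have "(\<Sum>t\<in>(A - U) \<inter> supp (fs ! r). \<bar>(fs ! r) t\<bar> powr q)
            \<le> (\<Sum>t\<in>A \<inter> supp (fs ! r) - G r. \<bar>(fs ! r) t\<bar> powr q)"
          by (rule sum_mono2) (use Suc.prems(2) r in \<open>auto simp: U_def\<close>)
        also have "\<dots> \<le> (1 / \<beta> ^ (h - 1)) powr q" by (rule G(3)[OF r])
        finally show "(\<Sum>t\<in>(A - U) \<inter> supp (fs ! r). \<bar>(fs ! r) t\<bar> powr q) \<le> (1 / \<beta> ^ (h - 1)) powr q" .
      qed (use \<beta>(1) Suc.prems(2) in auto)
      moreover have "(1 / \<beta> ^ (h - 1)) powr q * (1 / \<beta>) powr q = (1 / \<beta> ^ h) powr q"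
        using \<beta>(1) h by (cases h) (simp_all add: mult.commute flip: powr_mult)
      moreover have "U \<subseteq> A" using G(1) by (auto simp: U_def)
      ultimately show ?thesis by auto
    qed
  qed
qed

lemma NN_level:
  assumes "f \<in> NN" "2 \<le> j"
  obtains G where "G \<subseteq> supp f" "G \<inter> {j..} \<in> schreier (\<kappa> j)"
    "(\<Sum>t\<in>supp f - G. \<bar>f t\<bar> powr q) \<le> (1 / real (m (2*j))) powr q"
proof -
  have fin: "finite (supp f)" using NN_finite[OF assms(1)] .
  obtain k where k: "\<And>t. t \<in> supp f \<Longrightarrow> (1/2::real) ^ k < \<bar>f t\<bar>" using finite_large[OF fin] by blast
  have "real (m (2*j)) = \<beta> ^ ex j" using m_eq_\<beta>_power[of j] assms(2) by simp
  then show ?thesis using NN_level_aux[OF assms(1) fin k order_refl assms(2)] that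
    by (auto simp: \<kappa>_def)
qed

end

section \<open>Functionals with a prescribed outermost weight\<close>

context MN_schreier_space
begin

text \<open>Indexing the children by the minima of their supports turns admissibility into the
  single condition that \<open>I\<close> is a Schreier set.\<close>

lemma NkI:
  assumes k: "1 \<le> k" and I: "I \<in> schreier (n (2*k))" "I \<noteq> {}"
    and y: "\<And>i. i \<in> I \<Longrightarrow> y i \<in> NN \<and> i \<in> supp (y i) \<and> (\<forall>t\<in>supp (y i). i \<le> t)"
    and less: "\<And>i j. i \<in> I \<Longrightarrow> j \<in> I \<Longrightarrow> i < j \<Longrightarrow> set_less (supp (y i)) (supp (y j))"
    and \<gamma>: "(\<Sum>i\<in>I. \<bar>\<gamma> i\<bar> powr q) \<le> 1"
  shows "(\<lambda>t. (\<Sum>i\<in>I. \<gamma> i * y i t) / real (m (2*k))) \<in> NN"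
proof -
  define xs where "xs = sorted_list_of_set I"
  have finI: "finite I" using I schreier_finite by blast
  have xs: "set xs = I" "distinct xs" "sorted_wrt (<) xs"
    using finI by (auto simp: xs_def)
  have bij: "bij_betw ((!) xs) {..<length xs} I" using xs by (intro bij_betw_nth) auto
  define fs where "fs = map y xs"
  define \<gamma>' where "\<gamma>' r = \<gamma> (xs ! r)" for r
  have "lin_comb \<gamma>' fs t = (\<Sum>i\<in>I. \<gamma> i * y i t)" for t
    unfolding lin_comb_def using sum.reindex_bij_betw[OF bij, of "\<lambda>i. \<gamma> i * y i t"]
    by (simp add: fs_def \<gamma>'_def)
  then have eq: "(\<lambda>t. (\<Sum>i\<in>I. \<gamma> i * y i t) / real (m (2*k))) = (\<lambda>t. lin_comb \<gamma>' fs t / real (m (2*k)))"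
    by simp
  have "in_ball_lq q 1 (length fs) \<gamma>'"
    using sum.reindex_bij_betw[OF bij, of "\<lambda>i. \<bar>\<gamma> i\<bar> powr q"] \<gamma>
    by (simp add: in_ball_lq_def fs_def \<gamma>'_def)
  moreover have "admissible (n (2*k)) fs"
  proof -
    have fin: "finite (supp (y i))" if "i \<in> I" for i using y[OF that] NN_finite by blast
    have "Min (supp (y i)) = i" if "i \<in> I" for i
      using y[OF that] fin[OF that] by (intro Min_eqI) auto
    then have "Min ` set (map supp fs) = I" using xs(1) by (simp add: fs_def image_image)
    moreover have "sorted_wrt set_less (map supp fs)"
      unfolding fs_def map_map sorted_wrt_map
      by (rule sorted_wrt_mono_rel[OF _ xs(3)]) (use less xs(1) in auto)
    moreover have "\<forall>E\<in>set (map supp fs). finite E \<and> E \<noteq> {}" using y fin xs(1) unfolding fs_def by fastforce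
    ultimately show ?thesis using I unfolding admissible_def admissible_sets_def by simp
  qed
  moreover have "fs \<noteq> []" "set fs \<subseteq> NN" using I xs(1) y by (auto simp: fs_def)
  ultimately have "(\<lambda>t. lin_comb \<gamma>' fs t / real (m (2*k))) \<in> Nk m n q NN k"
    unfolding Nk_def by blast
  then show ?thesis unfolding eq using Nk_subset[OF k] by blast
qed

text \<open>The norm has to be exactly 1: at order 0 the norming set only provides the vectors \<open>\<plusminus>e\<^sub>k\<^sup>*\<close>.\<close>

definition avg_ok :: "real \<Rightarrow> nat \<Rightarrow> bool" where
  "avg_ok w d \<longleftrightarrow> 0 < w \<and> (\<forall>F \<gamma>. F \<in> schreier d \<and> F \<noteq> {} \<and> supp \<gamma> = F \<and> (\<Sum>t\<in>F. \<bar>\<gamma> t\<bar> powr q) = 1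
     \<longrightarrow> (\<lambda>t. \<gamma> t / w) \<in> NN)"

lemma avg_ok_0: "avg_ok 1 0"
proof -
  have "\<gamma> \<in> NN" if F: "F \<in> schreier 0" "F \<noteq> {}" "supp \<gamma> = F" "(\<Sum>t\<in>F. \<bar>\<gamma> t\<bar> powr q) = 1" for F \<gamma>
  proof -
    obtain k where k: "F = {k}" "1 \<le> k" using F by auto
    have "\<bar>\<gamma> k\<bar> powr q = 1" "\<gamma> k \<noteq> 0" using F k by (auto simp: supp_def)
    then have "\<bar>\<gamma> k\<bar> = 1" using q by (metis abs_ge_zero powr_powr powr_one_eq_one powr_one
          nonzero_divide_eq_eq times_divide_eq_right not_one_less_zero mult.commute mult_1)
    moreover have "\<gamma> = (\<lambda>i. \<gamma> k * unitf k i)"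
      using F(3) k(1) by (auto simp: unitf_def supp_def fun_eq_iff)
    ultimately consider "\<gamma> = unitf k" | "\<gamma> = (\<lambda>i. - unitf k i)" by (cases "\<gamma> k" "0::real" rule: linorder_cases) auto
    then show ?thesis using NN_unit[OF k(2)] NN_uminus by cases auto
  qed
  then show ?thesis unfolding avg_ok_def by auto
qed

text \<open>On each piece \<open>\<gamma>\<close> is divided by its
  \<open>\<ell>\<^sub>q\<close>-norm \<open>lam i\<close>. The normalised pieces are functionals by
  assumption, and the numbers \<open>lam i\<close> are again coefficients of norm 1, so layers stack
  without loss.\<close>

lemma avg_split:
  assumes ok: "avg_ok w d" and F: "F \<in> schreier (c + d)" "F \<noteq> {}" "supp \<gamma> = F" "(\<Sum>t\<in>F. \<bar>\<gamma> t\<bar> powr q) = 1"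
  shows "\<exists>I y lam. I \<subseteq> F \<and> I \<noteq> {} \<and> I \<in> schreier c \<and>
    (\<forall>i\<in>I. y i \<in> NN \<and> i \<in> supp (y i) \<and> supp (y i) \<subseteq> F \<and> (\<forall>t\<in>supp (y i). i \<le> t)) \<and>
    (\<forall>i\<in>I. \<forall>j\<in>I. i < j \<longrightarrow> set_less (supp (y i)) (supp (y j))) \<and>
    (\<Sum>i\<in>I. \<bar>lam i\<bar> powr q) = 1 \<and> (\<forall>t. \<gamma> t / w = (\<Sum>i\<in>I. lam i * y i t))"
proof -
  obtain I P where I: "I \<subseteq> F" "I \<in> schreier c" "I \<noteq> {}" and FP: "F = (\<Union>i\<in>I. P i)"
    and PP: "\<forall>i\<in>I. P i \<in> schreier d \<and> i \<in> P i \<and> (\<forall>t\<in>P i. i \<le> t)"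
      "\<forall>i\<in>I. \<forall>j\<in>I. i < j \<longrightarrow> set_less (P i) (P j)"
    using schreier_split[OF F(1,2)] by (elim exE conjE)
  note P = PP(1)[rule_format] and less = PP(2)[rule_format]
  have finI: "finite I" using I schreier_finite by blast
  have finP: "finite (P i)" if "i \<in> I" for i using P[OF that] schreier_finite by blast
  have disj: "P i \<inter> P j = {}" if "i \<in> I" "j \<in> I" "i \<noteq> j" for i j
    using less[OF that(1,2)] less[OF that(2,1)] that(3)
    by (cases i j rule: linorder_cases) (auto simp: set_less_def)
  define lam where "lam i = (\<Sum>t\<in>P i. \<bar>\<gamma> t\<bar> powr q) powr (1/q)" for i
  define y where "y i t = (if t \<in> P i then \<gamma> t / lam i else 0) / w" for i t
  have nz: "\<gamma> t \<noteq> 0 \<longleftrightarrow> t \<in> F" for t using F(3) by (auto simp: supp_def)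
  have pos: "0 < (\<Sum>t\<in>P i. \<bar>\<gamma> t\<bar> powr q)" if "i \<in> I" for i
  proof (rule sum_pos2)
    show "0 < \<bar>\<gamma> i\<bar> powr q" using nz I that by auto
  qed (use P[OF that] finP[OF that] in auto)
  have lam: "0 < lam i" "lam i powr q = (\<Sum>t\<in>P i. \<bar>\<gamma> t\<bar> powr q)" if "i \<in> I" for i
    using pos[OF that] q by (simp_all add: lam_def powr_powr)
  have yN: "y i \<in> NN" if i: "i \<in> I" for i
  proof -
    let ?\<gamma> = "\<lambda>t. if t \<in> P i then \<gamma> t / lam i else 0"
    have "supp ?\<gamma> = P i" using nz FP i lam(1)[OF i] by (auto simp: supp_def)
    moreover
    have "(\<Sum>t\<in>P i. \<bar>?\<gamma> t\<bar> powr q) = (\<Sum>t\<in>P i. \<bar>\<gamma> t\<bar> powr q) / lam i powr q"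
      using lam(1)[OF i] by (simp add: sum_divide_distrib powr_divide abs_divide)
    then have "(\<Sum>t\<in>P i. \<bar>?\<gamma> t\<bar> powr q) = 1" using lam(2)[OF i] pos[OF i] by simp
    moreover have "P i \<in> schreier d" "P i \<noteq> {}" using P[OF i] by auto
    ultimately have "(\<lambda>t. ?\<gamma> t / w) \<in> NN" using ok unfolding avg_ok_def by blast
    then show ?thesis by (simp add: y_def[abs_def])
  qed
  have w: "0 < w" using ok by (simp add: avg_ok_def)
  have supp_y: "supp (y i) = P i" if "i \<in> I" for i
    using that nz FP lam(1)[OF that] w by (auto simp: supp_def y_def)
  have "(\<Sum>i\<in>I. \<bar>lam i\<bar> powr q) = (\<Sum>i\<in>I. \<Sum>t\<in>P i. \<bar>\<gamma> t\<bar> powr q)"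
    using lam by (intro sum.cong) (auto simp: abs_of_pos)
  also have "\<dots> = (\<Sum>t\<in>F. \<bar>\<gamma> t\<bar> powr q)" unfolding FP
    using finI finP disj by (subst sum.UNION_disjoint) auto
  finally have sum1: "(\<Sum>i\<in>I. \<bar>lam i\<bar> powr q) = 1" using F(4) by simp
  have "\<gamma> t / w = (\<Sum>i\<in>I. lam i * y i t)" for t
  proof (cases "t \<in> F")
    case True
    then obtain i where i: "i \<in> I" "t \<in> P i" using FP by blast
    then have "t \<notin> P j" if "j \<in> I" "j \<noteq> i" for j using disj[OF i(1) that(1)] that by auto
    then have "(\<Sum>i\<in>I. lam i * y i t) = (\<Sum>j\<in>I. if j = i then \<gamma> t / w else 0)"
      using i lam(1)[OF i(1)] by (intro sum.cong) (auto simp: y_def)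
    then show ?thesis using finI i by simp
  next
    case False
    then have "\<gamma> t = 0" "\<And>i. i \<in> I \<Longrightarrow> y i t = 0" using nz FP by (auto simp: y_def)
    then show ?thesis by simp
  qed
  then show ?thesis using I yN supp_y P less sum1 FP
    by (intro exI[of _ I] exI[of _ y] exI[of _ lam]) (auto simp: supp_y)
qed

lemma avg_ok_step:
  assumes ok: "avg_ok w d" and k: "1 \<le> k" 
  shows "avg_ok (real (m (2*k)) * w) (n (2*k) + d)"
  unfolding avg_ok_def
proof (intro conjI allI impI, goal_cases)
  case 1
  then show ?case using ok m_ge2[OF k] by (simp add: avg_ok_def)
next
  case (2 F \<gamma>)
  then have F: "F \<in> schreier (n (2*k) + d)" "F \<noteq> {}" "supp \<gamma> = F" "(\<Sum>t\<in>F. \<bar>\<gamma> t\<bar> powr q) = 1"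
    by auto
  obtain I y lam where I: "I \<noteq> {}" "I \<in> schreier (n (2*k))"
    "\<forall>i\<in>I. y i \<in> NN \<and> i \<in> supp (y i) \<and> supp (y i) \<subseteq> F \<and> (\<forall>t\<in>supp (y i). i \<le> t)"
    "\<forall>i\<in>I. \<forall>j\<in>I. i < j \<longrightarrow> set_less (supp (y i)) (supp (y j))"
    "(\<Sum>i\<in>I. \<bar>lam i\<bar> powr q) = 1" "\<And>t. \<gamma> t / w = (\<Sum>i\<in>I. lam i * y i t)"
    using avg_split[OF ok F] by auto
  have "(\<lambda>t. (\<Sum>i\<in>I. lam i * y i t) / real (m (2*k))) \<in> NN"
    by (rule NkI[OF k]) (use I in auto)
  then show ?case
    by (simp add: I(6)[symmetric] mult.commute)
qed

lemma avg_ok_power: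
  assumes "avg_ok w d" "1 \<le> k" 
  shows "avg_ok (real (m (2*k)) ^ a * w) (a * n (2*k) + d)"
proof (induction a)
  case (Suc a)
  then show ?case using avg_ok_step[OF Suc assms(2)] by (simp add: mult.assoc add.assoc)
qed (use assms in simp)

text \<open>The ratio is the product of \<open>m (2*i) ^ sx i\<close> over
  \<open>j \<le> i < l\<close>, and \<open>\<kappa> l - \<kappa> j\<close> is the sum of the
  matching orders \<open>sx i * n (2*i)\<close>. So the weight is rebuilt at exactly the order it
  has in \<open>\<kappa>\<close>; \<open>2 \<le> j\<close> avoids level 1, where \<open>nx\<close>
  differs from \<open>n 2\<close>.\<close>

lemma avg_ok_ratio:
  assumes "2 \<le> j" "j \<le> l"
  shows "\<kappa> j \<le> \<kappa> l \<and> avg_ok (real (m (2*l)) / real (m (2*j))) (\<kappa> l - \<kappa> j)"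
  using assms(2)
proof (induction l rule: dec_induct)
  case base
  then show ?case using avg_ok_0 m_ge2[of j] assms by simp
next
  case (step l)
  have "\<kappa> (Suc l) = sx l * n (2*l) + \<kappa> l" using \<kappa>_Suc[of l] assms step by (simp add: nx_def)
  moreover have "real (m (2 * Suc l)) = real (m (2*l)) ^ sx l * real (m (2*l))"
    using m_Suc[of l] step assms by simp
  ultimately show ?case using avg_ok_power[of _ _ l "sx l"] step assms by fastforce
qed

text \<open>The tolerance compensates the factor \<open>m (2 * (k + 2))\<close> of the dual vectors,
  \<open>k + 2 \<le> t\<close> allows composition over the block numbers, and the point skipped
  after each block supplies kernel vectors.\<close>

lemma blocks_exist:
  obtains F a where "\<And>k. F k \<in> schreier (Suc (\<kappa> (k + 2)))" "\<And>k. F k \<noteq> {}"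
    "\<And>k t. t \<in> F k \<Longrightarrow> k + 2 \<le> t \<and> 0 < a k t" "\<And>k t. t \<notin> F k \<Longrightarrow> a k t = (0::real)"
    "\<And>k. sum (a k) (F k) = 1"
    "\<And>k G. G \<in> schreier (\<kappa> (k + 2)) \<Longrightarrow> sum (a k) (G \<inter> F k) < (1 / real (m (2 * (k + 2)))) powr p"
    "\<And>k t. t \<in> F (Suc k) \<Longrightarrow> Max (F k) + 1 < t"
proof -
  define P where "P k = (\<lambda>(F, a :: nat \<Rightarrow> real). F \<in> schreier (Suc (\<kappa> (k + 2))) \<and> F \<noteq> {} \<and>
    (\<forall>t\<in>F. k + 2 \<le> t \<and> 0 < a t) \<and> (\<forall>t. t \<notin> F \<longrightarrow> a t = 0) \<and> sum a F = 1 \<and>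
    (\<forall>G\<in>schreier (\<kappa> (k + 2)). sum a (G \<inter> F) < (1 / real (m (2 * (k + 2)))) powr p))" for k
  have ex: "\<exists>F a. P k (F, a) \<and> (\<forall>t\<in>F. N \<le> t)" for k N
  proof -
    have "0 < (1 / real (m (2 * (k + 2)))) powr p" using m_ge4[of "2 * (k + 2)"] by simp
    from schreier_repeated_averages[OF this, of "\<kappa> (k + 2)" "max N (k + 2)"] show ?thesis
      unfolding P_def by simp blast
  qed
  have "\<exists>X. \<forall>k. P k (X k) \<and> (\<forall>t\<in>fst (X (Suc k)). Max (fst (X k)) + 1 < t)"
  proof (rule dependent_nat_choice)
    show "\<exists>x. P 0 x" using ex by blast
    show "\<exists>y. P (Suc k) y \<and> (\<forall>t\<in>fst y. Max (fst x) + 1 < t)" for x k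
      using ex[of "Suc k" "Max (fst x) + 2"] by fastforce
  qed
  then obtain X where X: "\<And>k. P k (X k)" "\<And>k. \<forall>t\<in>fst (X (Suc k)). Max (fst (X k)) + 1 < t" by blast
  show ?thesis
    by (rule that[of "\<lambda>k. fst (X k)" "\<lambda>k. snd (X k)"])
      (use X in \<open>auto simp: P_def case_prod_beta\<close>)
qed

end

section \<open>The block functionals\<close>

locale MN_blocks = MN_schreier_space +
  fixes F :: "nat \<Rightarrow> nat set" and a :: "nat \<Rightarrow> nat \<Rightarrow> real"
  assumes F_schreier: "\<And>k. F k \<in> schreier (Suc (\<kappa> (k + 2)))" and F_ne: "\<And>k. F k \<noteq> {}"
    and F_ge: "\<And>k t. t \<in> F k \<Longrightarrow> k + 2 \<le> t" and a_pos: "\<And>k t. t \<in> F k \<Longrightarrow> 0 < a k t"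
    and a_0: "\<And>k t. t \<notin> F k \<Longrightarrow> a k t = 0" and a_sum: "\<And>k. sum (a k) (F k) = 1"
    and a_small: "\<And>k G. G \<in> schreier (\<kappa> (k + 2)) \<Longrightarrow>
      sum (a k) (G \<inter> F k) < (1 / real (m (2 * (k + 2)))) powr p"
    and F_gap: "\<And>k t. t \<in> F (Suc k) \<Longrightarrow> Max (F k) + 1 < t"
begin

text \<open>With \<open>vec_k\<close> the weights cancel and the coordinatewise product is
  \<open>a k t\<close>, of total mass 1; the exponents \<open>1/q\<close> and \<open>1/p\<close>
  normalise the two factors in \<open>\<ell>\<^sub>q\<close> and
  \<open>\<ell>\<^sub>p\<close>.\<close>

definition fun_k :: "nat \<Rightarrow> nat \<Rightarrow> real" where
  "fun_k k t = a k t powr (1/q) / real (m (2 * (k + 2)))"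

definition vec_k :: "nat \<Rightarrow> nat \<Rightarrow> real" where
  "vec_k k t = real (m (2 * (k + 2))) * a k t powr (1/p)"

lemma F_finite: "finite (F k)"
  using F_schreier schreier_finite by blast

lemma F_max_less: "k < k' \<Longrightarrow> t \<in> F k' \<Longrightarrow> Max (F k) + 1 < t"
proof -
  have Suc: "Max (F k) < Max (F (Suc k))" for k
    using F_gap[OF Max_in[OF F_finite F_ne], of k] by simp
  assume "k < k'" "t \<in> F k'"
  then obtain i where i: "k' = Suc i" "k \<le> i" by (cases k') auto
  have "Max (F k) \<le> Max (F i)" by (rule lift_Suc_mono_le[OF _ i(2)]) (use Suc less_imp_le in blast)
  then show ?thesis using F_gap[of t i] i \<open>t \<in> F k'\<close> by simp
qed

lemma F_less:
  assumes "k < k'"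
  shows "set_less (F k) (F k')"
  unfolding set_less_def using F_max_less[OF assms] Max_ge[OF F_finite] by fastforce

lemma F_disjoint: "k \<noteq> k' \<Longrightarrow> F k \<inter> F k' = {}"
  using F_less[of k k'] F_less[of k' k] by (cases k k' rule: linorder_cases) (auto simp: set_less_def)

lemma M_ge: "4 \<le> real (m (2 * (k + 2)))"
  using m_ge4[of "2 * (k + 2)"] by simp

lemma supp_root: "supp (\<lambda>t. a k t powr (1/q)) = F k"
  using a_pos a_0 by (force simp: supp_def)

lemma root_lq: "(\<Sum>t\<in>F k. \<bar>a k t powr (1/q)\<bar> powr q) = 1"
proof -
  have "\<bar>a k t powr (1/q)\<bar> powr q = a k t" if "t \<in> F k" for t
    using a_pos[OF that] q by (simp add: powr_powr)
  then show ?thesis using a_sum[of k] by simp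
qed

lemma supp_fun_k: "supp (fun_k k) = F k"
  using supp_root[of k] M_ge[of k] by (auto simp: supp_def fun_k_def)

lemma fun_k_NN: "fun_k k \<in> NN"
proof -
  let ?l = "k + 2"
  have "avg_ok (real (m (2 * ?l)) * 1) (n (2 * ?l) + 0)" by (rule avg_ok_step[OF avg_ok_0]) simp
  moreover have "F k \<in> schreier (n (2 * ?l))"
    using schreier_mono[OF F_schreier[of k]] \<kappa>_bound[of ?l] by simp
  ultimately show ?thesis using F_ne[of k] supp_root[of k] root_lq[of k]
    unfolding avg_ok_def fun_k_def[abs_def] by auto
qed

text \<open>Each \<open>fun_k k\<close> with \<open>k \<ge> j\<close> can be written with outermost
  weight \<open>m (2*j)\<close> over a set \<open>I k\<close> of order
  \<open>\<kappa> j + 1\<close>. These outermost layers share their weight and merge into one: by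
  composition the union of the \<open>I k\<close> over \<open>B\<close> has order
  \<open>2 * \<kappa> j + 1\<close>, which \<open>n (2*j)\<close> admits.\<close>

lemma fun_k_comb_NN:
  assumes j: "2 \<le> j" and B: "B \<in> schreier (\<kappa> j)" "B \<noteq> {}" "\<And>k. k \<in> B \<Longrightarrow> j \<le> k"
    and b: "(\<Sum>k\<in>B. \<bar>b k\<bar> powr q) \<le> 1"
  shows "(\<lambda>t. \<Sum>k\<in>B. b k * fun_k k t) \<in> NN"
proof -
  define R where "R k I y lam \<longleftrightarrow> I \<subseteq> F k \<and> I \<noteq> {} \<and> I \<in> schreier (Suc (\<kappa> j)) \<and>
    (\<forall>i\<in>I. y i \<in> NN \<and> i \<in> supp (y i) \<and> supp (y i) \<subseteq> F k \<and> (\<forall>t\<in>supp (y i). i \<le> t)) \<and>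
    (\<forall>i\<in>I. \<forall>j\<in>I. i < j \<longrightarrow> set_less (supp (y i)) (supp (y j))) \<and>
    (\<Sum>i\<in>I. \<bar>lam i\<bar> powr q) = 1 \<and>
    (\<forall>t. fun_k k t = (\<Sum>i\<in>I. lam i * y i t) / real (m (2*j)))" for k I y lam
  have "\<exists>I y lam. R k I y lam" if k: "k \<in> B" for k
  proof -
    let ?l = "k + 2" and ?w = "real (m (2 * (k + 2))) / real (m (2*j))"
    have ok: "\<kappa> j \<le> \<kappa> ?l" "avg_ok ?w (\<kappa> ?l - \<kappa> j)"
      using avg_ok_ratio[OF j, of ?l] B(3)[OF k] by auto
    have FS: "F k \<in> schreier (Suc (\<kappa> j) + (\<kappa> ?l - \<kappa> j))" using F_schreier[of k] ok(1) by simp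
    have "fun_k k t = x / real (m (2*j)) \<longleftrightarrow> a k t powr (1/q) / ?w = x" for t x
      using m_ge2[of j] M_ge[of k] j by (simp add: fun_k_def field_simps)
    then show ?thesis unfolding R_def
      using avg_split[OF ok(2) FS F_ne supp_root root_lq] by (simp only:)
  qed
  then obtain I y lam where "\<And>k. k \<in> B \<Longrightarrow> R k (I k) (y k) (lam k)" by metis
  then have I: "I k \<subseteq> F k" "I k \<noteq> {}" "I k \<in> schreier (Suc (\<kappa> j))"
    "\<And>i. i \<in> I k \<Longrightarrow> y k i \<in> NN \<and> i \<in> supp (y k i) \<and> supp (y k i) \<subseteq> F k \<and> (\<forall>t\<in>supp (y k i). i \<le> t)"
    "\<And>i j. i \<in> I k \<Longrightarrow> j \<in> I k \<Longrightarrow> i < j \<Longrightarrow> set_less (supp (y k i)) (supp (y k j))"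
    "(\<Sum>i\<in>I k. \<bar>lam k i\<bar> powr q) = 1"
    "\<And>t. fun_k k t = (\<Sum>i\<in>I k. lam k i * y k i t) / real (m (2*j))" if "k \<in> B" for k
    using that unfolding R_def by blast+
  define own where "own i = (THE k. i \<in> F k)" for i
  have own: "own i = k" if "i \<in> F k" for i k
    unfolding own_def by (rule the_equality) (use that F_disjoint in blast)+
  have ownI: "own i = k" if "k \<in> B" "i \<in> I k" for i k using own I(1) that by blast
  define J where "J = (\<Union>k\<in>B. I k)"
  have finB: "finite B" using B schreier_finite by blast
  have finI: "finite (I k)" if "k \<in> B" for k using I(3)[OF that] schreier_finite by blast
  have disj: "I k \<inter> I k' = {}" if "k \<in> B" "k' \<in> B" "k \<noteq> k'" for k k'
    using I(1)[OF that(1)] I(1)[OF that(2)] F_disjoint[OF that(3)] by blast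
  have sum_J: "(\<Sum>i\<in>J. h (own i) i) = (\<Sum>k\<in>B. \<Sum>i\<in>I k. h k i)" for h :: "nat \<Rightarrow> nat \<Rightarrow> real"
  proof -
    have "(\<Sum>i\<in>J. h (own i) i) = (\<Sum>k\<in>B. \<Sum>i\<in>I k. h (own i) i)"
      unfolding J_def using finB finI disj by (subst sum.UNION_disjoint) auto
    then show ?thesis using ownI by simp
  qed
  have "(\<lambda>t. (\<Sum>i\<in>J. (b (own i) * lam (own i) i) * y (own i) i t) / real (m (2*j))) \<in> NN"
  proof (rule NkI)
    have "J \<in> schreier (\<kappa> j + Suc (\<kappa> j))" unfolding J_def
    proof (rule schreier_compose[OF B(1)])
      show "k \<le> t" if "k \<in> B" "t \<in> I k" for k t using F_ge[of t k] I(1)[OF that(1)] that by auto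
      show "set_less (I k) (I k')" if "k \<in> B" "k' \<in> B" "k < k'" for k k'
        using F_less[OF that(3)] I(1)[OF that(1)] I(1)[OF that(2)] unfolding set_less_def by blast
    qed (use I(3) in auto)
    then show "J \<in> schreier (n (2*j))" using \<kappa>_bound[OF j] schreier_mono by fastforce
    show "J \<noteq> {}" using B(2) I(2) by (auto simp: J_def)
    show "y (own i) i \<in> NN \<and> i \<in> supp (y (own i) i) \<and> (\<forall>t\<in>supp (y (own i) i). i \<le> t)" if "i \<in> J" for i
      using that ownI I(4) by (auto simp: J_def)
    show "set_less (supp (y (own i) i)) (supp (y (own i') i'))" if "i \<in> J" "i' \<in> J" "i < i'" for i i'
    proof -
      obtain k k' where k: "k \<in> B" "i \<in> I k" "k' \<in> B" "i' \<in> I k'"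
        using \<open>i \<in> J\<close> \<open>i' \<in> J\<close> by (auto simp: J_def)
      show ?thesis
      proof (cases "k = k'")
        case True
        then show ?thesis using k I(5)[of k i i'] ownI that(3) by simp
      next
        case False
        have iF: "i \<in> F k" "i' \<in> F k'" using k I(1) by auto
        then have "k < k'" using False F_less[of k' k] that(3)
          by (cases k k' rule: linorder_cases) (auto simp: set_less_def dest: less_asym)
        then show ?thesis using F_less[of k k'] I(4)[OF k(1,2)] I(4)[OF k(3,4)] ownI[OF k(1,2)] ownI[OF k(3,4)]
          unfolding set_less_def by (metis subsetD)
      qed
    qed
    have "(\<Sum>i\<in>J. \<bar>b (own i) * lam (own i) i\<bar> powr q) = (\<Sum>k\<in>B. \<Sum>i\<in>I k. \<bar>b k * lam k i\<bar> powr q)"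
      by (rule sum_J)
    also have "\<dots> = (\<Sum>k\<in>B. \<bar>b k\<bar> powr q * (\<Sum>i\<in>I k. \<bar>lam k i\<bar> powr q))"
      by (simp add: abs_mult powr_mult sum_distrib_left)
    also have "\<dots> = (\<Sum>k\<in>B. \<bar>b k\<bar> powr q)" using I(6) by simp
    finally show "(\<Sum>i\<in>J. \<bar>b (own i) * lam (own i) i\<bar> powr q) \<le> 1" using b by simp
  qed (use j in simp)
  moreover have "(\<Sum>i\<in>J. (b (own i) * lam (own i) i) * y (own i) i t) / real (m (2*j)) = (\<Sum>k\<in>B. b k * fun_k k t)" for t
  proof -
    have "(\<Sum>i\<in>J. (b (own i) * lam (own i) i) * y (own i) i t) = (\<Sum>k\<in>B. \<Sum>i\<in>I k. (b k * lam k i) * y k i t)"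
      by (rule sum_J)
    also have "\<dots> = (\<Sum>k\<in>B. b k * (\<Sum>i\<in>I k. lam k i * y k i t))" by (simp add: sum_distrib_left mult.assoc)
    finally show ?thesis using I(7) by (simp add: sum_divide_distrib[of _ B])
  qed
  ultimately show ?thesis by simp
qed

section \<open>Bounded vectors biorthogonal to the block functionals\<close>

lemma sum_a_le: "finite A \<Longrightarrow> sum (a k) A \<le> 1"
proof -
  assume A: "finite A"
  have "sum (a k) A = sum (a k) (A \<inter> F k)" using a_0 by (intro sum.mono_neutral_right A) auto
  also have "\<dots> \<le> sum (a k) (F k)" using a_pos F_finite by (intro sum_mono2) (auto intro: less_imp_le)
  finally show ?thesis using a_sum by simp
qed

lemma a_nonneg: "0 \<le> a k t"
  using a_pos[of t k] a_0[of t k] by (cases "t \<in> F k") auto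

text \<open>Split \<open>f\<close> at level \<open>k + 2\<close>. On the light part its norm
  \<open>1 / M\<close> cancels the factor \<open>M\<close> of the vector. On the heavy part its norm
  is only bounded by 1, but \<open>G\<close> captures mass at most \<open>(1 / M) powr p\<close> of
  \<open>a k\<close>. Young's inequality then bounds each part by 1.\<close>

lemma act_vec_k_le:
  assumes f: "f \<in> NN"
  shows "act f (vec_k k) \<le> 2"
proof -
  define M where "M = real (m (2 * (k + 2)))"
  have M: "4 \<le> M" using M_ge by (simp add: M_def)
  obtain G where G: "G \<subseteq> supp f" "G \<inter> {k + 2..} \<in> schreier (\<kappa> (k + 2))"
    "(\<Sum>t\<in>supp f - G. \<bar>f t\<bar> powr q) \<le> (1 / M) powr q"
    using NN_level[OF f, of "k + 2"] by (auto simp: M_def)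
  have fin: "finite (supp f)" "finite G" using NN_finite[OF f] G(1) finite_subset by auto
  have root: "(a k t powr (1/p)) powr p = a k t" for t
    using a_nonneg[of k t] p by (simp add: powr_powr)
  have "(\<Sum>t\<in>supp f - G. f t * vec_k k t) \<le> (\<Sum>t\<in>supp f - G. a k t / p + M powr q * \<bar>f t\<bar> powr q / q)"
  proof (rule sum_mono)
    fix t
    have "f t * vec_k k t \<le> \<bar>f t\<bar> * vec_k k t"
      using M unfolding vec_k_def by (intro mult_right_mono) auto
    also have "\<dots> = a k t powr (1/p) * (M * \<bar>f t\<bar>)" by (simp add: vec_k_def M_def)
    also have "\<dots> \<le> (a k t powr (1/p)) powr p / p + (M * \<bar>f t\<bar>) powr q / q"
      using M by (intro Youngs_inequality p q pq) auto
    finally show "f t * vec_k k t \<le> a k t / p + M powr q * \<bar>f t\<bar> powr q / q"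
      unfolding root by (simp add: powr_mult)
  qed
  also have "\<dots> = sum (a k) (supp f - G) / p + M powr q * (\<Sum>t\<in>supp f - G. \<bar>f t\<bar> powr q) / q"
    by (simp add: sum.distrib sum_divide_distrib sum_distrib_left)
  also have "\<dots> \<le> 1 / p + M powr q * (1 / M) powr q / q"
    using sum_a_le[of "supp f - G" k] fin G(3) p q
    by (intro add_mono divide_right_mono mult_left_mono) auto
  also have "\<dots> = 1" using M pq by (simp add: powr_divide)
  finally have 1: "(\<Sum>t\<in>supp f - G. f t * vec_k k t) \<le> 1" .
  have "(\<Sum>t\<in>G. f t * vec_k k t) \<le> (\<Sum>t\<in>G. M powr p * a k t / p + \<bar>f t\<bar> powr q / q)"
  proof (rule sum_mono)
    fix t
    have "f t * vec_k k t \<le> \<bar>f t\<bar> * vec_k k t"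
      using M unfolding vec_k_def by (intro mult_right_mono) auto
    also have "\<dots> = (M * a k t powr (1/p)) * \<bar>f t\<bar>" by (simp add: vec_k_def M_def)
    also have "\<dots> \<le> (M * a k t powr (1/p)) powr p / p + \<bar>f t\<bar> powr q / q"
      using M by (intro Youngs_inequality p q pq) auto
    finally show "f t * vec_k k t \<le> M powr p * a k t / p + \<bar>f t\<bar> powr q / q"
      by (simp add: powr_mult root)
  qed
  also have "\<dots> = M powr p * sum (a k) G / p + (\<Sum>t\<in>G. \<bar>f t\<bar> powr q) / q"
    by (simp add: sum.distrib sum_divide_distrib sum_distrib_left)
  also have "\<dots> \<le> M powr p * (1 / M) powr p / p + 1 / q"
  proof -
    have "sum (a k) G = sum (a k) (G \<inter> F k)" using a_0 fin by (intro sum.mono_neutral_right) auto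
    \<comment> \<open>The block starts at \<open>k + 2\<close> or later, so the uncontrolled initial
      coordinates of \<open>G\<close> miss it.\<close>
    also have "G \<inter> F k = (G \<inter> {k + 2..}) \<inter> F k" using F_ge by auto
    finally have "sum (a k) G \<le> (1 / M) powr p" using a_small[OF G(2)] by (simp add: M_def)
    then show ?thesis using NN_lq[OF f fin(2)] p q
      by (intro add_mono divide_right_mono mult_left_mono) auto
  qed
  also have "\<dots> = 1" using M pq by (simp add: powr_divide)
  finally have 2: "(\<Sum>t\<in>G. f t * vec_k k t) \<le> 1" .
  have "act f (vec_k k) = (\<Sum>t\<in>supp f - G. f t * vec_k k t) + (\<Sum>t\<in>G. f t * vec_k k t)"
    unfolding act_def by (rule sum.subset_diff[OF G(1) fin(1)])
  then show ?thesis using 1 2 by simp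
qed

lemma act_fun_vec: "act (fun_k k) (vec_k k') = (if k = k' then 1 else 0)"
proof (cases "k = k'")
  case True
  have "fun_k k t * vec_k k t = a k t" if "t \<in> F k" for t
  proof -
    have "fun_k k t * vec_k k t = a k t powr (1/q) * a k t powr (1/p)"
      using M_ge[of k] by (simp add: fun_k_def vec_k_def)
    also have "\<dots> = a k t powr 1" using pq by (simp add: add.commute flip: powr_add)
    finally show ?thesis using a_pos[OF that] by simp
  qed
  then show ?thesis using True a_sum by (simp add: act_def supp_fun_k)
next
  case False
  have "vec_k k' t = 0" if "t \<in> F k" for t
    using F_disjoint[OF False] that a_0[of t k'] by (auto simp: vec_k_def)
  then show ?thesis using False by (simp add: act_def supp_fun_k)
qed

end

section \<open>The operators\<close>

context MN_blocks
begin

lemma m_ge_power4: "1 \<le> j \<Longrightarrow> 4 ^ j \<le> m (2*j)"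
proof (induction j rule: dec_induct)
  case base
  then show ?case using m_ge4[of 2] by simp
next
  case (step j)
  have "4 * 4 ^ j \<le> m (2*j) * m (2*j)" using m_ge4[of "2*j"] step by (intro mult_le_mono) auto
  also have "\<dots> \<le> m (2*j) * m (2*j) ^ sx j"
    using sx_pos[of j] m_ge4[of "2*j"] step by (intro mult_le_mono2 self_le_power) auto
  finally show ?case using m_Suc[of j] step by simp
qed

lemma act_fun_k_le: "bdd x \<Longrightarrow> \<bar>act (fun_k k) x\<bar> \<le> nnorm NN x"
  using act_le fun_k_NN by blast

text \<open>Coordinates below \<open>j\<close> are estimated one at a time, at the cost of the
  factor \<open>j\<close>. The others, divided by \<open>D * S\<close>, are coefficients of a
  combination lying in \<open>NN\<close>; this works because the block number is also the output
  coordinate.\<close>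

lemma level_sum_bound:
  assumes x: "bdd x" and S: "0 < S" "\<And>t. \<bar>b t\<bar> \<le> S" and j: "2 \<le> j" and D: "0 < D"
    and A: "finite A" "A \<inter> {j..} \<in> schreier (\<kappa> j)" "(\<Sum>t\<in>A. \<bar>f t\<bar> powr q) \<le> D powr q"
  shows "\<bar>\<Sum>t\<in>A. f t * (b t * act (fun_k t) x)\<bar> \<le> (real j + 1) * D * (S * nnorm NN x)"
proof -
  let ?h = "\<lambda>t. f t * (b t * act (fun_k t) x)"
  have N0: "0 \<le> nnorm NN x" using nnorm_nonneg[OF x] .
  have fD: "\<bar>f t\<bar> \<le> D" if "t \<in> A" for t
  proof -
    have "\<bar>f t\<bar> powr q \<le> (\<Sum>t\<in>A. \<bar>f t\<bar> powr q)" by (rule member_le_sum) (use A that in auto)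
    then have "\<bar>f t\<bar> powr q \<le> D powr q" using A(3) by linarith
    then show ?thesis using q D powr_less_mono2[of q D "\<bar>f t\<bar>"] by (cases "\<bar>f t\<bar> \<le> D") auto
  qed
  have "\<bar>\<Sum>t\<in>A \<inter> {..<j}. ?h t\<bar> \<le> (\<Sum>t\<in>A \<inter> {..<j}. D * (S * nnorm NN x))"
  proof (rule order_trans[OF sum_abs sum_mono])
    fix t assume "t \<in> A \<inter> {..<j}"
    then show "\<bar>?h t\<bar> \<le> D * (S * nnorm NN x)"
      unfolding abs_mult using fD S act_fun_k_le[OF x] D by (intro mult_mono) auto
  qed
  also have "\<dots> = real (card (A \<inter> {..<j})) * (D * (S * nnorm NN x))" by simp
  also have "\<dots> \<le> real j * (D * (S * nnorm NN x))"
  proof (rule mult_right_mono)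
    have "card (A \<inter> {..<j}) \<le> card {..<j}" by (rule card_mono) auto
    then show "real (card (A \<inter> {..<j})) \<le> real j" by simp
  qed (use D S(1) N0 in auto)
  finally have low: "\<bar>\<Sum>t\<in>A \<inter> {..<j}. ?h t\<bar> \<le> real j * (D * (S * nnorm NN x))" .
  define B where "B = A \<inter> {j..}"
  have high: "\<bar>\<Sum>t\<in>B. ?h t\<bar> \<le> D * (S * nnorm NN x)"
  proof (cases "B = {}")
    case True
    then show ?thesis using D S(1) N0 by simp
  next
    case False
    define \<gamma> where "\<gamma> t = f t * b t / (D * S)" for t
    have "\<bar>\<gamma> t\<bar> powr q \<le> \<bar>f t\<bar> powr q / D powr q" for t
    proof -
      have "\<bar>\<gamma> t\<bar> \<le> \<bar>f t\<bar> * S / (D * S)" unfolding \<gamma>_def abs_divide abs_mult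
        using D S by (intro frac_le mult_left_mono) auto
      then have "\<bar>\<gamma> t\<bar> \<le> \<bar>f t\<bar> / D" using S(1) by simp
      then have "\<bar>\<gamma> t\<bar> powr q \<le> (\<bar>f t\<bar> / D) powr q" using q by (intro powr_mono2) auto
      then show ?thesis using D by (simp add: powr_divide)
    qed
    then have "(\<Sum>t\<in>B. \<bar>\<gamma> t\<bar> powr q) \<le> (\<Sum>t\<in>B. \<bar>f t\<bar> powr q) / D powr q"
      unfolding sum_divide_distrib by (intro sum_mono)
    also have "\<dots> \<le> (\<Sum>t\<in>A. \<bar>f t\<bar> powr q) / D powr q"
      using A(1) by (intro divide_right_mono sum_mono2) (auto simp: B_def)
    also have "\<dots> \<le> 1" using A(3) D by simp
    finally have "(\<lambda>t. \<Sum>k\<in>B. \<gamma> k * fun_k k t) \<in> NN"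
      using A(2) False by (intro fun_k_comb_NN[OF j]) (auto simp: B_def)
    then have "\<bar>\<Sum>k\<in>B. \<gamma> k * act (fun_k k) x\<bar> \<le> nnorm NN x"
      using act_le[OF x] act_lin_comb[of B fun_k \<gamma> x] A(1) F_finite
      by (fastforce simp: supp_fun_k B_def)
    moreover have "(\<Sum>t\<in>B. ?h t) = (D * S) * (\<Sum>k\<in>B. \<gamma> k * act (fun_k k) x)"
      using D S(1) by (simp add: \<gamma>_def sum_distrib_left mult.assoc)
    ultimately show ?thesis using D S(1) by (simp add: abs_mult mult.assoc mult_left_mono)
  qed
  have "A = (A \<inter> {..<j}) \<union> B" by (auto simp: B_def)
  then have "(\<Sum>t\<in>A. ?h t) = (\<Sum>t\<in>A \<inter> {..<j}. ?h t) + (\<Sum>t\<in>B. ?h t)"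
    using A(1) by (subst sum.union_disjoint[symmetric]) (auto simp: B_def)
  then show ?thesis using low high by (simp add: algebra_simps)
qed

text \<open>Coordinates are sorted by the first level \<open>lev t\<close> at which they are heavy.
  Those of level \<open>j > 2\<close> were light at \<open>j - 1\<close>, so their norm is at most
  \<open>1 / m (2*(j - 1))\<close>, hence \<open>(1/4) ^ (j - 2)\<close>, a bound that also covers
  \<open>j = 2\<close>. With the factor \<open>j + 1\<close> the terms are at most
  \<open>3 * (1/2) ^ (j - 2)\<close>, with sum at most 6.\<close>

lemma operator_bound:
  assumes f: "f \<in> NN" and x: "bdd x" and S: "0 \<le> S" "\<And>t. \<bar>b t\<bar> \<le> S"
  shows "\<bar>\<Sum>t\<in>supp f. f t * (b t * act (fun_k t) x)\<bar> \<le> 6 * (S * nnorm NN x)"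
proof (cases "S = 0")
  case True
  then have "b t = 0" for t using S(2)[of t] by simp
  then show ?thesis using True by simp
next
  case False
  then have S0: "0 < S" using S by simp
  let ?h = "\<lambda>t. f t * (b t * act (fun_k t) x)"
  have N0: "0 \<le> S * nnorm NN x" using nnorm_nonneg[OF x] S by simp
  have fin: "finite (supp f)" using NN_finite[OF f] .
  have "\<forall>j\<in>{2..}. \<exists>G. G \<subseteq> supp f \<and> G \<inter> {j..} \<in> schreier (\<kappa> j) \<and>
    (\<Sum>t\<in>supp f - G. \<bar>f t\<bar> powr q) \<le> (1 / real (m (2*j))) powr q"
    using NN_level[OF f] by (metis atLeast_iff)
  then obtain G where G: "\<And>j. 2 \<le> j \<Longrightarrow> G j \<subseteq> supp f" "\<And>j. 2 \<le> j \<Longrightarrow> G j \<inter> {j..} \<in> schreier (\<kappa> j)"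
    "\<And>j. 2 \<le> j \<Longrightarrow> (\<Sum>t\<in>supp f - G j. \<bar>f t\<bar> powr q) \<le> (1 / real (m (2*j))) powr q"
    unfolding bchoice_iff by auto
  have m4: "1 / real (m (2*j)) \<le> (1/4) ^ j" if "1 \<le> j" for j
  proof -
    have "real (4 ^ j) \<le> real (m (2*j))" using m_ge_power4[OF that] by (simp only: of_nat_le_iff)
    then show ?thesis by (simp add: power_divide frac_le)
  qed
  obtain k where k: "\<And>t. t \<in> supp f \<Longrightarrow> (1/2::real) ^ k < \<bar>f t\<bar>" using finite_large[OF fin] by blast
  \<comment> \<open>At this level the bound \<open>1 / m (2*J)\<close> is below every nonzero
    coordinate, so all of them are heavy and the levels end at \<open>J\<close>.\<close>
  define J where "J = max 2 k"
  have all: "supp f \<subseteq> G J"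
  proof (rule ccontr)
    assume "\<not> supp f \<subseteq> G J"
    then obtain t where t: "t \<in> supp f" "t \<notin> G J" by blast
    have "\<bar>f t\<bar> powr q \<le> (\<Sum>t\<in>supp f - G J. \<bar>f t\<bar> powr q)" by (rule member_le_sum) (use t fin in auto)
    also have "\<dots> \<le> (1 / real (m (2*J))) powr q" by (rule G(3)) (simp add: J_def)
    finally have "\<bar>f t\<bar> \<le> 1 / real (m (2*J))"
      using q powr_less_mono2[of q "1 / real (m (2*J))" "\<bar>f t\<bar>"] by (cases "\<bar>f t\<bar> \<le> 1 / real (m (2*J))") auto
    also have "\<dots> \<le> (1/4) ^ J" by (rule m4) (simp add: J_def)
    also have "\<dots> \<le> (1/2::real) ^ J" by (rule power_mono) auto
    also have "\<dots> \<le> (1/2) ^ k" by (rule power_decreasing) (auto simp: J_def)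
    finally show False using k[OF t(1)] by simp
  qed
  define lev where "lev t = (LEAST j. 2 \<le> j \<and> t \<in> G j)" for t
  have lev: "2 \<le> lev t" "t \<in> G (lev t)" "lev t \<le> J" "\<And>j. 2 \<le> j \<Longrightarrow> j < lev t \<Longrightarrow> t \<notin> G j"
    if "t \<in> supp f" for t
  proof -
    have ex: "2 \<le> J \<and> t \<in> G J" using all that by (auto simp: J_def)
    show "2 \<le> lev t" "t \<in> G (lev t)" using LeastI[of "\<lambda>j. 2 \<le> j \<and> t \<in> G j", OF ex] by (auto simp: lev_def)
    show "lev t \<le> J" unfolding lev_def by (rule Least_le) (use ex in simp)
    show "t \<notin> G j" if "2 \<le> j" "j < lev t" for j
      using not_less_Least[of j "\<lambda>j. 2 \<le> j \<and> t \<in> G j"] that by (auto simp: lev_def)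
  qed
  define L where "L j = {t \<in> supp f. lev t = j}" for j
  have part: "\<bar>\<Sum>t\<in>L j. ?h t\<bar> \<le> (real j + 1) * (1/4) ^ (j - 2) * (S * nnorm NN x)" if j: "2 \<le> j" for j
  proof (rule level_sum_bound[OF x S0 S(2) j])
    show "finite (L j)" using fin by (simp add: L_def)
    show "L j \<inter> {j..} \<in> schreier (\<kappa> j)"
      by (rule schreier_subset[OF G(2)[OF j]]) (use lev(2) in \<open>auto simp: L_def\<close>)
    show "(\<Sum>t\<in>L j. \<bar>f t\<bar> powr q) \<le> ((1/4) ^ (j - 2)) powr q"
    proof (cases "j = 2")
      case True
      then show ?thesis using NN_lq[OF f, of "L j"] fin by (simp add: L_def)
    next
      case False
      have "(\<Sum>t\<in>L j. \<bar>f t\<bar> powr q) \<le> (\<Sum>t\<in>supp f - G (j - 1). \<bar>f t\<bar> powr q)"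
        using fin lev(4)[of _ "j - 1"] False j by (intro sum_mono2) (auto simp: L_def)
      also have "\<dots> \<le> (1 / real (m (2*(j - 1)))) powr q" by (rule G(3)) (use False j in simp)
      also have "\<dots> \<le> ((1/4) ^ (j - 2)) powr q"
      proof (rule powr_mono2)
        have "1 / real (m (2*(j - 1))) \<le> (1/4) ^ (j - 1)" by (rule m4) (use j in simp)
        also have "\<dots> \<le> (1/4::real) ^ (j - 2)" by (rule power_decreasing) auto
        finally show "1 / real (m (2*(j - 1))) \<le> (1/4) ^ (j - 2)" .
      qed (use q in auto)
      finally show ?thesis .
    qed
  qed simp
  have geo: "(real j + 1) * (1/4) ^ (j - 2) \<le> 3 * (1/2) ^ (j - 2)" if "2 \<le> j" for j
  proof -
    have "real i + 3 \<le> 3 * 2 ^ i" for i by (induction i) auto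
    from this[of "j - 2"] have "real j + 1 \<le> 3 * 2 ^ (j - 2)" using that by (simp add: of_nat_diff)
    then have "(real j + 1) * (1/4) ^ (j - 2) \<le> 3 * 2 ^ (j - 2) * (1/4) ^ (j - 2)"
      by (intro mult_right_mono) auto
    also have "\<dots> = 3 * (2 * (1/4)) ^ (j - 2)" by (simp only: power_mult_distrib mult.assoc)
    also have "\<dots> = 3 * (1/2) ^ (j - 2)" by simp
    finally show ?thesis .
  qed
  have "(\<Sum>t\<in>supp f. ?h t) = (\<Sum>j\<in>{2..J}. \<Sum>t\<in>L j. ?h t)"
    unfolding L_def by (rule sum.group[symmetric]) (use fin lev in auto)
  also have "\<bar>\<dots>\<bar> \<le> (\<Sum>j\<in>{2..J}. 3 * (1/2) ^ (j - 2) * (S * nnorm NN x))"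
  proof (rule order_trans[OF sum_abs sum_mono])
    fix j assume "j \<in> {2..J}"
    then have j: "2 \<le> j" by simp
    show "\<bar>\<Sum>t\<in>L j. ?h t\<bar> \<le> 3 * (1/2) ^ (j - 2) * (S * nnorm NN x)"
      by (rule order_trans[OF part[OF j] mult_right_mono[OF geo[OF j] N0]])
  qed
  also have "\<dots> = 3 * (\<Sum>j\<in>{2..J}. (1/2) ^ (j - 2)) * (S * nnorm NN x)"
    by (simp add: sum_distrib_left sum_distrib_right)
  also have "(\<Sum>j\<in>{2..J}. (1/2::real) ^ (j - 2)) = (\<Sum>i\<in>{0..J - 2}. (1/2) ^ i)"
    by (rule sum.reindex_bij_witness[of _ "\<lambda>i. i + 2" "\<lambda>j. j - 2"]) (auto simp: J_def)
  also have "3 * (\<Sum>i\<in>{0..J - 2}. (1/2::real) ^ i) * (S * nnorm NN x) \<le> 3 * 2 * (S * nnorm NN x)"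
  proof (intro mult_right_mono mult_left_mono N0)
    have "(\<Sum>i\<in>{0..k}. (1/2::real) ^ i) = 2 - (1/2) ^ k" for k by (induction k) auto
    then show "(\<Sum>i\<in>{0..J - 2}. (1/2::real) ^ i) \<le> 2" by simp
  qed simp
  finally show ?thesis by simp
qed

text \<open>Vectors of the space vanish at coordinate 0. The shift \<open>t - 1\<close> pairs the
  entry \<open>b k\<close> of a sequence indexed from 0 with block \<open>Suc k\<close>.\<close>

definition block_op :: "(nat \<Rightarrow> real) \<Rightarrow> (nat \<Rightarrow> real) \<Rightarrow> nat \<Rightarrow> real" where
  "block_op b x t = (if t = 0 then 0 else b (t - 1) * act (fun_k t) x)"

lemma block_op_bound:
  assumes x: "bdd x" and S: "0 \<le> S" "\<And>t. \<bar>b t\<bar> \<le> S"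
  shows "nnorm NN (block_op b x) \<le> 6 * (S * nnorm NN x)" "bdd (block_op b x)"
proof -
  have *: "act f (block_op b x) \<le> 6 * (S * nnorm NN x)" if f: "f \<in> NN" for f
  proof -
    have "act f (block_op b x) = (\<Sum>t\<in>supp f. f t * (b (t - 1) * act (fun_k t) x))"
      unfolding act_def[of f] using NN_0[OF f] by (intro sum.cong) (auto simp: block_op_def supp_def)
    then show ?thesis using operator_bound[OF f x S(1), of "\<lambda>t. b (t - 1)"] S(2) by simp
  qed
  show "nnorm NN (block_op b x) \<le> 6 * (S * nnorm NN x)" by (rule nnorm_le(1)[OF *])
  show "bdd (block_op b x)" by (rule nnorm_le(2)[OF *])
qed

text \<open>Coordinate \<open>t\<close> of the image depends only on coordinates of \<open>x\<close>
  from \<open>t + 2\<close> on, so a tail of the image is the image of the tail under truncated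
  multipliers; the cut \<open>t < k\<close> accounts for the shift by one.\<close>

lemma block_op_XN:
  assumes x: "x \<in> XN NN" and S: "0 \<le> S" "\<And>t. \<bar>b t\<bar> \<le> S"
  shows "block_op b x \<in> XN NN"
proof (rule XN_I)
  show "bdd (block_op b x)" using block_op_bound(2)[OF XN_bdd[OF x] S] .
  show "nnorm NN (tail k (block_op b x)) \<le> 6 * (S * nnorm NN (tail k x))" for k
  proof -
    define b' where "b' t = (if t < k then 0 else b t)" for t
    have eq: "act (fun_k t) (tail k x) = act (fun_k t) x" if "k < t" for t
      unfolding act_def supp_fun_k using F_ge[of _ t] that by (intro sum.cong) fastforce+
    have "tail k (block_op b x) = block_op b' (tail k x)"
      by (rule ext) (auto simp: block_op_def b'_def eq)
    moreover have "\<bar>b' t\<bar> \<le> S" for t using S by (simp add: b'_def)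
    ultimately show ?thesis using block_op_bound(1)[OF nnorm_tail(2)[OF XN_bdd[OF x]] S(1), of b'] by simp
  qed
  show "(\<lambda>k. 6 * (S * nnorm NN (tail k x))) \<longlonglongrightarrow> 0"
    using tendsto_mult_right_zero[OF tendsto_mult_right_zero[OF XN_tail[OF x]], of 6 S] by simp
qed (simp add: block_op_def)

lemma bounded_block_op:
  assumes "0 \<le> S" "\<And>t. \<bar>b t\<bar> \<le> S"
  shows "bounded_op NN (block_op b)"
  unfolding bounded_op_def
proof (intro conjI ballI allI)
  show "\<exists>C. \<forall>x\<in>XN NN. nnorm NN (block_op b x) \<le> C * nnorm NN x"
    using block_op_bound(1)[OF XN_bdd assms] by (intro exI[of _ "6 * S"]) (simp add: mult.assoc)
qed (use block_op_XN[OF _ assms] in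
    \<open>auto simp: block_op_def act_add act_scale fun_eq_iff algebra_simps\<close>)

section \<open>Test vectors and kernel vectors\<close>

lemma vec_k_XN: "vec_k k \<in> XN NN"
proof (rule XN_finite)
  have "0 \<notin> F k" using F_ge[of 0 k] by auto
  then show "vec_k k 0 = 0" using a_0 by (simp add: vec_k_def)
  have "supp (vec_k k) \<subseteq> F k" using a_0 by (auto simp: supp_def vec_k_def)
  then show "finite (supp (vec_k k))" using F_finite finite_subset by blast
qed

definition unit_vec :: "nat \<Rightarrow> nat \<Rightarrow> real" where
  "unit_vec k = (\<lambda>i. (1/2) * vec_k (Suc k) i)"

lemma unit_vec_XN: "unit_vec k \<in> XN NN"
  unfolding unit_vec_def by (rule XN_scale[OF vec_k_XN])

lemma nnorm_unit_vec: "nnorm NN (unit_vec k) \<le> 1"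
proof -
  have "nnorm NN (vec_k (Suc k)) \<le> 2" by (rule nnorm_le(1)) (rule act_vec_k_le)
  then show ?thesis unfolding unit_vec_def
    using nnorm_scale_le(1)[OF XN_bdd[OF vec_k_XN], of "1/2" "Suc k"] by simp
qed

lemma block_op_unit_vec: "block_op b (unit_vec k) = (\<lambda>i. (b k / 2) * unitf (Suc k) i)"
proof -
  have "act (fun_k i) (unit_vec k) = (if i = Suc k then 1/2 else 0)" for i
    unfolding unit_vec_def act_scale act_fun_vec by simp
  then show ?thesis by (auto simp: fun_eq_iff block_op_def unitf_def)
qed

text \<open>The strict inequality \<open>Max (F k) + 1 < t\<close> between consecutive blocks keeps
  these points out of every block.\<close>

definition gaps :: "nat set" where
  "gaps = range (\<lambda>k. Max (F k) + 1)"

lemma inj_gaps: "inj (\<lambda>k. Max (F k) + 1)"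
proof (rule linorder_injI)
  fix k k' :: nat assume "k < k'"
  then have "Max (F k) + 1 < Max (F k')" using F_max_less Max_in[OF F_finite F_ne] by blast
  then show "Max (F k) + 1 \<noteq> Max (F k') + 1" by simp
qed

lemma gaps_disjoint: "gaps \<inter> F k = {}"
proof -
  have "Max (F i) + 1 \<notin> F k" for i
  proof (cases "i < k")
    case True
    then show ?thesis using F_max_less[of i k] by blast
  next
    case False
    have "t \<le> Max (F i)" if "t \<in> F k" for t
    proof (cases "k = i")
      case True
      then show ?thesis using that F_finite by simp
    next
      case False
      then have "t < Max (F i)" using F_less[of k i] that \<open>\<not> i < k\<close> Max_in[OF F_finite F_ne, of i]
        by (auto simp: set_less_def)
      then show ?thesis by simp
    qed
    then show ?thesis by fastforce
  qed
  then show ?thesis by (auto simp: gaps_def)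
qed

lemma block_op_gaps:
  assumes "\<forall>i. i \<notin> gaps \<longrightarrow> x i = 0"
  shows "block_op b x = (\<lambda>i. 0)"
proof -
  have "act (fun_k k) x = 0" for k
    unfolding act_def supp_fun_k using gaps_disjoint[of k] assms by (intro sum.neutral) auto
  then show ?thesis by (auto simp: block_op_def)
qed

text \<open>On the unit vectors at gaps the operator vanishes, so \<open>K\<close> acts as
  \<open>- c\<close> and compactness forces \<open>c = 0\<close>. Then \<open>K\<close> agrees with
  the operator, which sends the test vectors to halves of distinct unit vectors.\<close>

lemma block_op_not_scalar_plus_compact:
  "\<not> (\<exists>c K. compact_op NN K \<and> (\<forall>x\<in>XN NN. block_op (\<lambda>_. 1) x = (\<lambda>i. c * x i + K x i)))"
proof
  assume "\<exists>c K. compact_op NN K \<and> (\<forall>x\<in>XN NN. block_op (\<lambda>_. 1) x = (\<lambda>i. c * x i + K x i))"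
  then obtain c K where K: "compact_op NN K"
    "\<And>x. x \<in> XN NN \<Longrightarrow> block_op (\<lambda>_. 1) x = (\<lambda>i. c * x i + K x i)" by blast
  define g where "g k = Max (F k) + 1" for k
  have "K (unitf (g k)) = (\<lambda>i. (- c) * unitf (g k) i)" for k
  proof -
    have "block_op (\<lambda>_. 1) (unitf (g k)) = (\<lambda>i. 0)"
      by (rule block_op_gaps) (auto simp: unitf_def gaps_def g_def)
    moreover have "unitf (g k) \<in> XN NN" by (rule unitf_XN) (simp add: g_def)
    ultimately have "(\<lambda>i. 0) = (\<lambda>i. c * unitf (g k) i + K (unitf (g k)) i)" using K(2) by metis
    then show ?thesis by (simp add: fun_eq_iff eq_neg_iff_add_eq_0 add.commute)
  qed
  then have "- c = 0"
    using inj_gaps by (intro compact_op_unit_images[OF K(1), of "\<lambda>k. unitf (g k)" _ g])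
      (auto simp: g_def[abs_def] intro!: unitf_XN nnorm_unitf)
  then have "K (unit_vec k) = (\<lambda>i. (1/2) * unitf (Suc k) i)" for k
    using K(2)[OF unit_vec_XN] block_op_unit_vec[of "\<lambda>_. 1" k] by (simp add: fun_eq_iff)
  then have "1/2 = (0::real)"
    by (intro compact_op_unit_images[OF K(1), of unit_vec _ Suc]) (auto intro: unit_vec_XN nnorm_unit_vec)
  then show False by simp
qed

lemma noncompact_operator:
  "\<exists>T. bounded_op NN T
     \<and> \<not> (\<exists>c K. compact_op NN K \<and> (\<forall>x\<in>XN NN. T x = (\<lambda>i. c * x i + K x i)))
     \<and> (hered_indec NN \<longrightarrow> strictly_singular NN T \<and> \<not> compact_op NN T)"
proof (intro exI[of _ "block_op (\<lambda>_. 1)"] conjI impI block_op_not_scalar_plus_compact)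
  show bd: "bounded_op NN (block_op (\<lambda>_. 1))" by (rule bounded_block_op[of 1]) auto
  have "infinite gaps" unfolding gaps_def using inj_gaps by (simp add: range_inj_infinite)
  moreover have "0 \<notin> gaps" by (auto simp: gaps_def)
  ultimately show "strictly_singular NN (block_op (\<lambda>_. 1))" if "hered_indec NN"
    using strictly_singular_if_large_kernel[OF that bd] block_op_gaps by blast
  show "\<not> compact_op NN (block_op (\<lambda>_. 1))"
  proof
    assume "compact_op NN (block_op (\<lambda>_. 1))"
    then have "\<exists>c K. compact_op NN K \<and> (\<forall>x\<in>XN NN. block_op (\<lambda>_. 1) x = (\<lambda>i. c * x i + K x i))"
      by (intro exI[of _ 0] exI[of _ "block_op (\<lambda>_. 1)"]) simp
    then show False using block_op_not_scalar_plus_compact by blast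
  qed
qed

text \<open>The constant 6 comes from \<open>operator_bound\<close>; the constant 1/2 comes from the
  test vectors, since one coordinate of the image of \<open>unit_vec k\<close> is
  \<open>b k / 2\<close>.\<close>

lemma linf_embeds: "linf_embeds NN"
  unfolding linf_embeds_def
proof (intro exI[of _ block_op] conjI)
  have le: "\<bar>b i\<bar> \<le> sup_norm b" if "bounded_seq b" for b i
    using that unfolding bounded_seq_def sup_norm_def by (intro cSUP_upper) auto
  have nonneg: "0 \<le> sup_norm b" if "bounded_seq b" for b using le[OF that, of 0] by linarith
  show "\<forall>b. bounded_seq b \<longrightarrow> bounded_op NN (block_op b)"
    using bounded_block_op[of "sup_norm b" b for b] nonneg le by blast
  show "\<exists>c C. 0 < c \<and> (\<forall>b. bounded_seq b \<longrightarrow>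
      c * sup_norm b \<le> op_norm NN (block_op b) \<and> op_norm NN (block_op b) \<le> C * sup_norm b)"
  proof (rule exI[of _ "1/2"], rule exI[of _ 6], intro conjI allI impI)
    fix b assume b: "bounded_seq b"
    let ?S = "{nnorm NN (block_op b x) |x. x \<in> XN NN \<and> nnorm NN x \<le> 1}"
    have upper: "y \<le> 6 * sup_norm b" if "y \<in> ?S" for y
    proof -
      obtain x where x: "y = nnorm NN (block_op b x)" "x \<in> XN NN" "nnorm NN x \<le> 1"
        using \<open>y \<in> ?S\<close> by blast
      have "y \<le> 6 * (sup_norm b * nnorm NN x)"
        unfolding x(1) by (rule block_op_bound(1)[OF XN_bdd[OF x(2)] nonneg[OF b] le[OF b]])
      also have "\<dots> \<le> 6 * (sup_norm b * 1)"
        using x(3) nonneg[OF b] by (intro mult_left_mono) auto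
      finally show ?thesis by simp
    qed
    have "?S \<noteq> {}" using XN_zero nnorm_zero(2) by fastforce
    then show "op_norm NN (block_op b) \<le> 6 * sup_norm b"
      unfolding op_norm_def using upper by (intro cSup_least) auto
    have "\<bar>b k\<bar> \<le> 2 * op_norm NN (block_op b)" for k
    proof -
      have "\<bar>block_op b (unit_vec k) (Suc k)\<bar> \<le> nnorm NN (block_op b (unit_vec k))"
        by (rule coord_le[OF block_op_bound(2)[OF XN_bdd[OF unit_vec_XN] nonneg[OF b] le[OF b]]]) simp
      also have "\<dots> \<le> op_norm NN (block_op b)" unfolding op_norm_def
        using upper unit_vec_XN nnorm_unit_vec by (intro cSup_upper bdd_aboveI[of _ "6 * sup_norm b"]) auto
      finally show ?thesis by (simp add: block_op_unit_vec unitf_def)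
    qed
    then have "sup_norm b \<le> 2 * op_norm NN (block_op b)"
      unfolding sup_norm_def by (intro cSUP_least) auto
    then show "1/2 * sup_norm b \<le> op_norm NN (block_op b)" by simp
  qed simp
qed (auto simp: block_op_def fun_eq_iff algebra_simps)

end

theorem mainTheorem1:
  fixes p q :: real and m n :: "nat \<Rightarrow> nat" and NN :: "(nat \<Rightarrow> real) set"
  assumes "1 < p" and "1 < q" and "1/p + 1/q = 1"
    and "cond_MN m n"
    and "MNq_schreier m n p q NN"
  shows "(\<exists>T. bounded_op NN T
            \<and> \<not> (\<exists>c K. compact_op NN K \<and> (\<forall>x\<in>XN NN. T x = (\<lambda>i. c * x i + K x i)))
            \<and> (hered_indec NN \<longrightarrow> strictly_singular NN T \<and> \<not> compact_op NN T))
         \<and> linf_embeds NN"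
proof -
  obtain s where "incr_pos s" "\<forall>j\<ge>2. m (2*j) = (\<Prod>i\<in>{1..<j}. m (2*i) ^ s i)"
    using assms(4) by (auto simp: cond_MN_def)
  then interpret MN_schreier_space p q m n NN s
    using assms by unfold_locales auto
  obtain F a where "\<And>k. F k \<in> schreier (Suc (\<kappa> (k + 2)))" "\<And>k. F k \<noteq> {}"
    "\<And>k t. t \<in> F k \<Longrightarrow> k + 2 \<le> t \<and> 0 < a k t" "\<And>k t. t \<notin> F k \<Longrightarrow> a k t = (0::real)"
    "\<And>k. sum (a k) (F k) = 1"
    "\<And>k G. G \<in> schreier (\<kappa> (k + 2)) \<Longrightarrow> sum (a k) (G \<inter> F k) < (1 / real (m (2 * (k + 2)))) powr p"
    "\<And>k t. t \<in> F (Suc k) \<Longrightarrow> Max (F k) + 1 < t"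
    using blocks_exist by blast
  then interpret MN_blocks p q m n NN s F a by unfold_locales auto
  show ?thesis using noncompact_operator linf_embeds by blast
qed

end
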